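(* Let $X$ be a compact complex manifold of complex dimension $n$, and let $0\le p,q\le n$. Then $$\dim\operatorname{im}\left(\pi_{\bar\partial}:H^{p,q}_{BC}\to H^{p,q}_{\bar\partial}\right)=k^{p,q}+\dim\ker\left(\pi_A:H^{p,q}_{\bar\partial}\to H^{p,q}_A\right).$$
   Context: On smooth complex-valued $(p,q)$-forms on $X$, define $$H^{p,q}_{BC}=\frac{\ker(\partial)\cap\ker(\bar\partial)}{\operatorname{im}(\partial\bar\partial)},\quad H^{p,q}_A=\frac{\ker(\partial\bar\partial)}{\operatorname{im}(\partial)+\operatorname{im}(\bar\partial)},\quad H^{p,q}_{\bar\partial}=\frac{\ker(\bar\partial)}{\operatorname{im}(\bar\partial)},\quad K^{p,q}=\frac{\ker(\partial)\cap\ker(\bar\partial)}{\operatorname{im}(\partial)\cap\ker(\bar\partial)+\operatorname{im}(\bar\partial)\cap\ker(\partial)},$$ all spaces in bidegree $(p,q)$, and $k^{p,q}=\dim_{\mathbb C}K^{p,q}$. The maps $\pi_{\bar\partial}$ and $\pi_A$ are the natural maps induced by the identity on forms: $\pi_{\bar\partial}[\theta]_{BC}=[\theta]_{\bar\partial}$ and $\pi_A[\theta]_{\bar\partial}=[\theta]_A$. *)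

theory Defs
  imports
    "HOL-Analysis.Analysis"
    "HOL-Library.Extended_Nat"
    "HOL-Library.Function_Algebras"
    "HOL-Library.Set_Algebras"
begin

section \<open>Calculus on open subsets of complex n-space\<close>

text \<open>
  Points of complex n-space are sequences vanishing from index \<open>n\<close> on, exactly as in
  \<^const>\<open>Euclidean_space\<close>; the coordinates are numbered \<open>0, \<dots>, n - 1\<close>, and \<open>n = 0\<close> is allowed.
\<close>

definition Cspace :: "nat \<Rightarrow> (nat \<Rightarrow> complex) set" where
  "Cspace n = {z. \<forall>i\<ge>n. z i = 0}"

text \<open>
  With \<open>z\<^sub>i = x\<^sub>i + \<i> y\<^sub>i\<close>, the operator \<open>pd 1 i\<close> is the partial derivative along \<open>x\<^sub>i\<close>, and
  \<open>pd \<i> i\<close> is the one along \<open>y\<^sub>i\<close>.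
\<close>

definition pd :: "complex \<Rightarrow> nat \<Rightarrow> ((nat \<Rightarrow> complex) \<Rightarrow> complex) \<Rightarrow> (nat \<Rightarrow> complex) \<Rightarrow> complex" where
  "pd u i f z = vector_derivative (\<lambda>t::real. f (z(i := z i + of_real t * u))) (at 0)"

definition d_z :: "nat \<Rightarrow> ((nat \<Rightarrow> complex) \<Rightarrow> complex) \<Rightarrow> (nat \<Rightarrow> complex) \<Rightarrow> complex" where
  "d_z i f z = (pd 1 i f z - \<i> * pd \<i> i f z) / 2"

definition d_zbar :: "nat \<Rightarrow> ((nat \<Rightarrow> complex) \<Rightarrow> complex) \<Rightarrow> (nat \<Rightarrow> complex) \<Rightarrow> complex" where
  "d_zbar i f z = (pd 1 i f z + \<i> * pd \<i> i f z) / 2"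

text \<open>In the following three definitions \<open>D\<close> is meant to be open in \<^term>\<open>Cspace n\<close>.\<close>

primrec Ck_on :: "nat \<Rightarrow> nat \<Rightarrow> (nat \<Rightarrow> complex) set \<Rightarrow> ((nat \<Rightarrow> complex) \<Rightarrow> complex) \<Rightarrow> bool" where
  "Ck_on n 0 D f \<longleftrightarrow> continuous_on D f"
| "Ck_on n (Suc k) D f \<longleftrightarrow>
     continuous_on D f \<and>
     (\<forall>i<n. \<forall>u\<in>{1, \<i>}.
        (\<forall>z\<in>D. (\<lambda>t::real. f (z(i := z i + of_real t * u))) differentiable (at 0)) \<and>
        Ck_on n k D (pd u i f))"

definition smooth_on :: "nat \<Rightarrow> (nat \<Rightarrow> complex) set \<Rightarrow> ((nat \<Rightarrow> complex) \<Rightarrow> complex) \<Rightarrow> bool" where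
  "smooth_on n D f \<longleftrightarrow> (\<forall>k. Ck_on n k D f)"

text \<open>Holomorphic functions of several variables: smooth solutions of the Cauchy--Riemann equations.\<close>

definition holo_on :: "nat \<Rightarrow> (nat \<Rightarrow> complex) set \<Rightarrow> ((nat \<Rightarrow> complex) \<Rightarrow> complex) \<Rightarrow> bool" where
  "holo_on n D f \<longleftrightarrow> smooth_on n D f \<and> (\<forall>z\<in>D. \<forall>i<n. d_zbar i f z = 0)"


section \<open>Complex manifolds\<close>

text \<open>A chart is a pair of its domain and its coordinate map; the latter is only relevant on the domain.\<close>

type_synonym 'a chart = "'a set \<times> ('a \<Rightarrow> nat \<Rightarrow> complex)"

definition is_chart :: "nat \<Rightarrow> 'a topology \<Rightarrow> 'a chart \<Rightarrow> bool" where
  "is_chart n X c \<longleftrightarrow> (case c of (U, \<phi>) \<Rightarrow>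
     openin X U \<and>
     openin (top_of_set (Cspace n)) (\<phi> ` U) \<and>
     homeomorphic_map (subtopology X U) (top_of_set (\<phi> ` U)) \<phi>)"

text \<open>A function on the domain of a chart, read in the coordinates of that chart.\<close>

definition in_chart :: "'a chart \<Rightarrow> ('a \<Rightarrow> complex) \<Rightarrow> (nat \<Rightarrow> complex) \<Rightarrow> complex" where
  "in_chart c f z = f (inv_into (fst c) (snd c) z)"

definition holo_compatible :: "nat \<Rightarrow> 'a chart \<Rightarrow> 'a chart \<Rightarrow> bool" where
  "holo_compatible n c d \<longleftrightarrow>
     (\<forall>a<n. holo_on n (snd c ` (fst c \<inter> fst d)) (in_chart c (\<lambda>x. snd d x a)))"

definition complex_manifold :: "nat \<Rightarrow> 'a topology \<Rightarrow> 'a chart set \<Rightarrow> bool" where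
  "complex_manifold n X \<A> \<longleftrightarrow>
     Hausdorff_space X \<and> second_countable X \<and>
     (\<forall>c\<in>\<A>. is_chart n X c) \<and>
     (\<Union>c\<in>\<A>. fst c) = topspace X \<and>
     (\<forall>c\<in>\<A>. \<forall>d\<in>\<A>. holo_compatible n c d)"

definition compact_complex_manifold :: "nat \<Rightarrow> 'a topology \<Rightarrow> 'a chart set \<Rightarrow> bool" where
  "compact_complex_manifold n X \<A> \<longleftrightarrow> complex_manifold n X \<A> \<and> compact_space X"


section \<open>Smooth forms of type (p,q)\<close>

text \<open>
  A form is given by its components in all charts of the atlas: in the chart \<open>c\<close> with coordinates \<open>z\<close>,
  \<open>\<omega> = 1/(p! q!) \<Sum> \<omega> c I J dz\<^sub>I\<^sub>1 \<and> \<dots> \<and> dz\<^sub>I\<^sub>p \<and> dzbar\<^sub>J\<^sub>1 \<and> \<dots> \<and> dzbar\<^sub>J\<^sub>q\<close>,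
  summed over all index lists \<open>I\<close> of length \<open>p\<close> and \<open>J\<close> of length \<open>q\<close>. The components are
  antisymmetric in \<open>I\<close> and in \<open>J\<close>, are functions on the domain of the chart, and are \<open>0\<close> outside
  the meaningful range of the arguments, so that equality of forms is equality of functions.
\<close>

type_synonym 'a form = "'a chart \<Rightarrow> nat list \<Rightarrow> nat list \<Rightarrow> 'a \<Rightarrow> complex"

definition cscale :: "complex \<Rightarrow> 'a form \<Rightarrow> 'a form" where
  "cscale a \<omega> = (\<lambda>c I J x. a * \<omega> c I J x)"

definition indices :: "nat \<Rightarrow> nat \<Rightarrow> nat list set" where
  "indices n k = {I. length I = k \<and> set I \<subseteq> {..<n}}"

definition swap_entries :: "nat \<Rightarrow> nat \<Rightarrow> nat list \<Rightarrow> nat list" where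
  "swap_entries s t I = I[s := I ! t, t := I ! s]"

text \<open>
  The derivative at \<open>x\<close> of the \<open>a\<close>-th coordinate of the chart \<open>d\<close> by the \<open>i\<close>-th coordinate of the
  chart \<open>c\<close>.
\<close>

definition jac :: "'a chart \<Rightarrow> 'a chart \<Rightarrow> nat \<Rightarrow> nat \<Rightarrow> 'a \<Rightarrow> complex" where
  "jac c d a i x = d_z i (in_chart c (\<lambda>y. snd d y a)) (snd c x)"

definition forms :: "nat \<Rightarrow> 'a chart set \<Rightarrow> nat \<Rightarrow> nat \<Rightarrow> 'a form set" where
  "forms n \<A> p q = {\<omega>.
     (\<forall>c I J x. \<not> (c \<in> \<A> \<and> I \<in> indices n p \<and> J \<in> indices n q \<and> x \<in> fst c) \<longrightarrow> \<omega> c I J x = 0) \<and>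
     (\<forall>c\<in>\<A>. \<forall>I\<in>indices n p. \<forall>J\<in>indices n q.
        smooth_on n (snd c ` fst c) (in_chart c (\<omega> c I J))) \<and>
     (\<forall>c\<in>\<A>. \<forall>I\<in>indices n p. \<forall>J\<in>indices n q. \<forall>x\<in>fst c.
        (\<forall>s<p. \<forall>t<p. s \<noteq> t \<longrightarrow> \<omega> c (swap_entries s t I) J x = - \<omega> c I J x) \<and>
        (\<forall>s<q. \<forall>t<q. s \<noteq> t \<longrightarrow> \<omega> c I (swap_entries s t J) x = - \<omega> c I J x)) \<and>
     (\<forall>c\<in>\<A>. \<forall>d\<in>\<A>. \<forall>I\<in>indices n p. \<forall>J\<in>indices n q. \<forall>x\<in>fst c \<inter> fst d.
        \<omega> c I J x =
          (\<Sum>A\<in>indices n p. \<Sum>B\<in>indices n q.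
             \<omega> d A B x * (\<Prod>s<p. jac c d (A ! s) (I ! s) x)
                       * (\<Prod>t<q. cnj (jac c d (B ! t) (J ! t) x))))}"

definition omit :: "nat \<Rightarrow> nat list \<Rightarrow> nat list" where
  "omit s I = take s I @ drop (Suc s) I"

text \<open>
  The components of \<open>\<Sum>\<^sub>i dz\<^sub>i \<and> \<partial>\<omega>/\<partial>z\<^sub>i\<close> and of \<open>\<Sum>\<^sub>j dzbar\<^sub>j \<and> \<partial>\<omega>/\<partial>zbar\<^sub>j\<close>. In the second case, the
  factor \<open>(-1)\<^sup>p\<close>, with \<open>p\<close> the length of \<open>I\<close>, comes from moving \<open>dzbar\<^sub>j\<close> past \<open>dz\<^sub>I\<close>.
\<close>

definition del :: "nat \<Rightarrow> 'a form \<Rightarrow> 'a form" where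
  "del n \<omega> = (\<lambda>c I J x.
     if x \<in> fst c \<and> set I \<subseteq> {..<n} \<and> set J \<subseteq> {..<n}
     then \<Sum>s<length I. (-1) ^ s * d_z (I ! s) (in_chart c (\<omega> c (omit s I) J)) (snd c x)
     else 0)"

definition delbar :: "nat \<Rightarrow> 'a form \<Rightarrow> 'a form" where
  "delbar n \<omega> = (\<lambda>c I J x.
     if x \<in> fst c \<and> set I \<subseteq> {..<n} \<and> set J \<subseteq> {..<n}
     then (-1) ^ length I *
          (\<Sum>t<length J. (-1) ^ t * d_zbar (J ! t) (in_chart c (\<omega> c I (omit t J))) (snd c x))
     else 0)"

text \<open>Kernels and images in bidegree \<open>(p,q)\<close>; there are no nonzero forms of negative bidegree.\<close>

definition ker_del :: "nat \<Rightarrow> 'a chart set \<Rightarrow> nat \<Rightarrow> nat \<Rightarrow> 'a form set" where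
  "ker_del n \<A> p q = {\<omega> \<in> forms n \<A> p q. del n \<omega> = 0}"

definition ker_delbar :: "nat \<Rightarrow> 'a chart set \<Rightarrow> nat \<Rightarrow> nat \<Rightarrow> 'a form set" where
  "ker_delbar n \<A> p q = {\<omega> \<in> forms n \<A> p q. delbar n \<omega> = 0}"

definition ker_del_delbar :: "nat \<Rightarrow> 'a chart set \<Rightarrow> nat \<Rightarrow> nat \<Rightarrow> 'a form set" where
  "ker_del_delbar n \<A> p q = {\<omega> \<in> forms n \<A> p q. del n (delbar n \<omega>) = 0}"

definition im_del :: "nat \<Rightarrow> 'a chart set \<Rightarrow> nat \<Rightarrow> nat \<Rightarrow> 'a form set" where
  "im_del n \<A> p q = (if p = 0 then {0} else del n ` forms n \<A> (p - 1) q)"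

definition im_delbar :: "nat \<Rightarrow> 'a chart set \<Rightarrow> nat \<Rightarrow> nat \<Rightarrow> 'a form set" where
  "im_delbar n \<A> p q = (if q = 0 then {0} else delbar n ` forms n \<A> p (q - 1))"

definition im_del_delbar :: "nat \<Rightarrow> 'a chart set \<Rightarrow> nat \<Rightarrow> nat \<Rightarrow> 'a form set" where
  "im_del_delbar n \<A> p q =
     (if p = 0 \<or> q = 0 then {0} else (\<lambda>\<omega>. del n (delbar n \<omega>)) ` forms n \<A> (p - 1) (q - 1))"


section \<open>Quotient spaces\<close>

text \<open>
  The quotient of \<open>V\<close> by a subspace \<open>W\<close> is the set of cosets of \<open>W\<close>. Its zero is \<open>W\<close>, its addition
  is the addition of sets, and its scalar multiplication is \<open>quot_scale W\<close>; adding \<open>W\<close> there only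
  matters for the scalar \<open>0\<close>.
\<close>

definition quot :: "'a form set \<Rightarrow> 'a form set \<Rightarrow> 'a form set set" where
  "quot V W = (\<lambda>\<theta>. \<theta> +o W) ` V"

definition quot_scale :: "'a form set \<Rightarrow> complex \<Rightarrow> 'a form set \<Rightarrow> 'a form set" where
  "quot_scale W a C = cscale a ` C + W"

fun quot_lincomb :: "'a form set \<Rightarrow> complex list \<Rightarrow> 'a form set list \<Rightarrow> 'a form set" where
  "quot_lincomb W (a # as) (C # Cs) = quot_scale W a C + quot_lincomb W as Cs"
| "quot_lincomb W _ _ = W"

definition quot_indep :: "'a form set \<Rightarrow> 'a form set list \<Rightarrow> bool" where
  "quot_indep W Cs \<longleftrightarrow>
     (\<forall>as. length as = length Cs \<longrightarrow> quot_lincomb W as Cs = W \<longrightarrow> (\<forall>a\<in>set as. a = 0))"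

text \<open>
  The complex dimension of a linear subspace \<open>S\<close> of a quotient by \<open>W\<close>: the supremum of the lengths
  of linearly independent families in \<open>S\<close>, which is \<open>\<infinity>\<close> for an infinite-dimensional \<open>S\<close>.
\<close>

definition quot_dim :: "'a form set \<Rightarrow> 'a form set set \<Rightarrow> enat" where
  "quot_dim W S = Sup {enat (length Cs) | Cs. set Cs \<subseteq> S \<and> quot_indep W Cs}"

text \<open>
  The map induced by the identity on forms, with values in the quotient \<open>Q'\<close>: a class is sent to the
  class in \<open>Q'\<close> of its representatives.
\<close>

definition induced :: "'a form set set \<Rightarrow> 'a form set \<Rightarrow> 'a form set" where
  "induced Q' C = (THE D. D \<in> Q' \<and> C \<subseteq> D)"


section \<open>The cohomologies\<close>

definition H_BC :: "nat \<Rightarrow> 'a chart set \<Rightarrow> nat \<Rightarrow> nat \<Rightarrow> 'a form set set" where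
  "H_BC n \<A> p q = quot (ker_del n \<A> p q \<inter> ker_delbar n \<A> p q) (im_del_delbar n \<A> p q)"

definition H_A :: "nat \<Rightarrow> 'a chart set \<Rightarrow> nat \<Rightarrow> nat \<Rightarrow> 'a form set set" where
  "H_A n \<A> p q = quot (ker_del_delbar n \<A> p q) (im_del n \<A> p q + im_delbar n \<A> p q)"

definition H_delbar :: "nat \<Rightarrow> 'a chart set \<Rightarrow> nat \<Rightarrow> nat \<Rightarrow> 'a form set set" where
  "H_delbar n \<A> p q = quot (ker_delbar n \<A> p q) (im_delbar n \<A> p q)"

definition K_denom :: "nat \<Rightarrow> 'a chart set \<Rightarrow> nat \<Rightarrow> nat \<Rightarrow> 'a form set" where
  "K_denom n \<A> p q =
     im_del n \<A> p q \<inter> ker_delbar n \<A> p q + im_delbar n \<A> p q \<inter> ker_del n \<A> p q"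

definition K_space :: "nat \<Rightarrow> 'a chart set \<Rightarrow> nat \<Rightarrow> nat \<Rightarrow> 'a form set set" where
  "K_space n \<A> p q = quot (ker_del n \<A> p q \<inter> ker_delbar n \<A> p q) (K_denom n \<A> p q)"

definition k_dim :: "nat \<Rightarrow> 'a chart set \<Rightarrow> nat \<Rightarrow> nat \<Rightarrow> enat" where
  "k_dim n \<A> p q = quot_dim (K_denom n \<A> p q) (K_space n \<A> p q)"

definition pi_delbar :: "nat \<Rightarrow> 'a chart set \<Rightarrow> nat \<Rightarrow> nat \<Rightarrow> 'a form set \<Rightarrow> 'a form set" where
  "pi_delbar n \<A> p q = induced (H_delbar n \<A> p q)"

definition pi_A :: "nat \<Rightarrow> 'a chart set \<Rightarrow> nat \<Rightarrow> nat \<Rightarrow> 'a form set \<Rightarrow> 'a form set" where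
  "pi_A n \<A> p q = induced (H_A n \<A> p q)"

definition ker_pi_A :: "nat \<Rightarrow> 'a chart set \<Rightarrow> nat \<Rightarrow> nat \<Rightarrow> 'a form set set" where
  "ker_pi_A n \<A> p q =
     {C \<in> H_delbar n \<A> p q. pi_A n \<A> p q C = im_del n \<A> p q + im_delbar n \<A> p q}"

end

theory Submission
  imports Defs
begin

text \<open>
  Put \<open>Z = ker \<partial> \<inter> ker \<partial>bar\<close>, \<open>B = im \<partial>\<close>, \<open>B' = im \<partial>bar\<close>. The image of the first map is \<open>(Z + B') / B'\<close>, and the
  kernel of the second one is \<open>U / B'\<close> with \<open>U = ker \<partial>bar \<inter> (B + B') = (B \<inter> ker \<partial>bar) + B' \<subseteq> Z + B'\<close>.
  So the dimensions differ by that of \<open>(Z + B') / U = (Z + U) / U\<close>, which is \<open>Z / (Z \<inter> U)\<close>, and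
  \<open>Z \<inter> U = (B \<inter> ker \<partial>bar) + (B' \<inter> ker \<partial>)\<close> is the denominator of \<open>K\<close>.

  This needs \<open>\<partial>\<^sup>2 = \<partial>bar\<^sup>2 = \<partial>\<partial>bar + \<partial>bar\<partial> = 0\<close>, which follow from the symmetry of second derivatives, and that
  \<open>\<partial>\<close> and \<open>\<partial>bar\<close> map forms to forms. For the latter, the second derivatives of the transition map that
  appear when the transformation law is differentiated cancel, by the same symmetry together with the
  antisymmetry of the components. Statements about \<open>\<partial>bar\<close> are reduced to \<open>\<partial>\<close> by conjugating forms.
\<close>

section \<open>Index lists and alternating sums\<close>

text \<open>The facts named above play different roles. \<partial>^2 = 0 and \<partial>bar^2 = 0
  give im \<partial> \<subseteq> ker \<partial> and im \<partial>bar \<subseteq> ker \<partial>bar,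
  the inclusions under which the modular law yields the descriptions of U and Z \<inter> U.
  Anticommutation gives im \<partial>\<partial>bar \<subseteq> im \<partial>bar, which makes
  \<open>pi_delbar\<close> well defined. Dimensions are suprema in \<open>enat\<close>, where
  differences are lost at \<infinity>. The comparison is therefore an addition along the chain B'
  \<subseteq> U \<subseteq> Z + B', read off from nested bases. The operators \<open>d_z\<close> and
  \<open>d_zbar\<close> only see derivatives along single coordinate lines, while differentiating
  the transformation law takes a chain rule. So total differentiability is first recovered from the
  continuity of partial derivatives. Holomorphy of the transition maps then makes the conjugated
  Jacobians constants for \<open>d_z\<close>, and only the antisymmetry in the first index list has
  to be exploited.\<close>

lemma length_omit: "s < length I \<Longrightarrow> length (omit s I) = length I - 1"
  by (simp add: omit_def)

lemma nth_omit: "s < length I \<Longrightarrow> r < length I - 1 \<Longrightarrow> omit s I ! r = I ! (if r < s then r else Suc r)"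
  by (auto simp: omit_def nth_append min_def)

lemma set_omit_subset: "set (omit s I) \<subseteq> set I"
  by (auto simp: omit_def dest: in_set_takeD in_set_dropD)

lemma omit_omit: "r < s \<Longrightarrow> s < length I \<Longrightarrow> omit r (omit s I) = omit (s - 1) (omit r I)"
  by (rule nth_equalityI) (auto simp: length_omit nth_omit)

lemma length_swap_entries [simp]: "length (swap_entries s t I) = length I"
  by (simp add: swap_entries_def)

lemma nth_swap_entries:
  "s < length I \<Longrightarrow> t < length I \<Longrightarrow> r < length I \<Longrightarrow>
     swap_entries s t I ! r = I ! (if r = s then t else if r = t then s else r)"
  by (auto simp: swap_entries_def nth_list_update)

lemma set_swap_entries:
  "s < length I \<Longrightarrow> t < length I \<Longrightarrow> set (swap_entries s t I) = set I"
  by (simp add: swap_entries_def)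

lemma swap_entries_indices:
  "I \<in> indices n k \<Longrightarrow> s < k \<Longrightarrow> t < k \<Longrightarrow> swap_entries s t I \<in> indices n k"
  by (auto simp: indices_def set_swap_entries)

lemma swap_entries_commute: "s < length I \<Longrightarrow> t < length I \<Longrightarrow> swap_entries s t I = swap_entries t s I"
  by (rule nth_equalityI) (auto simp: nth_swap_entries)

lemma omit_indices: "I \<in> indices n (Suc k) \<Longrightarrow> s < Suc k \<Longrightarrow> omit s I \<in> indices n k"
  using set_omit_subset[of s I] by (auto simp: indices_def length_omit)

lemma finite_indices [simp]: "finite (indices n k)"
  unfolding indices_def using finite_lists_length_eq[of "{..<n}" k] by (simp add: conj_commute)

text \<open>The sign pattern behind \<partial>^2 = 0: omitting two entries in either order leaves
  the same list, with opposite signs. \<open>H\<close> is abstract because the cancellation occurs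
  twice, for second derivatives of components in \<open>del_del\<close> and for those of transition
  maps in \<open>second_derivative_terms_cancel\<close>. Symmetry is asked only on entries of
  \<open>I\<close>, as derivatives are known to commute only along coordinates below
  \<open>n\<close>.\<close>

lemma double_omit_sum_eq_0:
  fixes H :: "nat \<Rightarrow> nat \<Rightarrow> nat list \<Rightarrow> complex"
  assumes sym: "\<And>i j L. i \<in> set I \<Longrightarrow> j \<in> set I \<Longrightarrow> set L \<subseteq> set I \<Longrightarrow> H i j L = H j i L"
  shows "(\<Sum>s<length I. \<Sum>r<length I - 1.
           (-1) ^ s * ((-1) ^ r * H (I ! s) (omit s I ! r) (omit r (omit s I)))) = 0"
proof -
  define m where "m = length I"
  define T where "T = (\<lambda>(s, r). (-1) ^ s * ((-1) ^ r * H (I ! s) (omit s I ! r) (omit r (omit s I))))"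
  \<comment> \<open>The involution exchanges the two orders in which a pair of entries can be omitted.\<close>
  define v where "v = (\<lambda>(s::nat, r::nat). if r < s then (r, s - 1) else (Suc r, s))"
  let ?P = "{..<m} \<times> {..<m - 1}"
  have flip: "T (v x) = - T x" if "x \<in> ?P" for x
  proof -
    obtain s r where x: "x = (s, r)" by force
    with that have sr: "s < length I" "r < length I - 1" by (auto simp: m_def)
    have L: "set (omit a (omit b I)) \<subseteq> set I" for a b
      using set_omit_subset[of a "omit b I"] set_omit_subset[of b I] by (rule subset_trans)
    show ?thesis
    proof (cases "r < s")
      case True
      then obtain k where k: "s = Suc k" "r \<le> k" by (cases s) auto
      have "H (I ! s) (I ! r) (omit k (omit r I)) = H (I ! r) (I ! s) (omit k (omit r I))"
        using sr by (intro sym L) auto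
      then show ?thesis using True sr k omit_omit[of r s I]
        by (simp add: T_def v_def x nth_omit)
    next
      case False
      have "H (I ! s) (I ! Suc r) (omit r (omit s I)) = H (I ! Suc r) (I ! s) (omit r (omit s I))"
        using sr by (intro sym L) auto
      then show ?thesis using False sr omit_omit[of s "Suc r" I]
        by (simp add: T_def v_def x nth_omit)
    qed
  qed
  have "sum T ?P = (\<Sum>x\<in>?P. - T x)"
    by (rule sum.reindex_bij_witness[of _ v v]) (auto simp: flip, auto simp: v_def split: if_splits)
  then have "sum T ?P = 0" by (simp add: sum_negf)
  then show ?thesis by (simp add: T_def m_def sum.cartesian_product)
qed

section \<open>Antisymmetric functions of index lists\<close>

definition alternating :: "nat \<Rightarrow> nat \<Rightarrow> (nat list \<Rightarrow> complex) \<Rightarrow> bool" where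
  "alternating n k G \<longleftrightarrow>
     (\<forall>I\<in>indices n k. \<forall>s<k. \<forall>t<k. s \<noteq> t \<longrightarrow> G (swap_entries s t I) = - G I)"

lemma alternatingD:
  "alternating n k G \<Longrightarrow> I \<in> indices n k \<Longrightarrow> s < k \<Longrightarrow> t < k \<Longrightarrow> s \<noteq> t \<Longrightarrow> G (swap_entries s t I) = - G I"
  by (auto simp: alternating_def)

text \<open>Adjacent transpositions generate all others. For sums over omitted positions the
  adjacent case is the tractable one, as only two neighbouring positions trade places.\<close>

lemma alternating_adjacentI:
  assumes adj: "\<And>I s. I \<in> indices n k \<Longrightarrow> Suc s < k \<Longrightarrow> G (swap_entries s (Suc s) I) = - G I"
  shows "alternating n k G"
proof -
  have step: "G (swap_entries s (s + Suc d) I) = - G I" if "I \<in> indices n k" "s + Suc d < k" for s d I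
    using that
  proof (induction d arbitrary: I)
    case 0
    then show ?case using adj[of I s] by simp
  next
    case (Suc d)
    let ?t = "s + Suc d"
    define I1 where "I1 = swap_entries ?t (Suc ?t) I"
    define I2 where "I2 = swap_entries s ?t I1"
    have I1: "I1 \<in> indices n k" and I2: "I2 \<in> indices n k"
      using Suc.prems by (auto simp: I1_def I2_def intro!: swap_entries_indices)
    \<comment> \<open>The transposition of \<open>s\<close> and \<open>Suc ?t\<close> is that of
      \<open>s\<close> and \<open>?t\<close> conjugated by the adjacent one of \<open>?t\<close> and
      \<open>Suc ?t\<close>: three sign changes, hence one.\<close>
    have "swap_entries s (Suc ?t) I = swap_entries ?t (Suc ?t) I2"
      using Suc.prems by (intro nth_equalityI) (auto simp: I1_def I2_def nth_swap_entries indices_def)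
    also have "G \<dots> = - G I2" using adj[OF I2, of ?t] Suc.prems by simp
    also have "G I2 = - G I1" unfolding I2_def using Suc.IH[OF I1] Suc.prems by simp
    also have "G I1 = - G I" unfolding I1_def using adj[of I ?t] Suc.prems by simp
    finally show ?case by simp
  qed
  show ?thesis unfolding alternating_def
  proof (intro ballI allI impI)
    fix I s t assume *: "I \<in> indices n k" "s < k" "t < k" "s \<noteq> t"
    then consider d where "t = s + Suc d" | d where "s = t + Suc d"
      by (metis less_imp_Suc_add linorder_neqE_nat add_Suc_right)
    then show "G (swap_entries s t I) = - G I"
    proof cases
      case 1 then show ?thesis using step[of I s d] * by simp
    next
      case 2 then show ?thesis using step[of I t d] * swap_entries_commute[of s I t]
        by (simp add: indices_def)
    qed
  qed
qed

text \<open>Under an adjacent swap the two summands that omit a swapped position trade places, and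
  their signs are opposite; in every other summand both entries survive and the antisymmetry of
  \<open>F\<close> applies. This gives the antisymmetry of \<open>del n \<omega>\<close> in the
  first index list.\<close>

lemma alternating_omit_sum:
  assumes F: "\<And>i. i < n \<Longrightarrow> alternating n k (F i)"
  shows "alternating n (Suc k) (\<lambda>I. \<Sum>s<length I. (-1) ^ s * F (I ! s) (omit s I))"
proof (rule alternating_adjacentI)
  fix I s assume I: "I \<in> indices n (Suc k)" and s: "Suc s < Suc k"
  let ?I = "swap_entries s (Suc s) I"
  define \<sigma> where "\<sigma> = (\<lambda>r. if r = s then Suc s else if r = Suc s then s else r)"
  have len: "length I = Suc k" using I by (simp add: indices_def)
  have "(\<Sum>r<Suc k. (-1) ^ r * F (?I ! r) (omit r ?I)) = (\<Sum>r<Suc k. - ((-1) ^ r * F (I ! r) (omit r I)))"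
  proof (rule sum.reindex_bij_witness[of _ \<sigma> \<sigma>])
    fix r assume r: "r \<in> {..<Suc k}"
    then show "\<sigma> (\<sigma> r) = r" "\<sigma> r \<in> {..<Suc k}" using s by (auto simp: \<sigma>_def)
    then show "\<sigma> (\<sigma> r) = r" "\<sigma> r \<in> {..<Suc k}" by auto
    have nth: "?I ! r = I ! \<sigma> r" using r s len by (simp add: nth_swap_entries \<sigma>_def)
    have lt: "I ! r < n" using I r by (auto simp: indices_def subset_iff)
    consider "r = s" | "r = Suc s" | "r < s" | "Suc s < r" by linarith
    then show "- ((-1) ^ \<sigma> r * F (I ! \<sigma> r) (omit (\<sigma> r) I)) = (-1) ^ r * F (?I ! r) (omit r ?I)"
    proof cases
      case 1
      have "omit r ?I = omit (\<sigma> r) I"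
        by (rule nth_equalityI) (use 1 s r len in \<open>auto simp: length_omit nth_omit nth_swap_entries \<sigma>_def intro: arg_cong[where f="(!) I"]\<close>)
      then show ?thesis using nth 1 by (simp add: \<sigma>_def)
    next
      case 2
      have "omit r ?I = omit (\<sigma> r) I"
        by (rule nth_equalityI) (use 2 s r len in \<open>auto simp: length_omit nth_omit nth_swap_entries \<sigma>_def\<close>)
      then show ?thesis using nth 2 by (simp add: \<sigma>_def)
    next
      case 3
      \<comment> \<open>Omitting an earlier entry shifts the swapped pair one position to the
        left.\<close>
      have "omit r ?I = swap_entries (s - 1) s (omit r I)"
        by (rule nth_equalityI) (use 3 s r len in \<open>auto simp: length_omit nth_omit nth_swap_entries\<close>)
      moreover have "F (I ! r) (swap_entries (s - 1) s (omit r I)) = - F (I ! r) (omit r I)"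
        by (rule alternatingD[OF F[OF lt]]) (use 3 s r omit_indices[OF I] in auto)
      ultimately show ?thesis using nth 3 by (simp add: \<sigma>_def)
    next
      case 4
      have "omit r ?I = swap_entries s (Suc s) (omit r I)"
        by (rule nth_equalityI) (use 4 s r len in \<open>auto simp: length_omit nth_omit nth_swap_entries\<close>)
      moreover have "F (I ! r) (swap_entries s (Suc s) (omit r I)) = - F (I ! r) (omit r I)"
        by (rule alternatingD[OF F[OF lt]]) (use 4 s r omit_indices[OF I] in auto)
      ultimately show ?thesis using nth 4 by (simp add: \<sigma>_def)
    qed
  qed
  then show "(\<Sum>r<length ?I. (-1) ^ r * F (?I ! r) (omit r ?I)) = - (\<Sum>r<length I. (-1) ^ r * F (I ! r) (omit r I))"
    by (simp add: len sum_negf)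
qed

section \<open>Splitting an index list at one position\<close>

definition insert_at :: "nat \<Rightarrow> nat \<Rightarrow> nat list \<Rightarrow> nat list" where
  "insert_at s a A = take s A @ a # drop s A"

lemma length_insert_at [simp]: "s \<le> length A \<Longrightarrow> length (insert_at s a A) = Suc (length A)"
  by (simp add: insert_at_def)

lemma nth_insert_at:
  "s \<le> length A \<Longrightarrow> r \<le> length A \<Longrightarrow>
     insert_at s a A ! r = (if r < s then A ! r else if r = s then a else A ! (r - 1))"
  by (auto simp: insert_at_def nth_append min_def nth_Cons' diff_diff_left)

lemma set_insert_at: "set (insert_at s a A) = insert a (set A)"
  using set_append[of "take s A" "drop s A"] by (simp add: insert_at_def)

lemma omit_insert_at: "s \<le> length A \<Longrightarrow> omit s (insert_at s a A) = A"
  by (rule nth_equalityI) (auto simp: length_omit nth_omit nth_insert_at)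

lemma insert_at_omit: "s < length A \<Longrightarrow> insert_at s (A ! s) (omit s A) = A"
  by (rule nth_equalityI) (auto simp: length_omit nth_omit nth_insert_at)

text \<open>Moving the entry from position \<open>s\<close> to the front passes \<open>s\<close>
  neighbours. Contractions against an antisymmetric \<open>G\<close> thus depend on the position
  only through a sign.\<close>

lemma alternating_insert_at:
  assumes "alternating n (Suc k) G" "A \<in> indices n k" "a < n" "s \<le> k"
  shows "G (insert_at s a A) = (-1) ^ s * G (a # A)"
  using \<open>s \<le> k\<close>
proof (induction s)
  case 0
  then show ?case by (simp add: insert_at_def)
next
  case (Suc s)
  have len: "length A = k" using assms by (simp add: indices_def)
  have "insert_at (Suc s) a A = swap_entries s (Suc s) (insert_at s a A)"
    by (rule nth_equalityI) (use Suc.prems len in \<open>auto simp: nth_swap_entries nth_insert_at\<close>)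
  moreover have "insert_at s a A \<in> indices n (Suc k)"
    using assms Suc.prems by (auto simp: indices_def set_insert_at)
  ultimately show ?case using Suc alternatingD[OF assms(1), of "insert_at s a A" s "Suc s"] by simp
qed

text \<open>\<open>insert_at s\<close> and \<open>omit s\<close> are mutually inverse. Read from
  right to left, this merges the summation index of the chain rule into an index list; from left to
  right, it extracts the index of one slot.\<close>

lemma sum_indices_insert_at:
  assumes "s \<le> k"
  shows "(\<Sum>A\<in>indices n (Suc k). g (A ! s) (omit s A)) = (\<Sum>a<n. \<Sum>A\<in>indices n k. g a A)"
  unfolding sum.cartesian_product
proof (rule sum.reindex_bij_witness[of _ "\<lambda>(a, A). insert_at s a A" "\<lambda>A. (A ! s, omit s A)"])
  fix A assume A: "A \<in> indices n (Suc k)"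
  then show "(A ! s, omit s A) \<in> {..<n} \<times> indices n k"
    using assms omit_indices[OF A, of s] by (auto simp: indices_def subset_iff)
  show "(case (A ! s, omit s A) of (a, A) \<Rightarrow> insert_at s a A) = A"
    using A assms by (simp add: insert_at_omit indices_def)
qed (use assms in \<open>auto simp: indices_def omit_insert_at nth_insert_at set_insert_at\<close>)

lemma prod_remove_omit:
  fixes h :: "nat \<Rightarrow> nat \<Rightarrow> 'b::comm_monoid_mult"
  assumes "length A = Suc k" "length I = Suc k" "s \<le> k"
  shows "(\<Prod>r\<in>{..<Suc k} - {s}. h (A ! r) (I ! r)) = (\<Prod>r<k. h (omit s A ! r) (omit s I ! r))"
  by (rule prod.reindex_bij_witness[of _ "\<lambda>r. if r < s then r else Suc r" "\<lambda>r. if r < s then r else r - 1"])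
    (use assms in \<open>auto simp: nth_omit\<close>)

lemma prod_split_omit:
  fixes h :: "nat \<Rightarrow> nat \<Rightarrow> 'b::comm_monoid_mult"
  assumes "length A = Suc k" "length I = Suc k" "s \<le> k"
  shows "(\<Prod>r<Suc k. h (A ! r) (I ! r)) = h (A ! s) (I ! s) * (\<Prod>r<k. h (omit s A ! r) (omit s I ! r))"
  using assms prod.remove[of "{..<Suc k}" s "\<lambda>r. h (A ! r) (I ! r)"] prod_remove_omit[OF assms, of h] by simp

section \<open>Calculus on open subsets of complex n-space\<close>

abbreviation line :: "nat \<Rightarrow> complex \<Rightarrow> (nat \<Rightarrow> complex) \<Rightarrow> real \<Rightarrow> nat \<Rightarrow> complex" where
  "line i u z t \<equiv> z(i := z i + of_real t * u)"

abbreviation openC :: "nat \<Rightarrow> (nat \<Rightarrow> complex) set \<Rightarrow> bool" where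
  "openC n D \<equiv> openin (top_of_set (Cspace n)) D"

text \<open>The polydisc about \<open>z\<close> within \<open>Cspace n\<close>. Coordinatewise
  bounds are what the product topology provides and what moving one coordinate at a time
  preserves.\<close>

definition near :: "nat \<Rightarrow> real \<Rightarrow> (nat \<Rightarrow> complex) \<Rightarrow> (nat \<Rightarrow> complex) \<Rightarrow> bool" where
  "near n \<delta> z w \<longleftrightarrow> w \<in> Cspace n \<and> (\<forall>i<n. dist (w i) (z i) < \<delta>)"

lemma near_mono: "near n \<delta> z w \<Longrightarrow> \<delta> \<le> \<delta>' \<Longrightarrow> near n \<delta>' z w"
  by (force simp: near_def)

text \<open>The first \<open>n\<close> coordinates are controlled by finitely many radii of a basic
  product neighbourhood; the others are 0 for all points of \<open>Cspace n\<close>.\<close>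

lemma openC_near:
  assumes "openC n D" "z \<in> D"
  obtains \<delta> where "\<delta> > 0" "\<And>w. near n \<delta> z w \<Longrightarrow> w \<in> D"
proof -
  obtain T where T: "open T" "D = Cspace n \<inter> T" using assms(1) by (auto simp: openin_open)
  have "openin (product_topology (\<lambda>i. euclidean) UNIV) T" "z \<in> T"
    using T assms(2) by (auto simp: open_fun_def)
  from product_topology_open_contains_basis[OF this]
  obtain X where X: "z \<in> (\<Pi>\<^sub>E i\<in>UNIV. X i)" "\<And>i. open (X i)" "(\<Pi>\<^sub>E i\<in>UNIV. X i) \<subseteq> T"
    "finite {i. X i \<noteq> UNIV}"
    by auto
  have "\<exists>e>0. ball (z i) e \<subseteq> X i" for i
    using X(1) X(2)[of i] by (auto simp: PiE_iff open_contains_ball)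
  then obtain e where e: "\<And>i. e i > 0" "\<And>i. ball (z i) (e i) \<subseteq> X i" by metis
  define \<delta> where "\<delta> = Min (insert 1 (e ` {i. X i \<noteq> UNIV}))"
  define \<delta>' where "\<delta>' = Min (insert \<delta> (e ` {..<n}))"
  have le: "\<delta>' \<le> e i" if "i < n" for i unfolding \<delta>'_def by (rule Min_le) (use that in auto)
  have pos: "\<delta>' > 0" using X(4) e(1) by (simp add: \<delta>'_def \<delta>_def)
  show thesis
  proof
    show "\<delta>' > 0" by fact
    fix w assume w: "near n \<delta>' z w"
    have "w i \<in> X i" for i
    proof (cases "i < n")
      case True
      then have "dist (w i) (z i) < e i" using w le[of i] by (force simp: near_def)
      then show ?thesis using e(2)[of i] by (auto simp: dist_commute)
    next
      case False
      then have "w i = z i" using w T assms(2) by (auto simp: near_def Cspace_def)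
      then show ?thesis using X(1) by (auto simp: PiE_iff)
    qed
    then have "w \<in> T" using X(3) by (auto simp: PiE_iff)
    then show "w \<in> D" using w T by (auto simp: near_def)
  qed
qed

lemma continuous_on_near:
  fixes g :: "(nat \<Rightarrow> complex) \<Rightarrow> complex"
  assumes "openC n D" "z \<in> D" "continuous_on D g" "e > 0"
  obtains \<delta> where "\<delta> > 0" "\<And>w. near n \<delta> z w \<Longrightarrow> w \<in> D \<and> dist (g w) (g z) < e"
proof -
  have "openin (top_of_set D) (D \<inter> g -` ball (g z) e)"
    using assms(3) by (intro continuous_openin_preimage_gen) auto
  then have "openC n (D \<inter> g -` ball (g z) e)" using assms(1) by (rule openin_trans)
  moreover have "z \<in> D \<inter> g -` ball (g z) e" using assms by auto
  ultimately obtain \<delta> where "\<delta> > 0" "\<And>w. near n \<delta> z w \<Longrightarrow> w \<in> D \<inter> g -` ball (g z) e"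
    using openC_near by blast
  then show thesis using that by (auto simp: dist_commute)
qed

lemma openC_subset: "openC n D \<Longrightarrow> z \<in> D \<Longrightarrow> z \<in> Cspace n"
  by (auto dest: openin_imp_subset)

lemma fun_upd_Cspace: "z \<in> Cspace n \<Longrightarrow> i < n \<Longrightarrow> z(i := a) \<in> Cspace n"
  by (auto simp: Cspace_def)

lemma eventually_line:
  assumes "openC n D" "z \<in> D" "i < n"
  shows "eventually (\<lambda>t. line i u z t \<in> D) (nhds 0)"
proof -
  obtain \<delta> where \<delta>: "\<delta> > 0" "\<And>w. near n \<delta> z w \<Longrightarrow> w \<in> D"
    using openC_near[OF assms(1,2)] by blast
  have "((\<lambda>t::real. norm (of_real t * u)) \<longlongrightarrow> norm (of_real 0 * u)) (nhds 0)"
    by (intro tendsto_intros) (simp add: filterlim_ident)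
  then have "eventually (\<lambda>t::real. norm (of_real t * u) < \<delta>) (nhds 0)"
    by (rule order_tendstoD) (use \<delta> in simp)
  then show ?thesis
  proof eventually_elim
    case (elim t)
    then show ?case using \<delta> assms openC_subset[OF assms(1,2)]
      by (intro \<delta>(2)) (auto simp: near_def fun_upd_Cspace dist_norm)
  qed
qed

section \<open>Derivatives along coordinate lines\<close>

lemma pd_eqI:
  "((\<lambda>t. f (line i u z t)) has_vector_derivative v) (at 0) \<Longrightarrow> pd u i f z = v"
  unfolding pd_def by (rule vector_derivative_at)

lemma has_vector_derivative_pd:
  "(\<lambda>t. f (line i u z t)) differentiable (at 0) \<Longrightarrow>
     ((\<lambda>t. f (line i u z t)) has_vector_derivative pd u i f z) (at 0)"
  unfolding pd_def by (simp add: vector_derivative_works)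

lemma has_vector_derivative_line_cong:
  assumes "openC n D" "z \<in> D" "i < n" "\<And>w. w \<in> D \<Longrightarrow> f w = g w"
    and "((\<lambda>t. f (line i u z t)) has_vector_derivative v) (at 0)"
  shows "((\<lambda>t. g (line i u z t)) has_vector_derivative v) (at 0)"
proof -
  have "eventually (\<lambda>t. f (line i u z t) = g (line i u z t)) (nhds 0)"
    using eventually_line[OF assms(1-3), of u] by eventually_elim (use assms(4) in auto)
  then have "((\<lambda>t. f (line i u z t)) has_vector_derivative v) (at 0) =
      ((\<lambda>t. g (line i u z t)) has_vector_derivative v) (at 0)"
    by (intro has_vector_derivative_cong_ev) (auto dest: eventually_nhds_x_imp_x)
  then show ?thesis using assms(5) by simp
qed

text \<open>\<open>pd\<close> differentiates at parameter 0 from a moving base point. Translating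
  the parameter turns this into a derivative at \<open>s\<close> along one fixed line, as mean value
  estimates require.\<close>

lemma has_vector_derivative_line_shift:
  assumes "((\<lambda>t. f (line i u (line i u w s) t)) has_vector_derivative v) (at 0)"
  shows "((\<lambda>t. f (line i u w t)) has_vector_derivative v) (at s)"
proof -
  have "((\<lambda>t. f (line i u (line i u w s) t)) \<circ> (\<lambda>t. t - s) has_vector_derivative 1 *\<^sub>R v) (at s)"
    by (rule vector_diff_chain_at) (use assms in \<open>auto intro!: derivative_eq_intros\<close>)
  moreover have "(\<lambda>t. f (line i u (line i u w s) t)) \<circ> (\<lambda>t. t - s) = (\<lambda>t. f (line i u w t))"
    by (auto simp: fun_eq_iff algebra_simps)
  ultimately show ?thesis by simp
qed

text \<open>The mean value inequality for \<open>g s - of_real s * v\<close>; complex values admit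
  no mean value equality.\<close>

lemma vector_derivative_increment_bound:
  fixes g :: "real \<Rightarrow> complex"
  assumes "\<And>s. s \<in> closed_segment a b \<Longrightarrow> (g has_vector_derivative g' s) (at s)"
    and "\<And>s. s \<in> closed_segment a b \<Longrightarrow> norm (g' s - v) \<le> B"
  shows "norm (g b - g a - of_real (b - a) * v) \<le> B * \<bar>b - a\<bar>"
proof -
  have "norm ((g b - of_real b * v) - (g a - of_real a * v)) \<le> B * norm (b - a)"
  proof (rule differentiable_bound[of "closed_segment a b" _ "\<lambda>s h. h *\<^sub>R (g' s - v)"])
    fix s assume s: "s \<in> closed_segment a b"
    have "((\<lambda>s. g s - s *\<^sub>R v) has_vector_derivative g' s - v) (at s)"
      by (auto intro!: derivative_eq_intros assms(1)[OF s])
    then show "((\<lambda>s. g s - of_real s * v) has_derivative (\<lambda>h. h *\<^sub>R (g' s - v))) (at s within closed_segment a b)"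
      unfolding has_vector_derivative_def scaleR_conv_of_real[of _ v]
      by (rule has_derivative_at_withinI)
    show "onorm (\<lambda>h. h *\<^sub>R (g' s - v)) \<le> B"
      using assms(2)[OF s] onorm_scaleR_left[of "\<lambda>h::real. h" "g' s - v"]
      by (simp add: bounded_linear_ident onorm_id)
  qed auto
  then show ?thesis by (simp add: algebra_simps)
qed

text \<open>Increments from every base point \<open>w\<close> near \<open>z\<close> are compared
  with the derivative at the one point \<open>z\<close>. Second differences and total derivatives
  need this uniformity, because there the base point moves.\<close>

lemma directional_estimate:
  assumes D: "openC n D" "z \<in> D" and i: "i < n"
    and diff: "\<And>w. w \<in> D \<Longrightarrow> (\<lambda>t. f (line i u w t)) differentiable (at 0)"
    and cont: "continuous_on D (pd u i f)" and e: "e > 0"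
  obtains \<delta> where "\<delta> > 0" "\<And>w. near n \<delta> z w \<Longrightarrow> w \<in> D"
    "\<And>w t. near n \<delta> z w \<Longrightarrow> near n \<delta> z (line i u w t) \<Longrightarrow>
       norm (f (line i u w t) - f w - of_real t * pd u i f z) \<le> e * \<bar>t\<bar>"
proof -
  obtain \<delta> where \<delta>: "\<delta> > 0" "\<And>w. near n \<delta> z w \<Longrightarrow> w \<in> D \<and> dist (pd u i f w) (pd u i f z) < e"
    using continuous_on_near[OF D cont e] by blast
  show thesis
  proof
    fix w t assume w: "near n \<delta> z w" "near n \<delta> z (line i u w t)"
    \<comment> \<open>The moving coordinate stays in its disc because discs are convex; the other
      coordinates do not change.\<close>
    have mem: "near n \<delta> z (line i u w s)" if seg: "s \<in> closed_segment 0 t" for s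
    proof -
      obtain r where "0 \<le> r" "r \<le> 1" "s = (1 - r) *\<^sub>R 0 + r *\<^sub>R t"
        using seg unfolding in_segment by blast
      then have r: "0 \<le> r" "r \<le> 1" "s = r * t" by auto
      have "w i + of_real s * u = (1 - r) *\<^sub>R w i + r *\<^sub>R (w i + of_real t * u)"
        by (simp add: r(3) scaleR_conv_of_real algebra_simps)
      moreover have "w i \<in> ball (z i) \<delta>" "w i + of_real t * u \<in> ball (z i) \<delta>"
        using w i by (auto simp: near_def dist_commute)
      ultimately have "w i + of_real s * u \<in> ball (z i) \<delta>"
        using convexD_alt[OF convex_ball, of "w i" "z i" \<delta> "w i + of_real t * u" r] r(1,2) by (simp only:)
      then have "dist (w i + of_real s * u) (z i) < \<delta>" by (simp only: mem_ball dist_commute)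
      then show ?thesis using w(1) i by (simp add: near_def fun_upd_Cspace)
    qed
    have "norm (f (line i u w t) - f (line i u w 0) - of_real (t - 0) * pd u i f z) \<le> e * \<bar>t - 0\<bar>"
    proof (rule vector_derivative_increment_bound)
      fix s assume "s \<in> closed_segment 0 t"
      then have s: "line i u w s \<in> D" "dist (pd u i f (line i u w s)) (pd u i f z) < e"
        using mem \<delta>(2) by blast+
      show "((\<lambda>t. f (line i u w t)) has_vector_derivative pd u i f (line i u w s)) (at s)"
        by (rule has_vector_derivative_line_shift, rule has_vector_derivative_pd, rule diff) fact
      show "norm (pd u i f (line i u w s) - pd u i f z) \<le> e" using s(2) by (simp add: dist_norm)
    qed
    then show "norm (f (line i u w t) - f w - of_real t * pd u i f z) \<le> e * \<bar>t\<bar>" by simp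
  qed (use \<delta> in auto)
qed

lemma Ck_on_continuous: "Ck_on n k D f \<Longrightarrow> continuous_on D f"
  by (cases k) auto

section \<open>Symmetry of second partial derivatives\<close>

lemma near_line_line:
  assumes "z \<in> Cspace n" "i < n" "j < n" "norm u = 1" "norm v = 1" "\<bar>s\<bar> + \<bar>t\<bar> < \<delta>"
  shows "near n \<delta> z (line i u (line j v z t) s)"
proof -
  \<comment> \<open>For \<open>i = j\<close> both displacements act on the same coordinate, so their
    sum has to be bounded.\<close>
  have "norm (of_real t * v + of_real s * u) < \<delta>"
    using assms norm_triangle_ineq[of "of_real t * v" "of_real s * u"] by (simp add: norm_mult)
  then show ?thesis using assms by (auto simp: near_def fun_upd_Cspace dist_norm norm_mult add.assoc)
qed

text \<open>The second difference is the increment of \<open>g\<close>, the difference of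
  \<open>f\<close> on two parallel segments in direction \<open>u\<close>. The derivative of
  \<open>g\<close> is an increment of \<open>pd u i f\<close> in direction \<open>v\<close>, hence
  close to \<open>t * pd v j (pd u i f) z\<close>.\<close>

lemma second_difference_estimate:
  assumes D: "openC n D" "z \<in> D" and ij: "i < n" "j < n" and u: "u \<in> {1, \<i>}" and v: "v \<in> {1, \<i>}"
    and f: "Ck_on n 2 D f" and e: "e > 0"
  obtains \<delta> where "\<delta> > 0" "\<And>t. 0 < t \<Longrightarrow> t < \<delta> \<Longrightarrow>
     norm (f (line i u (line j v z t) t) - f (line i u z t) - f (line j v z t) + f z
           - (of_real t)\<^sup>2 * pd v j (pd u i f) z) \<le> e * t\<^sup>2"
proof -
  have uv: "norm u = 1" "norm v = 1" using u v by auto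
  have zC: "z \<in> Cspace n" using D by (rule openC_subset)
  have f1: "\<And>w. w \<in> D \<Longrightarrow> (\<lambda>t. f (line i u w t)) differentiable (at 0)"
    and f2: "Ck_on n 1 D (pd u i f)"
    using f ij u by (auto simp: numeral_2_eq_2)
  have A1: "\<And>w. w \<in> D \<Longrightarrow> (\<lambda>t. pd u i f (line j v w t)) differentiable (at 0)"
    and A2: "continuous_on D (pd v j (pd u i f))"
    using f2 ij v by auto
  obtain \<delta> where \<delta>: "\<delta> > 0" "\<And>w. near n \<delta> z w \<Longrightarrow> w \<in> D"
    "\<And>w t. near n \<delta> z w \<Longrightarrow> near n \<delta> z (line j v w t) \<Longrightarrow>
       norm (pd u i f (line j v w t) - pd u i f w - of_real t * pd v j (pd u i f) z) \<le> e * \<bar>t\<bar>"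
    using directional_estimate[OF D ij(2) A1 A2 e] by blast
  show thesis
  proof
    \<comment> \<open>Two displacements of size below \<open>\<delta> / 2\<close> together stay
      below \<open>\<delta>\<close>.\<close>
    show "\<delta> / 2 > 0" using \<delta> by simp
    fix t :: real assume t: "0 < t" "t < \<delta> / 2"
    define g where "g = (\<lambda>s. f (line i u (line j v z t) s) - f (line i u z s))"
    have "norm (g t - g 0 - of_real (t - 0) * (of_real t * pd v j (pd u i f) z)) \<le> (e * t) * \<bar>t - 0\<bar>"
    proof (rule vector_derivative_increment_bound)
      fix s assume "s \<in> closed_segment 0 t"
      then have s: "0 \<le> s" "s \<le> t" using t by (auto simp: closed_segment_eq_real_ivl)
      have n1: "near n \<delta> z (line i u (line j v z t) s)"
        using t s uv zC ij by (intro near_line_line) auto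
      have n2: "near n \<delta> z (line i u z s)"
        using near_line_line[of z n i j u v s 0 \<delta>] t s uv zC ij by simp
      have deriv: "((\<lambda>r. f (line i u y r)) has_vector_derivative pd u i f (line i u y s)) (at s)"
        if "near n \<delta> z (line i u y s)" for y
        by (rule has_vector_derivative_line_shift, rule has_vector_derivative_pd, rule f1, rule \<delta>(2), rule that)
      have eq: "line j v (line i u z s) t = line i u (line j v z t) s"
        by (auto simp: fun_eq_iff)
      show "(g has_vector_derivative pd u i f (line i u (line j v z t) s) - pd u i f (line i u z s)) (at s)"
        unfolding g_def by (rule has_vector_derivative_diff[OF deriv[OF n1] deriv[OF n2]])
      show "norm (pd u i f (line i u (line j v z t) s) - pd u i f (line i u z s)
              - of_real t * pd v j (pd u i f) z) \<le> e * t"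
        using \<delta>(3)[OF n2, of t] n1 t unfolding eq by simp
    qed
    moreover have l0: "line i u y 0 = y" for y by simp
    have "g t - g 0 = f (line i u (line j v z t) t) - f (line i u z t) - f (line j v z t) + f z"
      unfolding g_def l0 by algebra
    ultimately show "norm (f (line i u (line j v z t) t) - f (line i u z t) - f (line j v z t) + f z
           - (of_real t)\<^sup>2 * pd v j (pd u i f) z) \<le> e * t\<^sup>2"
      using t by (simp add: power2_eq_square mult.assoc)
  qed
qed

text \<open>The second difference \<open>X\<close> is symmetric in the two directions, so both
  iterated derivatives, multiplied by \<open>t\<^sup>2\<close>, lie within
  \<open>e/2 * t\<^sup>2\<close> of it. Dividing by \<open>t\<^sup>2\<close> leaves a distance of at
  most \<open>e\<close>.\<close>

lemma pd_commute:
  assumes D: "openC n D" "z \<in> D" and ij: "i < n" "j < n" and u: "u \<in> {1, \<i>}" and v: "v \<in> {1, \<i>}"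
    and f: "Ck_on n 2 D f"
  shows "pd v j (pd u i f) z = pd u i (pd v j f) z"
proof -
  have le: "norm (pd v j (pd u i f) z - pd u i (pd v j f) z) \<le> e" if e: "e > 0" for e
  proof -
    obtain \<delta>1 where \<delta>1: "\<delta>1 > 0" "\<And>t. 0 < t \<Longrightarrow> t < \<delta>1 \<Longrightarrow>
       norm (f (line i u (line j v z t) t) - f (line i u z t) - f (line j v z t) + f z
           - (of_real t)\<^sup>2 * pd v j (pd u i f) z) \<le> e/2 * t\<^sup>2"
      using second_difference_estimate[OF D ij u v f, of "e/2"] e by auto
    obtain \<delta>2 where \<delta>2: "\<delta>2 > 0" "\<And>t. 0 < t \<Longrightarrow> t < \<delta>2 \<Longrightarrow>
       norm (f (line j v (line i u z t) t) - f (line j v z t) - f (line i u z t) + f z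
           - (of_real t)\<^sup>2 * pd u i (pd v j f) z) \<le> e/2 * t\<^sup>2"
      using second_difference_estimate[OF D ij(2,1) v u f, of "e/2"] e by auto
    define t where "t = min \<delta>1 \<delta>2 / 2"
    have t: "0 < t" "t < \<delta>1" "t < \<delta>2" using \<delta>1(1) \<delta>2(1) by (auto simp: t_def)
    define X where "X = f (line i u (line j v z t) t) - f (line i u z t) - f (line j v z t) + f z"
    have eq: "line j v (line i u z t) t = line i u (line j v z t) t" by (auto simp: fun_eq_iff)
    have a: "norm (X - (of_real t)\<^sup>2 * pd v j (pd u i f) z) \<le> e/2 * t\<^sup>2"
      using \<delta>1(2)[OF t(1,2)] by (simp add: X_def)
    have X: "X = f (line i u (line j v z t) t) - f (line j v z t) - f (line i u z t) + f z"
      unfolding X_def by algebra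
    have b: "norm (X - (of_real t)\<^sup>2 * pd u i (pd v j f) z) \<le> e/2 * t\<^sup>2"
      using \<delta>2(2)[OF t(1,3)] unfolding eq X .
    have "(of_real t)\<^sup>2 * (pd v j (pd u i f) z - pd u i (pd v j f) z)
        = (X - (of_real t)\<^sup>2 * pd u i (pd v j f) z) - (X - (of_real t)\<^sup>2 * pd v j (pd u i f) z)"
      by (simp add: right_diff_distrib)
    also have "norm \<dots> \<le> e/2 * t\<^sup>2 + e/2 * t\<^sup>2"
      by (rule order_trans[OF norm_triangle_ineq4 add_mono[OF b a]])
    finally have "norm ((of_real t)\<^sup>2 * (pd v j (pd u i f) z - pd u i (pd v j f) z)) \<le> e * t\<^sup>2"
      by simp
    then show ?thesis using t by (simp add: norm_mult norm_power)
  qed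
  have "norm (pd v j (pd u i f) z - pd u i (pd v j f) z) \<le> 0"
  proof (rule field_le_epsilon)
    fix e :: real assume "0 < e"
    from le[OF this] show "norm (pd v j (pd u i f) z - pd u i (pd v j f) z) \<le> 0 + e" by simp
  qed
  then show ?thesis by simp
qed

text \<open>The point \<open>z\<close> is joined to \<open>w\<close> by 2n steps that each change
  one real coordinate, and \<open>directional_estimate\<close> bounds each step. The tolerance is
  \<open>e/2\<close> because the real and the imaginary step are each bounded by the full complex
  displacement.\<close>

lemma total_derivative_estimate:
  assumes D: "openC n D" "z \<in> D" and f: "Ck_on n 1 D f" and e: "e > 0"
  obtains \<delta> where "\<delta> > 0" "\<And>w. near n \<delta> z w \<Longrightarrow>
     norm (f w - f z - (\<Sum>a<n. of_real (Re (w a - z a)) * pd 1 a f z + of_real (Im (w a - z a)) * pd \<i> a f z))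
       \<le> e * (\<Sum>a<n. norm (w a - z a))"
proof -
  have "\<exists>\<delta>>0. \<forall>w t. near n \<delta> z w \<longrightarrow> near n \<delta> z (line i u w t) \<longrightarrow>
       norm (f (line i u w t) - f w - of_real t * pd u i f z) \<le> e/2 * \<bar>t\<bar>"
    if "i < n" "u \<in> {1, \<i>}" for i u
  proof -
    have 1: "\<And>w. w \<in> D \<Longrightarrow> (\<lambda>t. f (line i u w t)) differentiable (at 0)" 
      and 2: "continuous_on D (pd u i f)"
      using f that by auto
    show ?thesis
      by (rule directional_estimate[OF D that(1) 1 2, of "e/2"]) (use e in auto)
  qed
  then obtain d where d: "\<And>i u. i < n \<Longrightarrow> u \<in> {1, \<i>} \<Longrightarrow> d i u > 0"
    "\<And>i u w t. i < n \<Longrightarrow> u \<in> {1, \<i>} \<Longrightarrow> near n (d i u) z w \<Longrightarrow> near n (d i u) z (line i u w t) \<Longrightarrow>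
       norm (f (line i u w t) - f w - of_real t * pd u i f z) \<le> e/2 * \<bar>t\<bar>"
    by metis
  \<comment> \<open>The 1 keeps the set nonempty for \<open>n = 0\<close>.\<close>
  define \<delta> where "\<delta> = Min (insert 1 ((\<lambda>(i, u). d i u) ` ({..<n} \<times> {1, \<i>})))"
  have pos: "\<delta> > 0" unfolding \<delta>_def using d(1) by auto
  have le: "\<delta> \<le> d i u" if "i < n" "u \<in> {1, \<i>}" for i u
    unfolding \<delta>_def by (rule Min_le) (use that in auto)
  have est: "norm (f (line i u w t) - f w - of_real t * pd u i f z) \<le> e/2 * \<bar>t\<bar>"
    if "i < n" "u \<in> {1, \<i>}" "near n \<delta> z w" "near n \<delta> z (line i u w t)" for i u w t
    by (rule d(2)[OF that(1,2)]) (use that le[OF that(1,2)] near_mono in blast)+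
  have zC: "z \<in> Cspace n" using D by (rule openC_subset)
  show thesis
  proof
    fix w assume w: "near n \<delta> z w"
    \<comment> \<open>\<open>W k\<close> already has the first \<open>k\<close> coordinates of
      \<open>w\<close>; it runs from \<open>z\<close> at \<open>k = 0\<close> to \<open>w\<close> at
      \<open>k = n\<close>.\<close>
    define W where "W = (\<lambda>k a. if a < k then w a else z a)"
    define L where "L = (\<lambda>a. of_real (Re (w a - z a)) * pd 1 a f z + of_real (Im (w a - z a)) * pd \<i> a f z)"
    have near_W: "near n \<delta> z (W k)" for k
      using w zC pos by (auto simp: near_def W_def Cspace_def)
    have step: "norm (f (W (Suc k)) - f (W k) - L k) \<le> e * norm (w k - z k)" if k: "k < n" for k
    proof -
      define h where "h = w k - z k"
      \<comment> \<open>The intermediate point, where only the real part of coordinate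
        \<open>k\<close> has been moved.\<close>
      define V where "V = line k 1 (W k) (Re h)"
      have eqW: "W (Suc k) = line k \<i> V (Im h)"
      proof
        fix a show "W (Suc k) a = (line k \<i> V (Im h)) a"
          using complex_eq[of h] by (auto simp: V_def W_def h_def algebra_simps less_Suc_eq)
      qed
      have "norm h < \<delta>" using w k by (auto simp: near_def h_def dist_norm)
      then have "\<bar>Re h\<bar> < \<delta>" using abs_Re_le_cmod[of h] by linarith
      then have nV: "near n \<delta> z V"
        using near_W[of k] k by (auto simp: near_def V_def fun_upd_Cspace W_def dist_norm)
      have 1: "norm (f V - f (W k) - of_real (Re h) * pd 1 k f z) \<le> e/2 * \<bar>Re h\<bar>"
        unfolding V_def by (rule est) (use k near_W nV in \<open>auto simp: V_def\<close>)
      have 2: "norm (f (W (Suc k)) - f V - of_real (Im h) * pd \<i> k f z) \<le> e/2 * \<bar>Im h\<bar>"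
        unfolding eqW by (rule est) (use k near_W[of "Suc k"] nV in \<open>auto simp flip: eqW\<close>)
      have eq: "f (W (Suc k)) - f (W k) - L k =
          (f V - f (W k) - of_real (Re h) * pd 1 k f z) + (f (W (Suc k)) - f V - of_real (Im h) * pd \<i> k f z)"
        by (simp add: L_def h_def)
      have "norm (f (W (Suc k)) - f (W k) - L k) \<le> e/2 * \<bar>Re h\<bar> + e/2 * \<bar>Im h\<bar>"
        unfolding eq by (rule norm_triangle_mono[OF 1 2])
      also have "\<dots> \<le> e/2 * norm h + e/2 * norm h"
        using e abs_Re_le_cmod[of h] abs_Im_le_cmod[of h] by (intro add_mono mult_left_mono) auto
      finally show ?thesis by (simp add: h_def)
    qed
    have bound: "norm (f (W k) - f z - (\<Sum>a<k. L a)) \<le> e * (\<Sum>a<k. norm (w a - z a))" if "k \<le> n" for k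
      using that
    proof (induction k)
      case 0
      then show ?case by (simp add: W_def)
    next
      case (Suc k)
      have eq: "f (W (Suc k)) - f z - (\<Sum>a<Suc k. L a)
          = (f (W k) - f z - (\<Sum>a<k. L a)) + (f (W (Suc k)) - f (W k) - L k)" by simp
      have "norm (f (W (Suc k)) - f z - (\<Sum>a<Suc k. L a))
          \<le> e * (\<Sum>a<k. norm (w a - z a)) + e * norm (w k - z k)"
        unfolding eq by (rule norm_triangle_mono) (use Suc.IH step[of k] Suc.prems in auto)
      then show ?case by (simp add: distrib_left)
    qed
    have "W n = w"
      using w zC by (auto simp: W_def fun_eq_iff near_def Cspace_def)
    then show "norm (f w - f z - (\<Sum>a<n. of_real (Re (w a - z a)) * pd 1 a f z + of_real (Im (w a - z a)) * pd \<i> a f z))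
       \<le> e * (\<Sum>a<n. norm (w a - z a))" using bound[of n] by (simp add: L_def)
  qed (rule pos)
qed

text \<open>The composite is \<open>f z\<close>, plus the linear part \<open>L\<close> of the
  increment, plus a remainder \<open>R\<close> that is o(t) by
  \<open>total_derivative_estimate\<close>. So the derivative comes from \<open>L\<close> alone, and
  differentiability of the curve at 0 suffices.\<close>

lemma has_vector_derivative_curve:
  fixes \<gamma> :: "real \<Rightarrow> nat \<Rightarrow> complex"
  assumes D: "openC n D" "\<gamma> 0 \<in> D" and f: "Ck_on n 1 D f"
    and C: "eventually (\<lambda>t. \<gamma> t \<in> Cspace n) (nhds 0)"
    and \<gamma>: "\<And>a. a < n \<Longrightarrow> ((\<lambda>t. \<gamma> t a) has_vector_derivative v a) (at 0)"
  shows "((\<lambda>t. f (\<gamma> t)) has_vector_derivative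
      (\<Sum>a<n. of_real (Re (v a)) * pd 1 a f (\<gamma> 0) + of_real (Im (v a)) * pd \<i> a f (\<gamma> 0))) (at 0)"
proof -
  define z where "z = \<gamma> 0"
  define L where "L = (\<lambda>h. \<Sum>a<n. of_real (Re (h a)) * pd 1 a f z + of_real (Im (h a)) * pd \<i> a f z)"
  define R where "R = (\<lambda>t. f (\<gamma> t) - f z - L (\<lambda>a. \<gamma> t a - z a))"
  have R: "(R has_vector_derivative 0) (at 0)"
    unfolding has_vector_derivative_def has_derivative_at_alt
  proof (intro conjI allI impI)
    fix e :: real assume e: "e > 0"
    \<comment> \<open>For small \<open>t\<close> the coordinate displacements sum to at most
      \<open>(M - 1) * \<bar>t\<bar>\<close>; the extra 1 makes \<open>M\<close> positive even for
      \<open>n = 0\<close>. With tolerance \<open>e / M\<close> the remainder is at most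
      \<open>e * \<bar>t\<bar>\<close>.\<close>
    define M where "M = (\<Sum>a<n. norm (v a) + 1) + 1"
    have M: "M > 0" unfolding M_def by (intro add_nonneg_pos sum_nonneg) (auto intro: add_nonneg_nonneg)
    obtain \<delta> where \<delta>: "\<delta> > 0" "\<And>w. near n \<delta> z w \<Longrightarrow> norm (f w - f z - L (\<lambda>a. w a - z a)) \<le> e / M * (\<Sum>a<n. norm (w a - z a))"
      using total_derivative_estimate[OF D(1) D(2)[folded z_def] f divide_pos_pos[OF e M]] unfolding L_def by blast
    have lin: "eventually (\<lambda>t. norm (\<gamma> t a - z a) \<le> (norm (v a) + 1) * \<bar>t\<bar>) (nhds 0)" if a: "a < n" for a
    proof -
      obtain d where "d > 0" "\<And>t. norm t < d \<Longrightarrow> norm (\<gamma> t a - z a - t *\<^sub>R v a) \<le> norm t"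
        using \<gamma>[OF a] unfolding has_vector_derivative_def has_derivative_at_alt z_def
        by (auto dest: spec[of _ 1])
      then have "norm (\<gamma> t a - z a) \<le> (norm (v a) + 1) * \<bar>t\<bar>" if "dist t 0 < d" for t
        using norm_triangle_mono[of "\<gamma> t a - z a - t *\<^sub>R v a" "norm t" "t *\<^sub>R v a" "\<bar>t\<bar> * norm (v a)"] that
        by (simp add: algebra_simps)
      then show ?thesis using \<open>d > 0\<close> unfolding eventually_nhds_metric by blast
    qed
    have small: "eventually (\<lambda>t. dist (\<gamma> t a) (z a) < \<delta>) (nhds 0)" if "a < n" for a
    proof -
      have "isCont (\<lambda>t. \<gamma> t a) 0" using \<gamma>[OF that] by (rule has_vector_derivative_continuous)
      then have "((\<lambda>t. \<gamma> t a) \<longlongrightarrow> z a) (nhds 0)"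
        unfolding isCont_def z_def by (rule tendsto_at_iff_tendsto_nhds[THEN iffD1])
      then show ?thesis using \<delta>(1) by (rule tendstoD)
    qed
    have "eventually (\<lambda>t. \<forall>a\<in>{..<n}. norm (\<gamma> t a - z a) \<le> (norm (v a) + 1) * \<bar>t\<bar>) (nhds 0)"
      "eventually (\<lambda>t. \<forall>a\<in>{..<n}. dist (\<gamma> t a) (z a) < \<delta>) (nhds 0)"
      using lin small by (auto intro!: eventually_ball_finite)
    then have "eventually (\<lambda>t. norm (R t) \<le> e * \<bar>t\<bar>) (nhds 0)"
      using C
    proof eventually_elim
      case (elim t)
      have "norm (R t) \<le> e / M * (\<Sum>a<n. norm (\<gamma> t a - z a))"
        unfolding R_def by (rule \<delta>(2)) (use elim in \<open>auto simp: near_def\<close>)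
      also have "\<dots> \<le> e / M * (\<Sum>a<n. (norm (v a) + 1) * \<bar>t\<bar>)"
        using e M elim by (intro mult_left_mono sum_mono) auto
      also have "\<dots> = e / M * ((M - 1) * \<bar>t\<bar>)" by (simp add: M_def sum_distrib_right)
      also have "\<dots> \<le> e / M * (M * \<bar>t\<bar>)"
        using e M by (intro mult_left_mono mult_right_mono) auto
      finally show ?case using M by simp
    qed
    then obtain d where "d > 0" "\<And>t. dist t 0 < d \<Longrightarrow> norm (R t) \<le> e * \<bar>t\<bar>"
      unfolding eventually_nhds_metric by blast
    moreover have "R 0 = 0" by (simp add: R_def z_def L_def)
    ultimately show "\<exists>d>0. \<forall>y. norm (y - 0) < d \<longrightarrow> norm (R y - R 0 - (y - 0) *\<^sub>R 0) \<le> e * norm (y - 0)"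
      by (intro exI[of _ d]) auto
  qed (auto intro: bounded_linear_zero)
  have Re: "((\<lambda>t. complex_of_real (Re (\<gamma> t a - z a)) * pd 1 a f z) has_vector_derivative of_real (Re (v a)) * pd 1 a f z) (at 0)"
    and Im: "((\<lambda>t. complex_of_real (Im (\<gamma> t a - z a)) * pd \<i> a f z) has_vector_derivative of_real (Im (v a)) * pd \<i> a f z) (at 0)"
    if "a < n" for a
  proof -
    have "((\<lambda>t. \<gamma> t a - z a) has_vector_derivative v a - 0) (at 0)"
      by (intro has_vector_derivative_diff \<gamma> that has_vector_derivative_const)
    then show "((\<lambda>t. complex_of_real (Re (\<gamma> t a - z a)) * pd 1 a f z) has_vector_derivative of_real (Re (v a)) * pd 1 a f z) (at 0)"
      "((\<lambda>t. complex_of_real (Im (\<gamma> t a - z a)) * pd \<i> a f z) has_vector_derivative of_real (Im (v a)) * pd \<i> a f z) (at 0)"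
      by (auto intro!: DERIV_cmult_right simp: has_vector_derivative_complex_iff)
  qed
  have "((\<lambda>t. L (\<lambda>a. \<gamma> t a - z a)) has_vector_derivative L v) (at 0)"
    unfolding L_def by (intro has_vector_derivative_sum has_vector_derivative_add Re Im) auto
  from has_vector_derivative_add[OF has_vector_derivative_add[OF R this] has_vector_derivative_const[of "f z"]]
  show ?thesis by (simp add: R_def L_def z_def)
qed

text \<open>\<open>P\<close> and \<open>Q\<close> are the derivatives of \<open>f\<close> by the \<open>i\<close>-th coordinate and by its conjugate.\<close>

definition has_wirtinger :: "nat \<Rightarrow> ((nat \<Rightarrow> complex) \<Rightarrow> complex) \<Rightarrow> (nat \<Rightarrow> complex) \<Rightarrow> complex \<Rightarrow> complex \<Rightarrow> bool" where
  "has_wirtinger i f z P Q \<longleftrightarrow>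
     (\<forall>u\<in>{1, \<i>}. ((\<lambda>t. f (line i u z t)) has_vector_derivative (P * u + Q * cnj u)) (at 0))"

lemma has_wirtingerD: "has_wirtinger i f z P Q \<Longrightarrow> u \<in> {1, \<i>} \<Longrightarrow>
   ((\<lambda>t. f (line i u z t)) has_vector_derivative (P * u + Q * cnj u)) (at 0)"
  by (simp only: has_wirtinger_def Ball_def)

lemma Ck_on_Suc_differentiable:
  "Ck_on n (Suc k) D f \<Longrightarrow> i < n \<Longrightarrow> u \<in> {1, \<i>} \<Longrightarrow> z \<in> D \<Longrightarrow>
     (\<lambda>t::real. f (line i u z t)) differentiable (at 0)"
  unfolding Ck_on.simps by blast

lemma Ck_on_Suc_pd:
  "Ck_on n (Suc k) D f \<Longrightarrow> i < n \<Longrightarrow> u \<in> {1, \<i>} \<Longrightarrow> Ck_on n k D (pd u i f)"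
  unfolding Ck_on.simps by blast

lemma Ck_on_Suc_has_pd:
  "Ck_on n (Suc k) D f \<Longrightarrow> i < n \<Longrightarrow> u \<in> {1, \<i>} \<Longrightarrow> z \<in> D \<Longrightarrow>
     ((\<lambda>t. f (line i u z t)) has_vector_derivative pd u i f z) (at 0)"
  by (intro has_vector_derivative_pd Ck_on_Suc_differentiable)

lemma Ck_on_SucI:
  assumes "continuous_on D f"
    and "\<And>i u z. i < n \<Longrightarrow> u \<in> {1, \<i>} \<Longrightarrow> z \<in> D \<Longrightarrow>
      ((\<lambda>t. f (line i u z t)) has_vector_derivative v i u z) (at 0)"
    and "\<And>i u. i < n \<Longrightarrow> u \<in> {1, \<i>} \<Longrightarrow> Ck_on n k D (pd u i f)"
  shows "Ck_on n (Suc k) D f"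
  unfolding Ck_on.simps using assms(1) assms(3) differentiableI_vector[OF assms(2)] by blast

lemma has_wirtinger_imp_d_z: "has_wirtinger i f z P Q \<Longrightarrow> d_z i f z = P"
  and has_wirtinger_imp_d_zbar: "has_wirtinger i f z P Q \<Longrightarrow> d_zbar i f z = Q"
proof -
  assume *: "has_wirtinger i f z P Q"
  have "pd 1 i f z = P + Q" "pd \<i> i f z = \<i> * (P - Q)"
    using pd_eqI[OF has_wirtingerD[OF *, of 1]] pd_eqI[OF has_wirtingerD[OF *, of \<i>]]
    by (auto simp: algebra_simps)
  then show "d_z i f z = P" "d_zbar i f z = Q"
    by (simp_all add: d_z_def d_zbar_def flip: mult.assoc)
qed

section \<open>Calculus of Wirtinger derivatives\<close>

lemma has_wirtinger_const: "has_wirtinger i (\<lambda>_. c) z 0 0"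
  by (simp add: has_wirtinger_def)

lemma has_wirtinger_add:
  assumes "has_wirtinger i f z P Q" "has_wirtinger i g z P' Q'"
  shows "has_wirtinger i (\<lambda>w. f w + g w) z (P + P') (Q + Q')"
  unfolding has_wirtinger_def
proof
  fix u :: complex assume u: "u \<in> {1, \<i>}"
  show "((\<lambda>t. f (line i u z t) + g (line i u z t)) has_vector_derivative (P + P') * u + (Q + Q') * cnj u) (at 0)"
    using has_vector_derivative_add[OF has_wirtingerD[OF assms(1) u] has_wirtingerD[OF assms(2) u]]
    by (simp add: algebra_simps)
qed

lemma has_wirtinger_sum:
  "(\<And>k. k \<in> S \<Longrightarrow> has_wirtinger i (f k) z (P k) (Q k)) \<Longrightarrow>
     has_wirtinger i (\<lambda>w. \<Sum>k\<in>S. f k w) z (\<Sum>k\<in>S. P k) (\<Sum>k\<in>S. Q k)"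
  by (induction S rule: infinite_finite_induct) (auto intro: has_wirtinger_const has_wirtinger_add)

lemma has_wirtinger_mult:
  assumes "has_wirtinger i f z P Q" "has_wirtinger i g z P' Q'"
  shows "has_wirtinger i (\<lambda>w. f w * g w) z (P * g z + f z * P') (Q * g z + f z * Q')"
  unfolding has_wirtinger_def
proof
  fix u :: complex assume u: "u \<in> {1, \<i>}"
  show "((\<lambda>t. f (line i u z t) * g (line i u z t)) has_vector_derivative
          (P * g z + f z * P') * u + (Q * g z + f z * Q') * cnj u) (at 0)"
    using has_vector_derivative_mult[OF has_wirtingerD[OF assms(1) u] has_wirtingerD[OF assms(2) u]]
    by (simp add: algebra_simps)
qed

lemma has_wirtinger_cmult:
  "has_wirtinger i f z P Q \<Longrightarrow> has_wirtinger i (\<lambda>w. c * f w) z (c * P) (c * Q)"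
  using has_wirtinger_mult[OF has_wirtinger_const] by fastforce

lemma has_wirtinger_prod:
  assumes "finite S" "\<And>k. k \<in> S \<Longrightarrow> has_wirtinger i (f k) z (P k) (Q k)"
  shows "has_wirtinger i (\<lambda>w. \<Prod>k\<in>S. f k w) z
           (\<Sum>k\<in>S. P k * (\<Prod>l\<in>S - {k}. f l z)) (\<Sum>k\<in>S. Q k * (\<Prod>l\<in>S - {k}. f l z))"
  using assms
proof (induction S rule: finite_induct)
  case empty
  then show ?case by (simp add: has_wirtinger_const)
next
  case (insert x F)
  have eq: "(\<Sum>k\<in>insert x F. R k * (\<Prod>l\<in>insert x F - {k}. f l z))
      = R x * (\<Prod>l\<in>F. f l z) + f x z * (\<Sum>k\<in>F. R k * (\<Prod>l\<in>F - {k}. f l z))" for R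
  proof -
    have "(\<Prod>l\<in>insert x F - {k}. f l z) = f x z * (\<Prod>l\<in>F - {k}. f l z)" if "k \<in> F" for k
      using insert.hyps that by (subst insert_Diff_if) auto
    then have "(\<Sum>k\<in>F. R k * (\<Prod>l\<in>insert x F - {k}. f l z)) = f x z * (\<Sum>k\<in>F. R k * (\<Prod>l\<in>F - {k}. f l z))"
      by (simp add: sum_distrib_left mult_ac)
    moreover have "insert x F - {x} = F" using insert.hyps by auto
    ultimately show ?thesis using insert.hyps by simp
  qed
  show ?case unfolding eq using insert.hyps
    by simp (rule has_wirtinger_mult, auto intro: insert)
qed

lemma has_wirtinger_cnj:
  assumes "has_wirtinger i f z P Q"
  shows "has_wirtinger i (\<lambda>w. cnj (f w)) z (cnj Q) (cnj P)"
  unfolding has_wirtinger_def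
proof
  fix u :: complex assume u: "u \<in> {1, \<i>}"
  show "((\<lambda>t. cnj (f (line i u z t))) has_vector_derivative cnj Q * u + cnj P * cnj u) (at 0)"
    using has_vector_derivative_cnj[OF has_wirtingerD[OF assms u]] by (simp add: add.commute)
qed

lemma has_wirtinger_cong:
  assumes "openC n D" "z \<in> D" "i < n" "has_wirtinger i f z P Q" "\<And>w. w \<in> D \<Longrightarrow> f w = g w"
  shows "has_wirtinger i g z P Q"
  unfolding has_wirtinger_def
  by (intro ballI has_vector_derivative_line_cong[OF assms(1-3,5)] has_wirtingerD[OF assms(4)]) auto

text \<open>\<open>vector_derivative\<close> chooses among the values that qualify as a derivative.
  Functions agreeing near \<open>z\<close> have the same such values, so the choice agrees even
  where there are none.\<close>

lemma d_z_cong: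
  assumes "openC n D" "z \<in> D" "i < n" "\<And>w. w \<in> D \<Longrightarrow> f w = g w"
  shows "d_z i f z = d_z i g z" and "d_zbar i f z = d_zbar i g z"
proof -
  have "pd u i f z = pd u i g z" for u
  proof -
    have "((\<lambda>t. f (line i u z t)) has_vector_derivative v) (at 0) \<longleftrightarrow>
          ((\<lambda>t. g (line i u z t)) has_vector_derivative v) (at 0)" for v
      using has_vector_derivative_line_cong[OF assms(1-3), of f g u v]
        has_vector_derivative_line_cong[OF assms(1-3), of g f u v] assms(4) by auto
    then show ?thesis unfolding pd_def vector_derivative_def by simp
  qed
  then show "d_z i f z = d_z i g z" "d_zbar i f z = d_zbar i g z"
    by (simp_all add: d_z_def d_zbar_def)
qed

lemma has_wirtinger_C1:
  assumes "Ck_on n 1 D f" "z \<in> D" "i < n"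
  shows "has_wirtinger i f z (d_z i f z) (d_zbar i f z)"
  unfolding has_wirtinger_def
proof
  fix u :: complex assume u: "u \<in> {1, \<i>}"
  have "((\<lambda>t. f (line i u z t)) has_vector_derivative pd u i f z) (at 0)"
    using Ck_on_Suc_has_pd[of n 0 D f] assms u by simp
  moreover have "pd u i f z = d_z i f z * u + d_zbar i f z * cnj u"
    using u by (auto simp: d_z_def d_zbar_def field_simps)
  ultimately show "((\<lambda>t. f (line i u z t)) has_vector_derivative d_z i f z * u + d_zbar i f z * cnj u) (at 0)"
    by simp
qed

lemma smooth_on_C1: "smooth_on n D f \<Longrightarrow> Ck_on n 1 D f"
  by (simp only: smooth_on_def)

lemmas has_wirtinger_smooth = has_wirtinger_C1[OF smooth_on_C1]

text \<open>A displacement \<open>u\<close> moves the inner coordinate \<open>a\<close> by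
  \<open>P a * u\<close> to first order, because its antiholomorphic derivative vanishes. Hence the
  two kinds of derivatives of \<open>f\<close> do not mix.\<close>

lemma has_wirtinger_chain:
  assumes D': "openC n D'" "(\<lambda>a. \<tau> a z) \<in> D'" and f: "Ck_on n 1 D' f"
    and D: "openC n D" "z \<in> D" "i < n"
    and C: "\<And>w. w \<in> D \<Longrightarrow> (\<lambda>a. \<tau> a w) \<in> Cspace n"
    and \<tau>: "\<And>a. a < n \<Longrightarrow> has_wirtinger i (\<tau> a) z (P a) 0"
  shows "has_wirtinger i (\<lambda>w. f (\<lambda>a. \<tau> a w)) z
           (\<Sum>a<n. d_z a f (\<lambda>a. \<tau> a z) * P a) (\<Sum>a<n. d_zbar a f (\<lambda>a. \<tau> a z) * cnj (P a))"
  unfolding has_wirtinger_def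
proof
  fix u :: complex assume u: "u \<in> {1, \<i>}"
  define \<gamma> where "\<gamma> = (\<lambda>t a. \<tau> a (line i u z t))"
  have \<gamma>0: "\<gamma> 0 = (\<lambda>a. \<tau> a z)" by (simp add: \<gamma>_def)
  have "eventually (\<lambda>t. \<gamma> t \<in> Cspace n) (nhds 0)"
    using eventually_line[OF D, of u] unfolding \<gamma>_def by eventually_elim (rule C)
  moreover have "((\<lambda>t. \<gamma> t a) has_vector_derivative P a * u) (at 0)" if "a < n" for a
    using has_wirtingerD[OF \<tau>[OF that] u] by (simp add: \<gamma>_def)
  ultimately have "((\<lambda>t. f (\<gamma> t)) has_vector_derivative
      (\<Sum>a<n. of_real (Re (P a * u)) * pd 1 a f (\<gamma> 0) + of_real (Im (P a * u)) * pd \<i> a f (\<gamma> 0))) (at 0)"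
    using D' f by (intro has_vector_derivative_curve) (auto simp: \<gamma>0)
  \<comment> \<open>The real differential of \<open>f\<close>, split into its complex linear and its
    antilinear part.\<close>
  moreover have "of_real (Re h) * pd 1 a f w + of_real (Im h) * pd \<i> a f w
      = d_z a f w * h + d_zbar a f w * cnj h" for h a w
    using complex_eq[of h] complex_eq[of "cnj h"]
    by (subst (5 6) complex_eq) (simp add: d_z_def d_zbar_def field_simps)
  ultimately have "((\<lambda>t. f (\<gamma> t)) has_vector_derivative
      (\<Sum>a<n. d_z a f (\<gamma> 0) * (P a * u) + d_zbar a f (\<gamma> 0) * cnj (P a * u))) (at 0)"
    by (simp only:)
  also have "(\<Sum>a<n. d_z a f (\<gamma> 0) * (P a * u) + d_zbar a f (\<gamma> 0) * cnj (P a * u))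
      = (\<Sum>a<n. d_z a f (\<gamma> 0) * P a) * u + (\<Sum>a<n. d_zbar a f (\<gamma> 0) * cnj (P a)) * cnj u"
    by (simp add: sum.distrib sum_distrib_right mult.assoc)
  finally show "((\<lambda>t. f (\<lambda>a. \<tau> a (line i u z t))) has_vector_derivative
      (\<Sum>a<n. d_z a f (\<lambda>a. \<tau> a z) * P a) * u + (\<Sum>a<n. d_zbar a f (\<lambda>a. \<tau> a z) * cnj (P a)) * cnj u) (at 0)"
    unfolding \<gamma>0 unfolding \<gamma>_def .
qed

text \<open>The recursion of \<open>Ck_on\<close> passes to partial derivatives that agree only on
  \<open>D\<close>, so the induction lets both functions vary.\<close>

lemma Ck_on_cong:
  assumes D: "openC n D"
  shows "Ck_on n k D f \<Longrightarrow> (\<And>w. w \<in> D \<Longrightarrow> f w = g w) \<Longrightarrow> Ck_on n k D g"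
proof (induction k arbitrary: f g)
  case 0
  then show ?case by (simp cong: continuous_on_cong)
next
  case (Suc k)
  have cont: "continuous_on D g"
    using Ck_on_continuous[OF Suc.prems(1)] Suc.prems(2) by (simp cong: continuous_on_cong)
  have vd: "((\<lambda>t. g (line i u z t)) has_vector_derivative pd u i f z) (at 0)"
    if "i < n" "u \<in> {1, \<i>}" "z \<in> D" for i u z
    by (rule has_vector_derivative_line_cong[OF D that(3,1) Suc.prems(2) Ck_on_Suc_has_pd[OF Suc.prems(1) that]])
  have "Ck_on n k D (pd u i g)" if "i < n" "u \<in> {1, \<i>}" for i u
    by (rule Suc.IH[OF Ck_on_Suc_pd[OF Suc.prems(1) that]]) (simp only: pd_eqI[OF vd[OF that]])
  with cont vd show ?case by (rule Ck_on_SucI)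
qed

text \<open>\<open>bounded_linear\<close> means real linear, so scaling by a complex constant and
  conjugation are both covered.\<close>

lemma Ck_on_linear:
  assumes D: "openC n D" and h: "bounded_linear (h :: complex \<Rightarrow> complex)"
  shows "Ck_on n k D f \<Longrightarrow> Ck_on n k D (\<lambda>w. h (f w))"
proof (induction k arbitrary: f)
  case 0
  then show ?case by (simp add: bounded_linear.continuous_on[OF h])
next
  case (Suc k)
  have cont: "continuous_on D (\<lambda>w. h (f w))"
    using Ck_on_continuous[OF Suc.prems] by (rule bounded_linear.continuous_on[OF h])
  have vd: "((\<lambda>t. h (f (line i u z t))) has_vector_derivative h (pd u i f z)) (at 0)"
    if "i < n" "u \<in> {1, \<i>}" "z \<in> D" for i u z
    by (rule bounded_linear.has_vector_derivative[OF h Ck_on_Suc_has_pd[OF Suc.prems that]])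
  have "Ck_on n k D (pd u i (\<lambda>w. h (f w)))" if "i < n" "u \<in> {1, \<i>}" for i u
    by (rule Ck_on_cong[OF D Suc.IH[OF Ck_on_Suc_pd[OF Suc.prems that]]])
      (simp only: pd_eqI[of "\<lambda>w. h (f w)", OF vd[OF that]])
  with cont vd show ?case by (rule Ck_on_SucI)
qed

lemma Ck_on_add:
  assumes D: "openC n D"
  shows "Ck_on n k D f \<Longrightarrow> Ck_on n k D g \<Longrightarrow> Ck_on n k D (\<lambda>w. f w + g w)"
proof (induction k arbitrary: f g)
  case 0
  then show ?case by (simp add: continuous_on_add)
next
  case (Suc k)
  have cont: "continuous_on D (\<lambda>w. f w + g w)"
    using Ck_on_continuous[OF Suc.prems(1)] Ck_on_continuous[OF Suc.prems(2)] by (rule continuous_on_add)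
  have vd: "((\<lambda>t. f (line i u z t) + g (line i u z t)) has_vector_derivative pd u i f z + pd u i g z) (at 0)"
    if "i < n" "u \<in> {1, \<i>}" "z \<in> D" for i u z
    by (intro has_vector_derivative_add Ck_on_Suc_has_pd[OF Suc.prems(1) that] Ck_on_Suc_has_pd[OF Suc.prems(2) that])
  have "Ck_on n k D (pd u i (\<lambda>w. f w + g w))" if "i < n" "u \<in> {1, \<i>}" for i u
    by (rule Ck_on_cong[OF D Suc.IH[OF Ck_on_Suc_pd[OF Suc.prems(1) that] Ck_on_Suc_pd[OF Suc.prems(2) that]]])
      (simp only: pd_eqI[of "\<lambda>w. f w + g w", OF vd[OF that]])
  with cont vd show ?case by (rule Ck_on_SucI)
qed

section \<open>Closure properties of smooth functions\<close>

lemma smooth_on_cong: "openC n D \<Longrightarrow> smooth_on n D f \<Longrightarrow> (\<And>w. w \<in> D \<Longrightarrow> f w = g w) \<Longrightarrow> smooth_on n D g"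
  unfolding smooth_on_def by (blast intro: Ck_on_cong)

lemma smooth_on_linear:
  "openC n D \<Longrightarrow> bounded_linear h \<Longrightarrow> smooth_on n D f \<Longrightarrow> smooth_on n D (\<lambda>w. h (f w))"
  unfolding smooth_on_def by (blast intro: Ck_on_linear)

lemma smooth_on_add:
  "openC n D \<Longrightarrow> smooth_on n D f \<Longrightarrow> smooth_on n D g \<Longrightarrow> smooth_on n D (\<lambda>w. f w + g w)"
  unfolding smooth_on_def by (blast intro: Ck_on_add)

lemma smooth_on_cmult: "openC n D \<Longrightarrow> smooth_on n D f \<Longrightarrow> smooth_on n D (\<lambda>w. c * f w)"
  by (rule smooth_on_linear[OF _ bounded_linear_mult_right])

lemma smooth_on_cnj: "openC n D \<Longrightarrow> smooth_on n D f \<Longrightarrow> smooth_on n D (\<lambda>w. cnj (f w))"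
  by (rule smooth_on_linear[OF _ bounded_linear_cnj])

lemma smooth_on_const: "smooth_on n D (\<lambda>_. c)"
proof -
  have "Ck_on n k D (\<lambda>_. c)" for k c
  proof (induction k arbitrary: c)
    case (Suc k)
    have "pd u i (\<lambda>_. c) = (\<lambda>_. 0)" for u i by (simp add: pd_def fun_eq_iff)
    then show ?case using Suc by simp
  qed simp
  then show ?thesis by (simp add: smooth_on_def)
qed

lemma smooth_on_sum:
  "openC n D \<Longrightarrow> (\<And>k. k \<in> S \<Longrightarrow> smooth_on n D (f k)) \<Longrightarrow> smooth_on n D (\<lambda>w. \<Sum>k\<in>S. f k w)"
  by (induction S rule: infinite_finite_induct) (auto intro: smooth_on_const smooth_on_add)

lemma smooth_on_pd: "smooth_on n D f \<Longrightarrow> i < n \<Longrightarrow> u \<in> {1, \<i>} \<Longrightarrow> smooth_on n D (pd u i f)"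
  unfolding smooth_on_def
proof (intro allI)
  fix k assume "\<forall>k. Ck_on n k D f" "i < n" "u \<in> {1, \<i>}"
  then have "Ck_on n (Suc k) D f" "i < n" "u \<in> {1, \<i>}" by blast+
  then show "Ck_on n k D (pd u i f)" by (rule Ck_on_Suc_pd)
qed

lemma smooth_on_d_z: "openC n D \<Longrightarrow> smooth_on n D f \<Longrightarrow> i < n \<Longrightarrow> smooth_on n D (d_z i f)"
  and smooth_on_d_zbar: "openC n D \<Longrightarrow> smooth_on n D f \<Longrightarrow> i < n \<Longrightarrow> smooth_on n D (d_zbar i f)"
proof -
  assume D: "openC n D" and f: "smooth_on n D f" "i < n"
  have "smooth_on n D (pd 1 i f)" "smooth_on n D (pd \<i> i f)" using f by (auto intro: smooth_on_pd)
  note sm = this[THEN smooth_on_cmult[OF D]]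
  have "smooth_on n D (\<lambda>z. 1/2 * pd 1 i f z + (- \<i>/2) * pd \<i> i f z)"
    "smooth_on n D (\<lambda>z. 1/2 * pd 1 i f z + (\<i>/2) * pd \<i> i f z)"
    by (rule smooth_on_add[OF D sm])+
  moreover have "(\<lambda>z. 1/2 * pd 1 i f z + (- \<i>/2) * pd \<i> i f z) = d_z i f"
    "(\<lambda>z. 1/2 * pd 1 i f z + (\<i>/2) * pd \<i> i f z) = d_zbar i f"
    by (auto simp: d_z_def d_zbar_def fun_eq_iff field_simps)
  ultimately show "smooth_on n D (d_z i f)" "smooth_on n D (d_zbar i f)" by simp_all
qed

lemma pd_lincomb:
  assumes "smooth_on n D f" "smooth_on n D g" "z \<in> D" "i < n" "u \<in> {1, \<i>}"
  shows "pd u i (\<lambda>w. (f w + c * g w) / 2) z = (pd u i f z + c * pd u i g z) / 2"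
proof (rule pd_eqI)
  have "((\<lambda>t. f (line i u z t)) has_vector_derivative pd u i f z) (at 0)"
    "((\<lambda>t. g (line i u z t)) has_vector_derivative pd u i g z) (at 0)"
    using smooth_on_C1[OF assms(1)] smooth_on_C1[OF assms(2)] assms(3-5)
    by (simp_all only: One_nat_def Ck_on_Suc_has_pd)
  then show "((\<lambda>t. (f (line i u z t) + c * g (line i u z t)) / 2) has_vector_derivative
               (pd u i f z + c * pd u i g z) / 2) (at 0)"
    by (intro has_vector_derivative_divide has_vector_derivative_add has_vector_derivative_mult_right)
qed

text \<open>Both sides expand into the same four second derivatives along real directions, which
  commute by \<open>pd_commute\<close>.\<close>

lemma
  assumes D: "openC n D" "z \<in> D" and f: "smooth_on n D f" and ij: "i < n" "j < n"
  shows d_z_commute: "d_z i (d_z j f) z = d_z j (d_z i f) z"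
    and d_z_d_zbar_commute: "d_z i (d_zbar j f) z = d_zbar j (d_z i f) z"
proof -
  have sm: "smooth_on n D (pd u k f)" if "u \<in> {1, \<i>}" "k < n" for u k
    using f that by (intro smooth_on_pd)
  have com: "pd v l (pd u k f) z = pd u k (pd v l f) z" if "u \<in> {1, \<i>}" "v \<in> {1, \<i>}" "k < n" "l < n" for u v k l
    using pd_commute[OF D that(3,4,1,2)] f by (auto simp: smooth_on_def)
  have lin: "pd u k (\<lambda>w. (pd 1 l f w + c * pd \<i> l f w) / 2) z = (pd u k (pd 1 l f) z + c * pd u k (pd \<i> l f) z) / 2"
    if "u \<in> {1, \<i>}" "k < n" "l < n" for u k l c
    using that D sm by (intro pd_lincomb) auto
  have dz: "d_z l f = (\<lambda>w. (pd 1 l f w + (- \<i>) * pd \<i> l f w) / 2)"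
    and dzb: "d_zbar l f = (\<lambda>w. (pd 1 l f w + \<i> * pd \<i> l f w) / 2)" for l
    by (auto simp: d_z_def d_zbar_def fun_eq_iff)
  have c: "pd 1 j (pd 1 i f) z = pd 1 i (pd 1 j f) z" "pd 1 j (pd \<i> i f) z = pd \<i> i (pd 1 j f) z"
    "pd \<i> j (pd 1 i f) z = pd 1 i (pd \<i> j f) z" "pd \<i> j (pd \<i> i f) z = pd \<i> i (pd \<i> j f) z"
    using ij by (auto intro: com)
  have e: "d_z k g z = (pd 1 k g z - \<i> * pd \<i> k g z) / 2" "d_zbar k g z = (pd 1 k g z + \<i> * pd \<i> k g z) / 2" for k g
    by (auto simp: d_z_def d_zbar_def)
  show "d_z i (d_z j f) z = d_z j (d_z i f) z"
    unfolding e dz by (simp only: lin ij insertI1 insertI2 c) (simp add: algebra_simps add_divide_distrib diff_divide_distrib)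
  show "d_z i (d_zbar j f) z = d_zbar j (d_z i f) z"
    unfolding e dz dzb by (simp only: lin ij insertI1 insertI2 c) (simp add: algebra_simps add_divide_distrib diff_divide_distrib)
qed

section \<open>Forms and the operators\<close>

locale complex_mfd =
  fixes n :: nat and X :: "'a topology" and \<A> :: "'a chart set"
  assumes mfd: "complex_manifold n X \<A>"
begin

lemma is_chart: "c \<in> \<A> \<Longrightarrow> is_chart n X c"
  using mfd by (auto simp: complex_manifold_def)

lemma openin_chart: "c \<in> \<A> \<Longrightarrow> openin X (fst c)"
  using is_chart[of c] by (auto simp: is_chart_def)

lemma openC_chart: "c \<in> \<A> \<Longrightarrow> openC n (snd c ` fst c)"
  using is_chart[of c] by (auto simp: is_chart_def)

lemma homeomorphic_chart:
  "c \<in> \<A> \<Longrightarrow> homeomorphic_map (subtopology X (fst c)) (top_of_set (snd c ` fst c)) (snd c)"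
  using is_chart[of c] by (auto simp: is_chart_def)

lemma inj_on_chart: "c \<in> \<A> \<Longrightarrow> inj_on (snd c) (fst c)"
  using homeomorphic_imp_injective_map[OF homeomorphic_chart[of c]] openin_subset[OF openin_chart[of c]]
  by (simp add: Int_absorb1)

lemma in_chart_snd: "c \<in> \<A> \<Longrightarrow> x \<in> fst c \<Longrightarrow> in_chart c f (snd c x) = f x"
  by (simp add: in_chart_def inj_on_chart)

lemma openC_overlap:
  assumes "c \<in> \<A>" "d \<in> \<A>"
  shows "openC n (snd c ` (fst c \<inter> fst d))"
proof -
  have "openin (subtopology X (fst c)) (fst c \<inter> fst d)"
    using openin_chart[OF assms(2)] by (auto simp: openin_subtopology)
  then have "openin (top_of_set (snd c ` fst c)) (snd c ` (fst c \<inter> fst d))"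
    using homeomorphic_imp_open_map[OF homeomorphic_chart[OF assms(1)]] by (auto simp: open_map_def)
  then show ?thesis using openC_chart[OF assms(1)] by (rule openin_trans)
qed

section \<open>Components of a form\<close>

lemmas forms_unfold = CollectD[OF subst[OF forms_def, of "\<lambda>S. \<omega> \<in> S" for \<omega>]]

lemma form_eq_0:
  "\<omega> \<in> forms n \<A> p q \<Longrightarrow> \<not> (c \<in> \<A> \<and> I \<in> indices n p \<and> J \<in> indices n q \<and> x \<in> fst c) \<Longrightarrow> \<omega> c I J x = 0"
  by (drule forms_unfold[THEN conjunct1]) blast

lemma form_eq_0':
  "\<omega> \<in> forms n \<A> p q \<Longrightarrow> \<not> (c \<in> \<A> \<and> I \<in> indices n p \<and> J \<in> indices n q) \<Longrightarrow>
     in_chart c (\<omega> c I J) = (\<lambda>_. 0)"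
  using form_eq_0[of \<omega> p q c I J] by (auto simp: in_chart_def fun_eq_iff)

lemma form_smooth:
  assumes "\<omega> \<in> forms n \<A> p q" "c \<in> \<A>"
  shows "smooth_on n (snd c ` fst c) (in_chart c (\<omega> c I J))"
proof (cases "I \<in> indices n p \<and> J \<in> indices n q")
  case True
  then show ?thesis using forms_unfold[OF assms(1), THEN conjunct2, THEN conjunct1] assms(2) by blast
next
  case False
  then show ?thesis using form_eq_0'[OF assms(1), of c I J] by (simp add: smooth_on_const)
qed

lemma form_alternating1:
  assumes "\<omega> \<in> forms n \<A> p q"
  shows "alternating n p (\<lambda>I. \<omega> c I J x)"
  unfolding alternating_def
proof (intro ballI allI impI)
  fix I s t assume *: "I \<in> indices n p" "s < p" "t < p" "s \<noteq> t"
  show "\<omega> c (swap_entries s t I) J x = - \<omega> c I J x"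
  proof (cases "c \<in> \<A> \<and> J \<in> indices n q \<and> x \<in> fst c")
    case True
    then show ?thesis using forms_unfold[OF assms, THEN conjunct2, THEN conjunct2, THEN conjunct1] * by blast
  next
    case False
    then show ?thesis using form_eq_0[OF assms, of c _ J x] by auto
  qed
qed

lemma form_alternating2:
  assumes "\<omega> \<in> forms n \<A> p q"
  shows "alternating n q (\<lambda>J. \<omega> c I J x)"
  unfolding alternating_def
proof (intro ballI allI impI)
  fix J s t assume *: "J \<in> indices n q" "s < q" "t < q" "s \<noteq> t"
  show "\<omega> c I (swap_entries s t J) x = - \<omega> c I J x"
  proof (cases "c \<in> \<A> \<and> I \<in> indices n p \<and> x \<in> fst c")
    case True
    then show ?thesis using forms_unfold[OF assms, THEN conjunct2, THEN conjunct2, THEN conjunct1] * by blast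
  next
    case False
    then show ?thesis using form_eq_0[OF assms, of c I _ x] by auto
  qed
qed

lemma form_transform:
  assumes "\<omega> \<in> forms n \<A> p q" "c \<in> \<A>" "d \<in> \<A>" "I \<in> indices n p" "J \<in> indices n q" "x \<in> fst c \<inter> fst d"
  shows "\<omega> c I J x =
          (\<Sum>A\<in>indices n p. \<Sum>B\<in>indices n q.
             \<omega> d A B x * (\<Prod>s<p. jac c d (A ! s) (I ! s) x)
                       * (\<Prod>t<q. cnj (jac c d (B ! t) (J ! t) x)))"
  using forms_unfold[OF assms(1), THEN conjunct2, THEN conjunct2, THEN conjunct2] assms(2-) by blast

lemma formsI:
  assumes "\<And>c I J x. \<not> (c \<in> \<A> \<and> I \<in> indices n p \<and> J \<in> indices n q \<and> x \<in> fst c) \<Longrightarrow> \<omega> c I J x = 0"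
    and "\<And>c I J. c \<in> \<A> \<Longrightarrow> I \<in> indices n p \<Longrightarrow> J \<in> indices n q \<Longrightarrow>
       smooth_on n (snd c ` fst c) (in_chart c (\<omega> c I J))"
    and "\<And>c J x. c \<in> \<A> \<Longrightarrow> J \<in> indices n q \<Longrightarrow> x \<in> fst c \<Longrightarrow> alternating n p (\<lambda>I. \<omega> c I J x)"
    and "\<And>c I x. c \<in> \<A> \<Longrightarrow> I \<in> indices n p \<Longrightarrow> x \<in> fst c \<Longrightarrow> alternating n q (\<lambda>J. \<omega> c I J x)"
    and "\<And>c d I J x. c \<in> \<A> \<Longrightarrow> d \<in> \<A> \<Longrightarrow> I \<in> indices n p \<Longrightarrow> J \<in> indices n q \<Longrightarrow> x \<in> fst c \<inter> fst d \<Longrightarrow>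
       \<omega> c I J x =
          (\<Sum>A\<in>indices n p. \<Sum>B\<in>indices n q.
             \<omega> d A B x * (\<Prod>s<p. jac c d (A ! s) (I ! s) x)
                       * (\<Prod>t<q. cnj (jac c d (B ! t) (J ! t) x)))"
  shows "\<omega> \<in> forms n \<A> p q"
  unfolding forms_def mem_Collect_eq
  by (intro conjI allI impI ballI;
      (rule assms(1) | rule assms(2) | rule alternatingD[OF assms(3)] | rule alternatingD[OF assms(4)] | rule assms(5));
      assumption)

section \<open>Forms as a complex vector space\<close>

lemma zero_form: "0 \<in> forms n \<A> p q"
proof (rule formsI)
  fix c I J
  have "in_chart c (0 c I J) = (\<lambda>_. 0)" by (simp add: in_chart_def fun_eq_iff)
  then show "smooth_on n (snd c ` fst c) (in_chart c (0 c I J))" by (simp only: smooth_on_const)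
qed (auto simp: alternating_def)

lemma add_form:
  assumes "\<omega> \<in> forms n \<A> p q" "\<eta> \<in> forms n \<A> p q"
  shows "\<omega> + \<eta> \<in> forms n \<A> p q"
proof (rule formsI)
  fix c I J assume c: "c \<in> \<A>"
  have "in_chart c ((\<omega> + \<eta>) c I J) = (\<lambda>w. in_chart c (\<omega> c I J) w + in_chart c (\<eta> c I J) w)"
    by (simp add: in_chart_def fun_eq_iff)
  then show "smooth_on n (snd c ` fst c) (in_chart c ((\<omega> + \<eta>) c I J))"
    using openC_chart[OF c] form_smooth[OF assms(1) c] form_smooth[OF assms(2) c] by (simp add: smooth_on_add)
next
  fix c d I J x assume *: "c \<in> \<A>" "d \<in> \<A>" "I \<in> indices n p" "J \<in> indices n q" "x \<in> fst c \<inter> fst d"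
  show "(\<omega> + \<eta>) c I J x =
          (\<Sum>A\<in>indices n p. \<Sum>B\<in>indices n q.
             (\<omega> + \<eta>) d A B x * (\<Prod>s<p. jac c d (A ! s) (I ! s) x)
                       * (\<Prod>t<q. cnj (jac c d (B ! t) (J ! t) x)))"
    using form_transform[OF assms(1) *] form_transform[OF assms(2) *]
    by (simp add: sum.distrib distrib_right)
qed (use form_eq_0[OF assms(1)] form_eq_0[OF assms(2)]
    form_alternating1[OF assms(1)] form_alternating1[OF assms(2)]
    form_alternating2[OF assms(1)] form_alternating2[OF assms(2)] in \<open>auto simp: alternating_def\<close>)

lemma cscale_form:
  assumes "\<omega> \<in> forms n \<A> p q"
  shows "cscale a \<omega> \<in> forms n \<A> p q"
proof (rule formsI)
  fix c I J assume c: "c \<in> \<A>"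
  have "in_chart c (cscale a \<omega> c I J) = (\<lambda>w. a * in_chart c (\<omega> c I J) w)"
    by (simp add: in_chart_def cscale_def fun_eq_iff)
  then show "smooth_on n (snd c ` fst c) (in_chart c (cscale a \<omega> c I J))"
    using openC_chart[OF c] form_smooth[OF assms c] by (simp add: smooth_on_cmult)
next
  fix c d I J x assume *: "c \<in> \<A>" "d \<in> \<A>" "I \<in> indices n p" "J \<in> indices n q" "x \<in> fst c \<inter> fst d"
  show "cscale a \<omega> c I J x =
          (\<Sum>A\<in>indices n p. \<Sum>B\<in>indices n q.
             cscale a \<omega> d A B x * (\<Prod>s<p. jac c d (A ! s) (I ! s) x)
                       * (\<Prod>t<q. cnj (jac c d (B ! t) (J ! t) x)))"
    using form_transform[OF assms *] by (simp add: cscale_def sum_distrib_left mult.assoc)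
qed (use form_eq_0[OF assms] form_alternating1[OF assms] form_alternating2[OF assms]
    in \<open>auto simp: alternating_def cscale_def\<close>)

text \<open>The conjugate form up to the sign (-1)^(pq), the cost of reordering the conjugated
  differentials. Leaving the sign out keeps the definition independent of the bidegree.\<close>

definition conj_form :: "'a form \<Rightarrow> 'a form" where
  "conj_form \<omega> = (\<lambda>c I J x. cnj (\<omega> c J I x))"

lemma conj_form_forms:
  assumes "\<omega> \<in> forms n \<A> p q"
  shows "conj_form \<omega> \<in> forms n \<A> q p"
proof (rule formsI)
  fix c I J assume c: "c \<in> \<A>"
  have "in_chart c (conj_form \<omega> c I J) = (\<lambda>w. cnj (in_chart c (\<omega> c J I) w))"
    by (simp add: in_chart_def conj_form_def fun_eq_iff)
  then show "smooth_on n (snd c ` fst c) (in_chart c (conj_form \<omega> c I J))"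
    using openC_chart[OF c] form_smooth[OF assms c] by (simp add: smooth_on_cnj)
next
  fix c d I J x assume *: "c \<in> \<A>" "d \<in> \<A>" "I \<in> indices n q" "J \<in> indices n p" "x \<in> fst c \<inter> fst d"
  show "conj_form \<omega> c I J x =
          (\<Sum>A\<in>indices n q. \<Sum>B\<in>indices n p.
             conj_form \<omega> d A B x * (\<Prod>s<q. jac c d (A ! s) (I ! s) x)
                       * (\<Prod>t<p. cnj (jac c d (B ! t) (J ! t) x)))"
    using form_transform[OF assms *(1,2,4,3,5)]
    by (simp add: conj_form_def mult_ac) (rule sum.swap)
qed (use form_eq_0[OF assms] form_alternating1[OF assms] form_alternating2[OF assms]
    in \<open>auto simp: alternating_def conj_form_def\<close>)

lemma form_has_wirtinger:
  assumes "\<omega> \<in> forms n \<A> p q" "x \<in> fst c" "i < n"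
  shows "has_wirtinger i (in_chart c (\<omega> c I J)) (snd c x)
           (d_z i (in_chart c (\<omega> c I J)) (snd c x)) (d_zbar i (in_chart c (\<omega> c I J)) (snd c x))"
proof (cases "c \<in> \<A>")
  case True
  show ?thesis by (rule has_wirtinger_smooth[OF form_smooth[OF assms(1) True]]) (use assms in auto)
next
  case False
  then have 0: "in_chart c (\<omega> c I J) = (\<lambda>_. 0)" using form_eq_0'[OF assms(1)] by blast
  show ?thesis
    unfolding 0 has_wirtinger_imp_d_z[OF has_wirtinger_const] has_wirtinger_imp_d_zbar[OF has_wirtinger_const]
    by (rule has_wirtinger_const)
qed

lemma del_add:
  assumes "\<omega> \<in> forms n \<A> p q" "\<eta> \<in> forms n \<A> p q"
  shows "del n (\<omega> + \<eta>) = del n \<omega> + del n \<eta>"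
proof (intro ext)
  fix c I J x
  show "del n (\<omega> + \<eta>) c I J x = (del n \<omega> + del n \<eta>) c I J x"
  proof (cases "x \<in> fst c \<and> set I \<subseteq> {..<n} \<and> set J \<subseteq> {..<n}")
    case True
    have "d_z (I ! s) (in_chart c ((\<omega> + \<eta>) c K J)) (snd c x)
        = d_z (I ! s) (in_chart c (\<omega> c K J)) (snd c x) + d_z (I ! s) (in_chart c (\<eta> c K J)) (snd c x)"
      if "s < length I" for s K
    proof -
      have "in_chart c ((\<omega> + \<eta>) c K J) = (\<lambda>w. in_chart c (\<omega> c K J) w + in_chart c (\<eta> c K J) w)"
        by (simp add: in_chart_def fun_eq_iff)
      moreover have "I ! s < n" using True that by (auto simp: subset_iff)
      ultimately show ?thesis using True
        by (simp add: has_wirtinger_imp_d_z[OF has_wirtinger_add[OF form_has_wirtinger[OF assms(1)] form_has_wirtinger[OF assms(2)]]])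
    qed
    then show ?thesis using True by (simp add: del_def distrib_left sum.distrib)
  next
    case False
    then show ?thesis by (auto simp: del_def)
  qed
qed

lemma del_cscale:
  assumes "\<omega> \<in> forms n \<A> p q"
  shows "del n (cscale a \<omega>) = cscale a (del n \<omega>)"
proof (intro ext)
  fix c I J x
  show "del n (cscale a \<omega>) c I J x = cscale a (del n \<omega>) c I J x"
  proof (cases "x \<in> fst c \<and> set I \<subseteq> {..<n} \<and> set J \<subseteq> {..<n}")
    case True
    have "d_z (I ! s) (in_chart c (cscale a \<omega> c K J)) (snd c x)
        = a * d_z (I ! s) (in_chart c (\<omega> c K J)) (snd c x)"
      if "s < length I" for s K
    proof -
      have "in_chart c (cscale a \<omega> c K J) = (\<lambda>w. a * in_chart c (\<omega> c K J) w)"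
        by (simp add: in_chart_def cscale_def fun_eq_iff)
      moreover have "I ! s < n" using True that by (auto simp: subset_iff)
      ultimately show ?thesis using True
        by (simp add: has_wirtinger_imp_d_z[OF has_wirtinger_cmult[OF form_has_wirtinger[OF assms]]])
    qed
    then show ?thesis using True by (simp add: del_def cscale_def sum_distrib_left mult_ac)
  next
    case False
    then show ?thesis by (auto simp: del_def cscale_def)
  qed
qed

lemma in_chart_del:
  assumes "c \<in> \<A>" "w \<in> snd c ` fst c" "set I \<subseteq> {..<n}" "set J \<subseteq> {..<n}"
  shows "in_chart c (del n \<omega> c I J) w =
     (\<Sum>s<length I. (-1) ^ s * d_z (I ! s) (in_chart c (\<omega> c (omit s I) J)) w)"
  using assms by (auto simp: in_chart_snd del_def)

lemma in_chart_delbar: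
  assumes "c \<in> \<A>" "w \<in> snd c ` fst c" "set I \<subseteq> {..<n}" "set J \<subseteq> {..<n}"
  shows "in_chart c (delbar n \<omega> c I J) w = (-1) ^ length I *
     (\<Sum>t<length J. (-1) ^ t * d_zbar (J ! t) (in_chart c (\<omega> c I (omit t J))) w)"
  using assms by (auto simp: in_chart_snd delbar_def)

text \<open>The formula for \<open>del\<close> makes sense for index lists of any length and for
  every chart. Outside the expected range each summand differentiates a component that vanishes
  identically, since omitting one entry cannot repair a wrong length.\<close>

lemma del_eq_0:
  assumes "\<omega> \<in> forms n \<A> p q"
    and "\<not> (c \<in> \<A> \<and> I \<in> indices n (Suc p) \<and> J \<in> indices n q \<and> x \<in> fst c)"
  shows "del n \<omega> c I J x = 0"
proof (cases "x \<in> fst c \<and> set I \<subseteq> {..<n} \<and> set J \<subseteq> {..<n}")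
  case True
  have "d_z (I ! s) (in_chart c (\<omega> c (omit s I) J)) (snd c x) = 0" if "s < length I" for s
  proof -
    have "\<not> (c \<in> \<A> \<and> omit s I \<in> indices n p \<and> J \<in> indices n q)"
      using assms(2) True that by (auto simp: indices_def length_omit)
    then show ?thesis
      using form_eq_0'[OF assms(1)] has_wirtinger_imp_d_z[OF has_wirtinger_const] by simp
  qed
  then show ?thesis by (simp add: del_def)
next
  case False
  then show ?thesis by (auto simp: del_def)
qed

text \<open>\<open>conj_form\<close> leaves out the sign (-1)^(pq) on the way in and (-1)^(p(q+1))
  on the way back, so (-1)^p remains.\<close>

lemma delbar_eq_conj:
  assumes "\<omega> \<in> forms n \<A> p q"
  shows "delbar n \<omega> = cscale ((-1) ^ p) (conj_form (del n (conj_form \<omega>)))"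
proof (intro ext)
  fix c I J x
  show "delbar n \<omega> c I J x = cscale ((-1) ^ p) (conj_form (del n (conj_form \<omega>))) c I J x"
  proof (cases "x \<in> fst c \<and> set I \<subseteq> {..<n} \<and> set J \<subseteq> {..<n}")
    case True
    have conj: "cnj (d_z (J ! t) (in_chart c (conj_form \<omega> c K I)) (snd c x))
        = d_zbar (J ! t) (in_chart c (\<omega> c I K)) (snd c x)"
      if "t < length J" for t K
    proof -
      have "in_chart c (conj_form \<omega> c K I) = (\<lambda>w. cnj (in_chart c (\<omega> c I K) w))"
        by (simp add: in_chart_def conj_form_def fun_eq_iff)
      moreover have "J ! t < n" using True that by (auto simp: subset_iff)
      ultimately show ?thesis using True
        by (simp add: has_wirtinger_imp_d_z[OF has_wirtinger_cnj[OF form_has_wirtinger[OF assms]]])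
    qed
    have *: "delbar n \<omega> c I J x = (-1) ^ length I * conj_form (del n (conj_form \<omega>)) c I J x"
      using True by (simp add: delbar_def conj_form_def del_def flip: conj)
    show ?thesis
    \<comment> \<open>\<open>delbar\<close> carries the sign of \<open>length I\<close>, the
      right-hand side that of \<open>p\<close>; for lists of another length both sides are
      0.\<close>
    proof (cases "length I = p")
      case True
      then show ?thesis using * by (simp add: cscale_def)
    next
      case False
      then have "del n (conj_form \<omega>) c J I x = 0"
        by (intro del_eq_0[OF conj_form_forms[OF assms]]) (auto simp: indices_def)
      then show ?thesis using * by (simp add: cscale_def conj_form_def)
    qed
  next
    case False
    then show ?thesis by (auto simp: delbar_def cscale_def conj_form_def del_def)
  qed
qed

lemma conj_form_add: "conj_form (\<omega> + \<eta>) = conj_form \<omega> + conj_form \<eta>"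
  by (simp add: conj_form_def fun_eq_iff)

lemma conj_form_cscale: "conj_form (cscale a \<omega>) = cscale (cnj a) (conj_form \<omega>)"
  by (simp add: conj_form_def cscale_def fun_eq_iff)

lemma conj_form_conj_form: "conj_form (conj_form \<omega>) = \<omega>"
  by (simp add: conj_form_def)

lemma cscale_cscale: "cscale a (cscale b \<omega>) = cscale (a * b) \<omega>"
  by (simp add: cscale_def mult.assoc)

lemma cscale_add: "cscale a (\<omega> + \<eta>) = cscale a \<omega> + cscale a \<eta>"
  by (simp add: cscale_def fun_eq_iff distrib_left)

lemma delbar_add:
  assumes "\<omega> \<in> forms n \<A> p q" "\<eta> \<in> forms n \<A> p q"
  shows "delbar n (\<omega> + \<eta>) = delbar n \<omega> + delbar n \<eta>"
  using assms
  by (simp add: delbar_eq_conj[OF add_form[OF assms]] delbar_eq_conj[OF assms(1)] delbar_eq_conj[OF assms(2)]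
      conj_form_add del_add[OF conj_form_forms conj_form_forms] cscale_add)

lemma delbar_cscale:
  assumes "\<omega> \<in> forms n \<A> p q"
  shows "delbar n (cscale a \<omega>) = cscale a (delbar n \<omega>)"
  by (simp add: delbar_eq_conj[OF cscale_form[OF assms]] delbar_eq_conj[OF assms]
      conj_form_cscale del_cscale[OF conj_form_forms[OF assms]] cscale_cscale mult.commute)

lemma del_del:
  assumes "\<omega> \<in> forms n \<A> p q"
  shows "del n (del n \<omega>) = 0"
proof (intro ext)
  fix c I J x
  show "del n (del n \<omega>) c I J x = 0 c I J x"
  proof (cases "x \<in> fst c \<and> set I \<subseteq> {..<n} \<and> set J \<subseteq> {..<n}")
    case True
    define z where "z = snd c x"
    define F where "F = (\<lambda>L. in_chart c (\<omega> c L J))"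
    show ?thesis
    proof (cases "c \<in> \<A>")
      case c: True
      note D = openC_chart[OF c]
      have z: "z \<in> snd c ` fst c" using True by (simp add: z_def)
      have "d_z (I ! s) (in_chart c (del n \<omega> c (omit s I) J)) z
          = (\<Sum>r<length I - 1. (-1) ^ r * d_z (I ! s) (d_z (omit s I ! r) (F (omit r (omit s I)))) z)"
        if s: "s < length I" for s
      proof -
        have Is: "I ! s < n" "set (omit s I) \<subseteq> {..<n}"
          using True s set_omit_subset[of s I] by (auto simp: subset_iff)
        have eq: "d_z (I ! s) (in_chart c (del n \<omega> c (omit s I) J)) z
            = d_z (I ! s) (\<lambda>w. \<Sum>r<length I - 1. (-1) ^ r * d_z (omit s I ! r) (F (omit r (omit s I))) w) z"
          by (rule d_z_cong(1)[OF D z Is(1)]) (use True Is s in_chart_del[OF c] in \<open>auto simp: F_def length_omit\<close>)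
        show ?thesis unfolding eq
        proof (rule has_wirtinger_imp_d_z, rule has_wirtinger_sum, rule has_wirtinger_cmult)
          fix r assume "r \<in> {..<length I - 1}"
          then have r: "omit s I ! r < n" using Is(2) s by (auto simp: length_omit subset_iff)
          show "has_wirtinger (I ! s) (d_z (omit s I ! r) (F (omit r (omit s I)))) z
             (d_z (I ! s) (d_z (omit s I ! r) (F (omit r (omit s I)))) z)
             (d_zbar (I ! s) (d_z (omit s I ! r) (F (omit r (omit s I)))) z)"
            unfolding F_def
            by (rule has_wirtinger_smooth[OF smooth_on_d_z[OF D form_smooth[OF assms c] r] z Is(1)])
        qed
      qed
      then have "del n (del n \<omega>) c I J x = (\<Sum>s<length I. \<Sum>r<length I - 1.
           (-1) ^ s * ((-1) ^ r * d_z (I ! s) (d_z (omit s I ! r) (F (omit r (omit s I)))) z))"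
        using True by (simp add: del_def[of n "del n \<omega>"] sum_distrib_left flip: z_def)
      \<comment> \<open>The symmetric function is the iterated derivative of the component with the
        remaining indices.\<close>
      also have "\<dots> = 0"
        by (rule double_omit_sum_eq_0[of I "\<lambda>i j L. d_z i (d_z j (F L)) z"])
          (use True in \<open>auto simp: F_def intro!: d_z_commute[OF D z form_smooth[OF assms c]]\<close>)
      finally show ?thesis by simp
    next
      case False
      \<comment> \<open>Forms are compared as functions of every chart, so charts outside the atlas
        count as well; all components vanish there.\<close>
      then have "in_chart c (del n \<omega> c K J) = (\<lambda>_. 0)" for K
        using del_eq_0[OF assms, of c K J] by (auto simp: in_chart_def fun_eq_iff)
      then show ?thesis by (simp add: del_def[of n "del n \<omega>"] has_wirtinger_imp_d_z[OF has_wirtinger_const])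
    qed
  next
    case False
    then show ?thesis by (auto simp: del_def[of n "del n \<omega>"])
  qed
qed

lemma delbar_eq_0:
  assumes "\<omega> \<in> forms n \<A> p q" "c \<notin> \<A>"
  shows "delbar n \<omega> c I J x = 0"
  using del_eq_0[OF conj_form_forms[OF assms(1)], of c J I x] assms(2)
  by (simp add: delbar_eq_conj[OF assms(1)] cscale_def conj_form_def)

text \<open>Mixed derivatives commute, so the sign is that of \<open>delbar\<close> alone: in one
  order it is taken on the full list \<open>I\<close>, in the other on a list already shortened by
  \<open>del\<close>.\<close>

lemma del_delbar:
  assumes "\<omega> \<in> forms n \<A> p q"
  shows "del n (delbar n \<omega>) = - delbar n (del n \<omega>)"
proof (intro ext)
  fix c I J x
  show "del n (delbar n \<omega>) c I J x = (- delbar n (del n \<omega>)) c I J x"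
  proof (cases "x \<in> fst c \<and> set I \<subseteq> {..<n} \<and> set J \<subseteq> {..<n}")
    case True
    define z where "z = snd c x"
    define F where "F = (\<lambda>s t. in_chart c (\<omega> c (omit s I) (omit t J)))"
    show ?thesis
    proof (cases "c \<in> \<A>")
      case c: True
      note D = openC_chart[OF c]
      note smF = form_smooth[OF assms c]
      have z: "z \<in> snd c ` fst c" using True by (simp add: z_def)
      have I: "I ! s < n" "set (omit s I) \<subseteq> {..<n}" if "s < length I" for s
        using True that set_omit_subset[of s I] by (auto simp: subset_iff)
      have J: "J ! t < n" "set (omit t J) \<subseteq> {..<n}" if "t < length J" for t
        using True that set_omit_subset[of t J] by (auto simp: subset_iff)
      have "d_z (I ! s) (in_chart c (delbar n \<omega> c (omit s I) J)) z
          = (-1) ^ (length I - 1) * (\<Sum>t<length J. (-1) ^ t * d_z (I ! s) (d_zbar (J ! t) (F s t)) z)"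
        if s: "s < length I" for s
      proof -
        have eq: "d_z (I ! s) (in_chart c (delbar n \<omega> c (omit s I) J)) z
            = d_z (I ! s) (\<lambda>w. (-1) ^ (length I - 1) * (\<Sum>t<length J. (-1) ^ t * d_zbar (J ! t) (F s t) w)) z"
          by (rule d_z_cong(1)[OF D z I(1)[OF s]])
            (use True I(2)[OF s] s in_chart_delbar[OF c] in \<open>auto simp: F_def length_omit\<close>)
        show ?thesis unfolding eq
        proof (rule has_wirtinger_imp_d_z, rule has_wirtinger_cmult, rule has_wirtinger_sum, rule has_wirtinger_cmult)
          fix t assume "t \<in> {..<length J}"
          then show "has_wirtinger (I ! s) (d_zbar (J ! t) (F s t)) z
             (d_z (I ! s) (d_zbar (J ! t) (F s t)) z) (d_zbar (I ! s) (d_zbar (J ! t) (F s t)) z)"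
            unfolding F_def
            by (intro has_wirtinger_smooth[OF smooth_on_d_zbar[OF D smF J(1)] z I(1)[OF s]]) auto
        qed
      qed
      then have 1: "del n (delbar n \<omega>) c I J x = (\<Sum>s<length I. \<Sum>t<length J.
           (-1) ^ s * ((-1) ^ (length I - 1) * ((-1) ^ t * d_z (I ! s) (d_zbar (J ! t) (F s t)) z)))"
        using True by (simp add: del_def[of n "delbar n \<omega>"] sum_distrib_left flip: z_def)
      have "d_zbar (J ! t) (in_chart c (del n \<omega> c I (omit t J))) z
          = (\<Sum>s<length I. (-1) ^ s * d_zbar (J ! t) (d_z (I ! s) (F s t)) z)"
        if t: "t < length J" for t
      proof -
        have eq: "d_zbar (J ! t) (in_chart c (del n \<omega> c I (omit t J))) z
            = d_zbar (J ! t) (\<lambda>w. \<Sum>s<length I. (-1) ^ s * d_z (I ! s) (F s t) w) z"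
          by (rule d_z_cong(2)[OF D z J(1)[OF t]])
            (use True J(2)[OF t] t in_chart_del[OF c] in \<open>auto simp: F_def\<close>)
        show ?thesis unfolding eq
        proof (rule has_wirtinger_imp_d_zbar, rule has_wirtinger_sum, rule has_wirtinger_cmult)
          fix s assume "s \<in> {..<length I}"
          then show "has_wirtinger (J ! t) (d_z (I ! s) (F s t)) z
             (d_z (J ! t) (d_z (I ! s) (F s t)) z) (d_zbar (J ! t) (d_z (I ! s) (F s t)) z)"
            unfolding F_def
            by (intro has_wirtinger_smooth[OF smooth_on_d_z[OF D smF I(1)] z J(1)[OF t]]) auto
        qed
      qed
      then have 2: "delbar n (del n \<omega>) c I J x = (\<Sum>t<length J. \<Sum>s<length I.
           (-1) ^ length I * ((-1) ^ t * ((-1) ^ s * d_zbar (J ! t) (d_z (I ! s) (F s t)) z)))"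
        using True by (simp add: delbar_def[of n "del n \<omega>"] sum_distrib_left flip: z_def)
      have "(-1) ^ s * ((-1) ^ (length I - 1) * ((-1) ^ t * d_z (I ! s) (d_zbar (J ! t) (F s t)) z))
          = - ((-1) ^ length I * ((-1) ^ t * ((-1) ^ s * d_zbar (J ! t) (d_z (I ! s) (F s t)) z)))"
        if "s < length I" "t < length J" for s t
      proof -
        have "d_z (I ! s) (d_zbar (J ! t) (F s t)) z = d_zbar (J ! t) (d_z (I ! s) (F s t)) z"
          unfolding F_def by (rule d_z_d_zbar_commute[OF D z smF I(1)[OF that(1)] J(1)[OF that(2)]])
        moreover have "(-1 :: complex) ^ length I = - ((-1) ^ (length I - 1))"
          using that(1) by (cases "length I") auto
        ultimately show ?thesis by simp
      qed
      then show ?thesis unfolding fun_Compl_def uminus_apply 1 2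
        by (subst (2) sum.swap) (simp flip: sum_negf)
    next
      case False
      have "in_chart c (delbar n \<omega> c K J) = (\<lambda>_. 0)" "in_chart c (del n \<omega> c I K) = (\<lambda>_. 0)" for K
        using False del_eq_0[OF assms, of c I K] delbar_eq_0[OF assms, of c K J]
        by (auto simp: in_chart_def fun_eq_iff)
      then show ?thesis
        by (simp add: del_def[of n "delbar n \<omega>"] delbar_def[of n "del n \<omega>"]
            has_wirtinger_imp_d_z[OF has_wirtinger_const] has_wirtinger_imp_d_zbar[OF has_wirtinger_const])
    qed
  next
    case False
    then show ?thesis by (auto simp: del_def[of n "delbar n \<omega>"] delbar_def[of n "del n \<omega>"])
  qed
qed

end

section \<open>The transformation law for the derivative of a form\<close>

lemma alternating_cong:
  assumes "alternating n k G" "\<And>I. I \<in> indices n k \<Longrightarrow> G I = G' I"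
  shows "alternating n k G'"
  unfolding alternating_def
proof (intro ballI allI impI)
  fix I s t assume *: "I \<in> indices n k" "s < k" "t < k" "s \<noteq> t"
  show "G' (swap_entries s t I) = - G' I"
    using alternatingD[OF assms(1) *] assms(2)[OF *(1)] assms(2)[OF swap_entries_indices[OF *(1-3)]] by simp
qed

text \<open>\<open>W\<close> stands for the components in the other chart, \<open>J\<close> for the
  Jacobian and \<open>S\<close> for the second derivatives of the transition map. Antisymmetry of
  \<open>W\<close> moves the differentiated slot \<open>r\<close> to the front at the cost of
  (-1)^r; what is left is the double sum of \<open>double_omit_sum_eq_0\<close>.\<close>

lemma second_derivative_terms_cancel:
  fixes J :: "nat \<Rightarrow> nat \<Rightarrow> complex"
  assumes W: "alternating n p W"
    and sym: "\<And>i j a. i < n \<Longrightarrow> j < n \<Longrightarrow> a < n \<Longrightarrow> S i j a = S j i a"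
    and I: "I \<in> indices n (Suc p)"
  shows "(\<Sum>s<Suc p. (-1) ^ s * (\<Sum>A\<in>indices n p. W A *
           (\<Sum>r<p. S (I ! s) (omit s I ! r) (A ! r) * (\<Prod>l\<in>{..<p} - {r}. J (A ! l) (omit s I ! l))))) = 0"
proof (cases p)
  case 0
  then show ?thesis by simp
next
  case (Suc k)
  \<comment> \<open>The contraction with the differentiated slot put first; it is symmetric in
    \<open>i\<close> and \<open>j\<close> because \<open>S\<close> is.\<close>
  define H where "H = (\<lambda>i j L. \<Sum>a<n. \<Sum>A\<in>indices n k. W (a # A) * (S i j a * (\<Prod>l<k. J (A ! l) (L ! l))))"
  have len: "length I = Suc p" and In: "set I \<subseteq> {..<n}" using I by (auto simp: indices_def)
  have term_eq: "(\<Sum>A\<in>indices n p. W A * (S i j (A ! r) * (\<Prod>l\<in>{..<p} - {r}. J (A ! l) (K ! l))))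
      = (-1) ^ r * H i j (omit r K)" if r: "r < p" and K: "length K = p" for i j r K
  proof -
    have "(\<Sum>A\<in>indices n p. W A * (S i j (A ! r) * (\<Prod>l\<in>{..<p} - {r}. J (A ! l) (K ! l))))
        = (\<Sum>A\<in>indices n (Suc k). (-1) ^ r * (W (A ! r # omit r A) * (S i j (A ! r) * (\<Prod>l<k. J (omit r A ! l) (omit r K ! l)))))"
    proof (rule sum.cong)
      fix A assume A: "A \<in> indices n (Suc k)"
      have lA: "length A = Suc k" using A by (simp add: indices_def)
      have "A ! r < n" using A r Suc by (auto simp: indices_def subset_iff)
      then have "W (insert_at r (A ! r) (omit r A)) = (-1) ^ r * W (A ! r # omit r A)"
        using alternating_insert_at[OF W[unfolded Suc] omit_indices[OF A]] r Suc by simp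
      moreover have "insert_at r (A ! r) (omit r A) = A" using lA r Suc by (simp add: insert_at_omit)
      moreover have "(\<Prod>l\<in>{..<p} - {r}. J (A ! l) (K ! l)) = (\<Prod>l<k. J (omit r A ! l) (omit r K ! l))"
        unfolding Suc by (rule prod_remove_omit) (use lA K r Suc in auto)
      ultimately show "W A * (S i j (A ! r) * (\<Prod>l\<in>{..<p} - {r}. J (A ! l) (K ! l)))
          = (-1) ^ r * (W (A ! r # omit r A) * (S i j (A ! r) * (\<Prod>l<k. J (omit r A ! l) (omit r K ! l))))"
        by simp
    qed (simp add: Suc)
    also have "\<dots> = (-1) ^ r * H i j (omit r K)"
      unfolding H_def sum_distrib_left[symmetric]
      using sum_indices_insert_at[of r k "\<lambda>a A. W (a # A) * (S i j a * (\<Prod>l<k. J (A ! l) (omit r K ! l)))" n] r Suc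
      by simp
    finally show ?thesis .
  qed
  have "(\<Sum>A\<in>indices n p. W A *
           (\<Sum>r<p. S (I ! s) (omit s I ! r) (A ! r) * (\<Prod>l\<in>{..<p} - {r}. J (A ! l) (omit s I ! l))))
      = (\<Sum>r<p. (-1) ^ r * H (I ! s) (omit s I ! r) (omit r (omit s I)))" if "s < Suc p" for s
    unfolding sum_distrib_left
    by (subst sum.swap) (rule sum.cong, use that len in \<open>auto simp: term_eq length_omit\<close>)
  then have "(\<Sum>s<Suc p. (-1) ^ s * (\<Sum>A\<in>indices n p. W A *
           (\<Sum>r<p. S (I ! s) (omit s I ! r) (A ! r) * (\<Prod>l\<in>{..<p} - {r}. J (A ! l) (omit s I ! l)))))
      = (\<Sum>s<length I. \<Sum>r<length I - 1. (-1) ^ s * ((-1) ^ r * H (I ! s) (omit s I ! r) (omit r (omit s I))))"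
    by (simp add: len sum_distrib_left)
  also have "\<dots> = 0"
  proof (rule double_omit_sum_eq_0)
    fix i j L assume "i \<in> set I" "j \<in> set I"
    then have "S i j a = S j i a" if "a < n" for a using In that by (intro sym) auto
    then show "H i j L = H j i L" by (simp add: H_def)
  qed
  finally show ?thesis .
qed

text \<open>The index \<open>a\<close> created by the chain rule, inserted at position
  \<open>s\<close> of \<open>A\<close>, yields a list of length p+1, and its factor
  \<open>J a (I ! s)\<close> is the one missing from the Jacobian product.\<close>

lemma first_derivative_terms_transform:
  fixes J :: "nat \<Rightarrow> nat \<Rightarrow> complex"
  assumes I: "I \<in> indices n (Suc p)"
  shows "(\<Sum>s<Suc p. (-1) ^ s * (\<Sum>A\<in>indices n p. (\<Sum>a<n. V a A * J a (I ! s)) * (\<Prod>r<p. J (A ! r) (omit s I ! r))))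
    = (\<Sum>A\<in>indices n (Suc p). (\<Sum>s<Suc p. (-1) ^ s * V (A ! s) (omit s A)) * (\<Prod>r<Suc p. J (A ! r) (I ! r)))"
proof -
  have len: "length I = Suc p" using I by (simp add: indices_def)
  have "(\<Sum>A\<in>indices n p. (\<Sum>a<n. V a A * J a (I ! s)) * (\<Prod>r<p. J (A ! r) (omit s I ! r)))
      = (\<Sum>A\<in>indices n (Suc p). V (A ! s) (omit s A) * (\<Prod>r<Suc p. J (A ! r) (I ! r)))" if s: "s < Suc p" for s
  proof -
    have "(\<Sum>A\<in>indices n p. (\<Sum>a<n. V a A * J a (I ! s)) * (\<Prod>r<p. J (A ! r) (omit s I ! r)))
        = (\<Sum>a<n. \<Sum>A\<in>indices n p. V a A * J a (I ! s) * (\<Prod>r<p. J (A ! r) (omit s I ! r)))"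
      unfolding sum_distrib_right by (rule sum.swap)
    also have "\<dots> = (\<Sum>A\<in>indices n (Suc p). V (A ! s) (omit s A) * J (A ! s) (I ! s) * (\<Prod>r<p. J (omit s A ! r) (omit s I ! r)))"
      using sum_indices_insert_at[of s p "\<lambda>a A. V a A * J a (I ! s) * (\<Prod>r<p. J (A ! r) (omit s I ! r))" n] s
      by simp
    also have "\<dots> = (\<Sum>A\<in>indices n (Suc p). V (A ! s) (omit s A) * (\<Prod>r<Suc p. J (A ! r) (I ! r)))"
    proof (rule sum.cong[OF refl])
      fix A assume "A \<in> indices n (Suc p)"
      then have "length A = Suc p" by (simp add: indices_def)
      from prod_split_omit[OF this len, of s J] s
      show "V (A ! s) (omit s A) * J (A ! s) (I ! s) * (\<Prod>r<p. J (omit s A ! r) (omit s I ! r))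
          = V (A ! s) (omit s A) * (\<Prod>r<Suc p. J (A ! r) (I ! r))"
        by (simp add: mult.assoc)
    qed
    finally show ?thesis .
  qed
  then have "(\<Sum>s<Suc p. (-1) ^ s * (\<Sum>A\<in>indices n p. (\<Sum>a<n. V a A * J a (I ! s)) * (\<Prod>r<p. J (A ! r) (omit s I ! r))))
      = (\<Sum>s<Suc p. \<Sum>A\<in>indices n (Suc p). (-1) ^ s * V (A ! s) (omit s A) * (\<Prod>r<Suc p. J (A ! r) (I ! r)))"
    by (simp add: sum_distrib_left mult.assoc del: sum.lessThan_Suc prod.lessThan_Suc)
  also have "\<dots> = (\<Sum>A\<in>indices n (Suc p). (\<Sum>s<Suc p. (-1) ^ s * V (A ! s) (omit s A)) * (\<Prod>r<Suc p. J (A ! r) (I ! r)))"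
    unfolding sum_distrib_right by (rule sum.swap)
  finally show ?thesis .
qed

context complex_mfd
begin

lemma transition_holo:
  "c \<in> \<A> \<Longrightarrow> d \<in> \<A> \<Longrightarrow> a < n \<Longrightarrow> holo_on n (snd c ` (fst c \<inter> fst d)) (in_chart c (\<lambda>y. snd d y a))"
  using mfd by (auto simp: complex_manifold_def holo_compatible_def)

text \<open>The product rule for the transformation law. The conjugated Jacobian entries are
  antiholomorphic and act as constants, so only the chain rule term and the terms with second
  derivatives of the transition map remain.\<close>

lemma d_z_transformed_form:
  assumes \<omega>: "\<omega> \<in> forms n \<A> p q" and c: "c \<in> \<A>" and d: "d \<in> \<A>"
    and K: "K \<in> indices n p" and J: "J \<in> indices n q" and x: "x \<in> fst c \<inter> fst d" and i: "i < n"
  shows "d_z i (in_chart c (\<omega> c K J)) (snd c x) =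
     (\<Sum>A\<in>indices n p. \<Sum>B\<in>indices n q.
        ((\<Sum>a<n. d_z a (in_chart d (\<omega> d A B)) (snd d x) * jac c d a i x) * (\<Prod>s<p. jac c d (A ! s) (K ! s) x)
         + \<omega> d A B x * (\<Sum>r<p. d_z i (d_z (K ! r) (in_chart c (\<lambda>y. snd d y (A ! r)))) (snd c x) *
                            (\<Prod>l\<in>{..<p} - {r}. jac c d (A ! l) (K ! l) x)))
        * (\<Prod>t<q. cnj (jac c d (B ! t) (J ! t) x)))"
proof (rule has_wirtinger_imp_d_z)
  define D where "D = snd c ` (fst c \<inter> fst d)"
  define z where "z = snd c x"
  define \<tau> where "\<tau> = (\<lambda>a. in_chart c (\<lambda>y. snd d y a))"
  have D: "openC n D" and z: "z \<in> D" using openC_overlap[OF c d] x by (auto simp: D_def z_def)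
  have holo: "smooth_on n D (\<tau> a)" "\<And>w i. w \<in> D \<Longrightarrow> i < n \<Longrightarrow> d_zbar i (\<tau> a) w = 0" if "a < n" for a
    using transition_holo[OF c d that] by (auto simp: holo_on_def D_def \<tau>_def)
  have \<tau>_fold: "in_chart c (\<lambda>y. snd d y a) = \<tau> a" for a by (simp add: \<tau>_def)
  have jac: "jac c d a k x = d_z k (\<tau> a) z" for a k by (simp add: jac_def \<tau>_def z_def)
  have \<tau>_eq: "(\<lambda>a. \<tau> a (snd c y)) = snd d y" if "y \<in> fst c \<inter> fst d" for y
    using that c by (auto simp: \<tau>_def in_chart_snd)
  have idx: "A ! s < n" if "A \<in> indices n k" "s < k" for A s k
    using that by (auto simp: indices_def subset_iff)
  have w\<tau>: "has_wirtinger k (\<tau> a) z (d_z k (\<tau> a) z) 0" if "a < n" "k < n" for a k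
    using has_wirtinger_smooth[OF holo(1)[OF that(1)] z that(2)] holo(2)[OF that(1) z that(2)] by simp
  \<comment> \<open>Jacobian entries are again holomorphic: \<open>d_zbar\<close> passes through
    \<open>d_z\<close> to a function that vanishes on all of \<open>D\<close>.\<close>
  have w2: "has_wirtinger i (d_z j (\<tau> a)) z (d_z i (d_z j (\<tau> a)) z) 0" if "a < n" "j < n" for a j
  proof -
    have "d_zbar i (d_z j (\<tau> a)) z = d_z j (d_zbar i (\<tau> a)) z"
      by (rule d_z_d_zbar_commute[OF D z holo(1)[OF that(1)] that(2) i, symmetric])
    also have "\<dots> = d_z j (\<lambda>_. 0) z"
      by (rule d_z_cong(1)[OF D z that(2)]) (rule holo(2)[OF that(1) _ i])
    also have "\<dots> = 0" by (rule has_wirtinger_imp_d_z[OF has_wirtinger_const])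
    finally show ?thesis
      using has_wirtinger_smooth[OF smooth_on_d_z[OF D holo(1)[OF that(1)] that(2)] z i] by simp
  qed
  define Q1 where "Q1 = (\<lambda>A B. \<Sum>a<n. d_zbar a (in_chart d (\<omega> d A B)) (snd d x) * cnj (d_z i (\<tau> a) z))"
  have f1: "has_wirtinger i (\<lambda>w. in_chart d (\<omega> d A B) (\<lambda>a. \<tau> a w)) z
      (\<Sum>a<n. d_z a (in_chart d (\<omega> d A B)) (snd d x) * d_z i (\<tau> a) z) (Q1 A B)" for A B
  proof -
    have \<tau>z: "(\<lambda>a. \<tau> a z) = snd d x" using \<tau>_eq[OF x] by (simp add: z_def)
    have sub: "snd d y \<in> Cspace n" if "y \<in> fst d" for y
      using openC_subset[OF openC_chart[OF d]] that by blast
    have "has_wirtinger i (\<lambda>w. in_chart d (\<omega> d A B) (\<lambda>a. \<tau> a w)) z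
      (\<Sum>a<n. d_z a (in_chart d (\<omega> d A B)) (\<lambda>a. \<tau> a z) * d_z i (\<tau> a) z)
      (\<Sum>a<n. d_zbar a (in_chart d (\<omega> d A B)) (\<lambda>a. \<tau> a z) * cnj (d_z i (\<tau> a) z))"
    proof (rule has_wirtinger_chain[OF openC_chart[OF d] _ smooth_on_C1[OF form_smooth[OF \<omega> d]] D z i])
      show "(\<lambda>a. \<tau> a z) \<in> snd d ` fst d" using \<tau>z x by auto
      show "(\<lambda>a. \<tau> a w) \<in> Cspace n" if w: "w \<in> D" for w
      proof -
        obtain y where "y \<in> fst c \<inter> fst d" "w = snd c y" using w by (auto simp: D_def)
        then show ?thesis using \<tau>_eq[of y] sub[of y] by simp
      qed
    qed (use w\<tau> i in auto)
    then show ?thesis unfolding \<tau>z Q1_def .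
  qed
  have f2: "has_wirtinger i (\<lambda>w. \<Prod>s<p. d_z (K ! s) (\<tau> (A ! s)) w) z
      (\<Sum>r<p. d_z i (d_z (K ! r) (\<tau> (A ! r))) z * (\<Prod>l\<in>{..<p} - {r}. d_z (K ! l) (\<tau> (A ! l)) z)) 
      (\<Sum>r<p. 0 * (\<Prod>l\<in>{..<p} - {r}. d_z (K ! l) (\<tau> (A ! l)) z))" if "A \<in> indices n p" for A
    by (rule has_wirtinger_prod) (use K that idx w2 in auto)
  \<comment> \<open>Conjugation exchanges the two derivatives, so here the holomorphic ones are
    0.\<close>
  have f3: "has_wirtinger i (\<lambda>w. \<Prod>t<q. cnj (d_z (J ! t) (\<tau> (B ! t)) w)) z
      (\<Sum>r<q. 0 * (\<Prod>l\<in>{..<q} - {r}. cnj (d_z (J ! l) (\<tau> (B ! l)) z)))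
      (\<Sum>r<q. cnj (d_z i (d_z (J ! r) (\<tau> (B ! r))) z) * (\<Prod>l\<in>{..<q} - {r}. cnj (d_z (J ! l) (\<tau> (B ! l)) z)))"
    if "B \<in> indices n q" for B
  proof (rule has_wirtinger_prod)
    fix t assume "t \<in> {..<q}"
    then have "has_wirtinger i (d_z (J ! t) (\<tau> (B ! t))) z (d_z i (d_z (J ! t) (\<tau> (B ! t))) z) 0"
      using J that idx by (intro w2) auto
    from has_wirtinger_cnj[OF this]
    show "has_wirtinger i (\<lambda>w. cnj (d_z (J ! t) (\<tau> (B ! t)) w)) z 0 (cnj (d_z i (d_z (J ! t) (\<tau> (B ! t))) z))"
      by simp
  qed simp
  let ?P = "\<lambda>A B. ((\<Sum>a<n. d_z a (in_chart d (\<omega> d A B)) (snd d x) * jac c d a i x) * (\<Prod>s<p. jac c d (A ! s) (K ! s) x)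
         + \<omega> d A B x * (\<Sum>r<p. d_z i (d_z (K ! r) (in_chart c (\<lambda>y. snd d y (A ! r)))) (snd c x) *
                            (\<Prod>l\<in>{..<p} - {r}. jac c d (A ! l) (K ! l) x)))
        * (\<Prod>t<q. cnj (jac c d (B ! t) (J ! t) x))"
  have "in_chart d (\<omega> d A B) (\<lambda>a. \<tau> a z) = \<omega> d A B x" for A B
    using \<tau>_eq[OF x] x d by (simp add: z_def in_chart_snd)
  note at_x = this
  define F where "F = (\<lambda>A B w. in_chart d (\<omega> d A B) (\<lambda>a. \<tau> a w) * (\<Prod>s<p. d_z (K ! s) (\<tau> (A ! s)) w)
       * (\<Prod>t<q. cnj (d_z (J ! t) (\<tau> (B ! t)) w)))"
  \<comment> \<open>Only the holomorphic derivative is wanted; the other one gets a name so that the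
    sum rule for pairs applies.\<close>
  define Q where "Q = (\<lambda>A B. d_zbar i (F A B) z)"
  have Q: "has_wirtinger i (F A B) z (?P A B) (Q A B)" if "A \<in> indices n p" "B \<in> indices n q" for A B
  proof -
    have "\<exists>R. has_wirtinger i (F A B) z (?P A B) R"
      using has_wirtinger_mult[OF has_wirtinger_mult[OF f1[of A B] f2[OF that(1)]] f3[OF that(2)]]
      by (auto simp: jac \<tau>_fold z_def[symmetric] F_def at_x)
    then show ?thesis using has_wirtinger_imp_d_zbar unfolding Q_def by blast
  qed
  have "has_wirtinger i (\<lambda>w. \<Sum>A\<in>indices n p. \<Sum>B\<in>indices n q. F A B w) z
       (\<Sum>A\<in>indices n p. \<Sum>B\<in>indices n q. ?P A B) (\<Sum>A\<in>indices n p. \<Sum>B\<in>indices n q. Q A B)"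
    by (intro has_wirtinger_sum Q)
  then show "has_wirtinger i (in_chart c (\<omega> c K J)) (snd c x)
       (\<Sum>A\<in>indices n p. \<Sum>B\<in>indices n q. ?P A B) (\<Sum>A\<in>indices n p. \<Sum>B\<in>indices n q. Q A B)"
    unfolding z_def[symmetric]
  proof (rule has_wirtinger_cong[OF D z i])
    fix w assume "w \<in> D"
    then obtain y where y: "y \<in> fst c \<inter> fst d" "w = snd c y" by (auto simp: D_def)
    have "in_chart c (\<omega> c K J) w = \<omega> c K J y" using y c by (simp add: in_chart_snd)
    also have "\<dots> = (\<Sum>A\<in>indices n p. \<Sum>B\<in>indices n q.
             \<omega> d A B y * (\<Prod>s<p. jac c d (A ! s) (K ! s) y) * (\<Prod>t<q. cnj (jac c d (B ! t) (J ! t) y)))"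
      by (rule form_transform[OF \<omega> c d K J y(1)])
    also have "\<dots> = (\<Sum>A\<in>indices n p. \<Sum>B\<in>indices n q. F A B w)"
      using y d \<tau>_eq[OF y(1)] by (simp add: in_chart_snd jac_def \<tau>_fold F_def)
    finally show "(\<Sum>A\<in>indices n p. \<Sum>B\<in>indices n q. F A B w) = in_chart c (\<omega> c K J) w" by simp
  qed
qed

text \<open>Alternating summation over \<open>s\<close> separates two kinds of terms: those of
  \<open>f1\<close> reassemble into the derivative in the chart \<open>d\<close>, those of
  \<open>f2\<close> cancel. The list \<open>B\<close> and the conjugated Jacobians are
  spectators.\<close>

lemma del_transform:
  assumes \<omega>: "\<omega> \<in> forms n \<A> p q" and c: "c \<in> \<A>" and d: "d \<in> \<A>"
    and I: "I \<in> indices n (Suc p)" and J: "J \<in> indices n q" and x: "x \<in> fst c \<inter> fst d"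
  shows "del n \<omega> c I J x =
          (\<Sum>A\<in>indices n (Suc p). \<Sum>B\<in>indices n q.
             del n \<omega> d A B x * (\<Prod>s<Suc p. jac c d (A ! s) (I ! s) x)
                       * (\<Prod>t<q. cnj (jac c d (B ! t) (J ! t) x)))"
proof -
  define Jc where "Jc = (\<lambda>a i. jac c d a i x)"
  define cJ where "cJ = (\<lambda>B. \<Prod>t<q. cnj (jac c d (B ! t) (J ! t) x))"
  define V where "V = (\<lambda>B a A. d_z a (in_chart d (\<omega> d A B)) (snd d x))"
  define S where "S = (\<lambda>i j a. d_z i (d_z j (in_chart c (\<lambda>y. snd d y a))) (snd c x))"
  define f1 where "f1 = (\<lambda>B s A. (\<Sum>a<n. V B a A * Jc a (I ! s)) * (\<Prod>r<p. Jc (A ! r) (omit s I ! r)))"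
  define f2 where "f2 = (\<lambda>B s A. \<omega> d A B x *
       (\<Sum>r<p. S (I ! s) (omit s I ! r) (A ! r) * (\<Prod>l\<in>{..<p} - {r}. Jc (A ! l) (omit s I ! l))))"
  have lenI: "length I = Suc p" and In: "set I \<subseteq> {..<n}" and Jn: "set J \<subseteq> {..<n}"
    using I J by (auto simp: indices_def)
  have sym: "S i j a = S j i a" if "i < n" "j < n" "a < n" for i j a
    unfolding S_def
    by (rule d_z_commute[OF openC_overlap[OF c d] _ _ that(1,2)])
      (use x transition_holo[OF c d that(3)] in \<open>auto simp: holo_on_def\<close>)
  have 1: "(\<Sum>s<Suc p. (-1) ^ s * (\<Sum>A\<in>indices n p. f1 B s A))
      = (\<Sum>A\<in>indices n (Suc p). del n \<omega> d A B x * (\<Prod>s<Suc p. jac c d (A ! s) (I ! s) x))"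
    if "B \<in> indices n q" for B
    unfolding f1_def first_derivative_terms_transform[OF I]
    by (rule sum.cong[OF refl]) (use that x in \<open>auto simp: del_def V_def Jc_def indices_def\<close>)
  have 2: "(\<Sum>s<Suc p. (-1) ^ s * (\<Sum>A\<in>indices n p. f2 B s A)) = 0" for B
    unfolding f2_def by (rule second_derivative_terms_cancel[OF form_alternating1[OF \<omega>] sym I])
  have dz: "d_z (I ! s) (in_chart c (\<omega> c (omit s I) J)) (snd c x)
      = (\<Sum>B\<in>indices n q. (\<Sum>A\<in>indices n p. f1 B s A + f2 B s A) * cJ B)" if "s < Suc p" for s
  proof -
    have "I ! s < n" using In that lenI by (auto simp: subset_iff)
    from d_z_transformed_form[OF \<omega> c d omit_indices[OF I that] J x this]
    have "d_z (I ! s) (in_chart c (\<omega> c (omit s I) J)) (snd c x)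
        = (\<Sum>A\<in>indices n p. \<Sum>B\<in>indices n q. (f1 B s A + f2 B s A) * cJ B)"
      by (simp add: f1_def f2_def V_def S_def Jc_def cJ_def)
    also have "\<dots> = (\<Sum>B\<in>indices n q. (\<Sum>A\<in>indices n p. f1 B s A + f2 B s A) * cJ B)"
      by (subst sum.swap) (simp add: sum_distrib_right)
    finally show ?thesis .
  qed
  have "del n \<omega> c I J x = (\<Sum>s<Suc p. (-1) ^ s * d_z (I ! s) (in_chart c (\<omega> c (omit s I) J)) (snd c x))"
    using x In Jn lenI by (simp add: del_def)
  also have "\<dots> = (\<Sum>s<Suc p. \<Sum>B\<in>indices n q. ((-1) ^ s * (\<Sum>A\<in>indices n p. f1 B s A + f2 B s A)) * cJ B)"
    by (rule sum.cong[OF refl]) (simp only: dz lessThan_iff sum_distrib_left[where A = "indices n q"] mult.assoc)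
  also have "\<dots> = (\<Sum>B\<in>indices n q. (\<Sum>s<Suc p. (-1) ^ s * (\<Sum>A\<in>indices n p. f1 B s A + f2 B s A)) * cJ B)"
    unfolding sum_distrib_right by (rule sum.swap)
  also have "\<dots> = (\<Sum>B\<in>indices n q. (\<Sum>A\<in>indices n (Suc p). del n \<omega> d A B x * (\<Prod>s<Suc p. jac c d (A ! s) (I ! s) x)) * cJ B)"
    by (rule sum.cong[OF refl]) (simp only: sum.distrib distrib_left 1 2 add_0_right)
  also have "\<dots> = (\<Sum>A\<in>indices n (Suc p). \<Sum>B\<in>indices n q.
             del n \<omega> d A B x * (\<Prod>s<Suc p. jac c d (A ! s) (I ! s) x) * cJ B)"
    unfolding sum_distrib_right by (rule sum.swap)
  finally show ?thesis by (simp only: cJ_def)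
qed

lemma alternating_d_z:
  assumes "\<omega> \<in> forms n \<A> p q" "x \<in> fst c" "i < n"
  shows "alternating n p (\<lambda>K. d_z i (in_chart c (\<omega> c K J)) (snd c x))"
    and "alternating n q (\<lambda>L. d_z i (in_chart c (\<omega> c I L)) (snd c x))"
proof -
  have neg: "d_z i (in_chart c (\<omega> c K' L')) (snd c x) = - d_z i (in_chart c (\<omega> c K L)) (snd c x)"
    if "\<And>y. \<omega> c K' L' y = - \<omega> c K L y" for K K' L L'
  proof -
    have "in_chart c (\<omega> c K' L') = (\<lambda>w. (-1) * in_chart c (\<omega> c K L) w)"
      using that by (simp add: in_chart_def fun_eq_iff)
    then show ?thesis
      using has_wirtinger_imp_d_z[OF has_wirtinger_cmult[OF form_has_wirtinger[OF assms], of "-1"]] by simp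
  qed
  show "alternating n p (\<lambda>K. d_z i (in_chart c (\<omega> c K J)) (snd c x))"
    unfolding alternating_def
    by (intro ballI allI impI neg alternatingD[OF form_alternating1[OF assms(1)]])
  show "alternating n q (\<lambda>L. d_z i (in_chart c (\<omega> c I L)) (snd c x))"
    unfolding alternating_def
    by (intro ballI allI impI neg alternatingD[OF form_alternating2[OF assms(1)]])
qed

text \<open>Antisymmetry in the first list rests on \<open>alternating_omit_sum\<close>, because its
  entries are being omitted; in the second list it passes through each derivative
  separately.\<close>

lemma del_form:
  assumes \<omega>: "\<omega> \<in> forms n \<A> p q"
  shows "del n \<omega> \<in> forms n \<A> (Suc p) q"
proof (rule formsI)
  fix c I J assume c: "c \<in> \<A>" and I: "I \<in> indices n (Suc p)" and J: "J \<in> indices n q"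
  note D = openC_chart[OF c]
  have IJ: "set I \<subseteq> {..<n}" "set J \<subseteq> {..<n}" using I J by (auto simp: indices_def)
  have "smooth_on n (snd c ` fst c) (\<lambda>w. \<Sum>s<length I. (-1) ^ s * d_z (I ! s) (in_chart c (\<omega> c (omit s I) J)) w)"
    by (intro smooth_on_sum[OF D] smooth_on_cmult[OF D] smooth_on_d_z[OF D] form_smooth[OF \<omega> c])
      (use IJ in \<open>auto simp: subset_iff\<close>)
  then show "smooth_on n (snd c ` fst c) (in_chart c (del n \<omega> c I J))"
    by (rule smooth_on_cong[OF D]) (simp only: in_chart_del[OF c _ IJ])
next
  fix c :: "'a chart" and J x assume "J \<in> indices n q" "x \<in> fst c"
  then show "alternating n (Suc p) (\<lambda>I. del n \<omega> c I J x)"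
    by (intro alternating_cong[OF alternating_omit_sum[OF alternating_d_z(1)[OF \<omega>, of x c _ J]]])
      (auto simp: del_def indices_def)
next
  fix c :: "'a chart" and I x assume I: "I \<in> indices n (Suc p)" and x: "x \<in> fst c"
  have alt: "alternating n q (\<lambda>J. d_z (I ! s) (in_chart c (\<omega> c (omit s I) J)) (snd c x))" if "s < length I" for s
    by (rule alternating_d_z(2)[OF \<omega> x]) (use I that in \<open>auto simp: indices_def subset_iff\<close>)
  have "alternating n q (\<lambda>J. \<Sum>s<length I. (-1) ^ s * d_z (I ! s) (in_chart c (\<omega> c (omit s I) J)) (snd c x))"
    using alt by (simp add: alternating_def sum_negf)
  then show "alternating n q (\<lambda>J. del n \<omega> c I J x)"
    by (rule alternating_cong) (use I x in \<open>auto simp: del_def indices_def\<close>)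
qed ((rule del_eq_0[OF \<omega>] del_transform[OF \<omega>]; assumption)+)

lemma delbar_form:
  assumes "\<omega> \<in> forms n \<A> p q"
  shows "delbar n \<omega> \<in> forms n \<A> p (Suc q)"
  unfolding delbar_eq_conj[OF assms]
  by (intro cscale_form conj_form_forms del_form assms)

lemma delbar_delbar:
  assumes "\<omega> \<in> forms n \<A> p q"
  shows "delbar n (delbar n \<omega>) = 0"
proof -
  have "delbar n (delbar n \<omega>) = cscale ((-1) ^ p) (conj_form (del n (conj_form (delbar n \<omega>))))"
    by (rule delbar_eq_conj[OF delbar_form[OF assms]])
  \<comment> \<open>The conjugation that begins the outer \<open>delbar\<close> cancels the one that
    ends the inner \<open>delbar\<close>.\<close>
  also have "conj_form (delbar n \<omega>) = cscale ((-1) ^ p) (del n (conj_form \<omega>))"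
    by (simp add: delbar_eq_conj[OF assms] conj_form_cscale conj_form_conj_form)
  also have "del n \<dots> = 0"
    using del_cscale[OF del_form[OF conj_form_forms[OF assms]]] del_del[OF conj_form_forms[OF assms]]
    by (simp add: cscale_def fun_eq_iff)
  finally show ?thesis by (simp add: cscale_def conj_form_def fun_eq_iff)
qed

end

section \<open>Dimensions of quotients\<close>

interpretation form: vector_space "cscale :: complex \<Rightarrow> 'a form \<Rightarrow> 'a form"
  by unfold_locales (simp_all add: cscale_def fun_eq_iff algebra_simps)

interpretation form_pair: vector_space_pair
  "cscale :: complex \<Rightarrow> 'a form \<Rightarrow> 'a form" "cscale :: complex \<Rightarrow> 'a form \<Rightarrow> 'a form"
  by unfold_locales

text \<open>Vectors are functions here; the pointwise rules would rewrite eta-expanded vectors.\<close>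

declare plus_fun_apply [simp del] zero_fun_apply [simp del] minus_apply [simp del] uminus_apply [simp del]

lemma subspace_plus_self: "form.subspace W \<Longrightarrow> W + W = W"
  by (force simp: set_plus_def dest: form.subspace_add form.subspace_0)

lemma coset_eq_iff: "form.subspace W \<Longrightarrow> u +o W = v +o W \<longleftrightarrow> u - v \<in> W"
proof
  assume W: "form.subspace W" and "u +o W = v +o W"
  moreover have "u \<in> u +o W" using form.subspace_0[OF W] by (force simp: elt_set_plus_def)
  ultimately show "u - v \<in> W" by (auto simp: elt_set_plus_def)
next
  assume W: "form.subspace W" and uv: "u - v \<in> W"
  have sub: "a +o W \<subseteq> b +o W" if "a - b \<in> W" for a b
  proof
    fix y assume "y \<in> a +o W"
    then obtain w where "w \<in> W" "y = a + w" by (auto simp: elt_set_plus_def)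
    then have "y = b + ((a - b) + w)" "(a - b) + w \<in> W" using form.subspace_add[OF W that] by auto
    then show "y \<in> b +o W" unfolding elt_set_plus_def by blast
  qed
  have "v - u \<in> W" using form.subspace_neg[OF W uv] by simp
  then show "u +o W = v +o W" using sub uv by blast
qed

lemma coset_eq_self_iff: "form.subspace W \<Longrightarrow> v +o W = W \<longleftrightarrow> v \<in> W"
  using coset_eq_iff[of W v 0] by (simp add: set_zero_plus)

section \<open>Families independent modulo a subspace\<close>

definition lincomb :: "complex list \<Rightarrow> 'a form list \<Rightarrow> 'a form" where
  "lincomb as vs = sum_list (map2 cscale as vs)"

lemma lincomb_Nil [simp]: "lincomb [] [] = 0"
  and lincomb_Cons [simp]: "lincomb (a # as) (v # vs) = cscale a v + lincomb as vs"
  by (simp_all add: lincomb_def)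

lemma lincomb_in_subspace:
  assumes "form.subspace V" "length as = length vs" "set vs \<subseteq> V"
  shows "lincomb as vs \<in> V"
  using assms(2,3)
  by (induction as vs rule: list_induct2)
    (auto intro: form.subspace_0 form.subspace_add form.subspace_scale assms(1))

lemma quot_lincomb_cosets:
  assumes W: "form.subspace W" and "length as = length vs"
  shows "quot_lincomb W as (map (\<lambda>v. v +o W) vs) = lincomb as vs +o W"
  using assms(2)
proof (induction as vs rule: list_induct2)
  case Nil
  then show ?case by (simp add: set_zero_plus)
next
  case (Cons a as v vs)
  have "quot_scale W a (v +o W) = cscale a v +o W"
  proof
    show "quot_scale W a (v +o W) \<subseteq> cscale a v +o W"
      unfolding quot_scale_def elt_set_plus_def set_plus_def
      by (auto simp: form.scale_right_distrib add.assoc intro!: form.subspace_add[OF W] form.subspace_scale[OF W])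
    show "cscale a v +o W \<subseteq> quot_scale W a (v +o W)"
    proof
      fix y assume "y \<in> cscale a v +o W"
      then obtain w where "w \<in> W" "y = cscale a (v + 0) + w" by (auto simp: elt_set_plus_def)
      then show "y \<in> quot_scale W a (v +o W)"
        unfolding quot_scale_def elt_set_plus_def set_plus_def using form.subspace_0[OF W] by blast
    qed
  qed
  then show ?case using Cons by (simp add: set_plus_rearrange subspace_plus_self[OF W])
qed

text \<open>The condition of \<open>quot_indep\<close> on representatives, so that sets of cosets
  drop out of the dimension count. For \<open>W = {0}\<close> it is ordinary independence of a list,
  which excludes repetitions.\<close>

definition indep_mod :: "'a form set \<Rightarrow> 'a form list \<Rightarrow> bool" where
  "indep_mod W vs \<longleftrightarrow>
     (\<forall>as. length as = length vs \<longrightarrow> lincomb as vs \<in> W \<longrightarrow> (\<forall>a\<in>set as. a = 0))"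

lemma quot_indep_cosets:
  "form.subspace W \<Longrightarrow> quot_indep W (map (\<lambda>v. v +o W) vs) \<longleftrightarrow> indep_mod W vs"
  by (simp add: quot_indep_def indep_mod_def quot_lincomb_cosets coset_eq_self_iff cong: imp_cong)

definition dim_mod :: "'a form set \<Rightarrow> 'a form set \<Rightarrow> enat" where
  "dim_mod W V = Sup {enat (length vs) | vs. set vs \<subseteq> V \<and> indep_mod W vs}"

lemma quot_dim_quot:
  assumes W: "form.subspace W"
  shows "quot_dim W (quot V W) = dim_mod W V"
proof -
  have "(\<exists>Cs. k = enat (length Cs) \<and> set Cs \<subseteq> quot V W \<and> quot_indep W Cs)
      \<longleftrightarrow> (\<exists>vs. k = enat (length vs) \<and> set vs \<subseteq> V \<and> indep_mod W vs)" for k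
  proof
    assume "\<exists>Cs. k = enat (length Cs) \<and> set Cs \<subseteq> quot V W \<and> quot_indep W Cs"
    then obtain Cs where Cs: "k = enat (length Cs)" "set Cs \<subseteq> quot V W" "quot_indep W Cs" by blast
    then have "Cs \<in> lists ((\<lambda>v. v +o W) ` V)" by (simp add: quot_def in_lists_conv_set subset_iff)
    then obtain vs where "vs \<in> lists V" "Cs = map (\<lambda>v. v +o W) vs" by (auto simp: lists_image)
    then show "\<exists>vs. k = enat (length vs) \<and> set vs \<subseteq> V \<and> indep_mod W vs"
      using Cs quot_indep_cosets[OF W, of vs] by (intro exI[of _ vs]) auto
  next
    assume "\<exists>vs. k = enat (length vs) \<and> set vs \<subseteq> V \<and> indep_mod W vs"
    then obtain vs where "k = enat (length vs)" "set vs \<subseteq> V" "indep_mod W vs" by blast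
    then show "\<exists>Cs. k = enat (length Cs) \<and> set Cs \<subseteq> quot V W \<and> quot_indep W Cs"
      using quot_indep_cosets[OF W, of vs] by (intro exI[of _ "map (\<lambda>v. v +o W) vs"]) (auto simp: quot_def)
  qed
  then show ?thesis unfolding quot_dim_def dim_mod_def by presburger
qed

lemma lincomb_sum_nth:
  "length as = length vs \<Longrightarrow> lincomb as vs = (\<Sum>i<length vs. cscale (as ! i) (vs ! i))"
  by (simp add: lincomb_def sum_list_sum_nth atLeast0LessThan)

lemma indep_mod_0_imp_independent:
  assumes "indep_mod {0} us"
  shows "distinct us" and "form.independent (set us)"
proof -
  show d: "distinct us" unfolding distinct_conv_nth
  proof (intro allI impI notI)
    fix i j assume ij: "i < length us" "j < length us" "i \<noteq> j" "us ! i = us ! j"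
    \<comment> \<open>Coefficient 1 at \<open>i\<close> and -1 at \<open>j\<close> give the
      difference of two equal vectors.\<close>
    define as :: "complex list" where
      "as = map (\<lambda>k. (if k = i then 1 else 0) - (if k = j then 1 else 0)) [0..<length us]"
    have len: "length as = length us" by (simp add: as_def)
    have "lincomb as us = (\<Sum>k<length us. (if k = i then us ! k else 0) - (if k = j then us ! k else 0))"
      unfolding lincomb_sum_nth[OF len]
      by (rule sum.cong) (auto simp: as_def form.scale_left_diff_distrib)
    also have "\<dots> = 0" using ij by (simp add: sum_subtractf sum.delta)
    finally have "\<forall>a\<in>set as. a = 0" using assms len by (simp add: indep_mod_def)
    moreover have "as ! i = 1" "i < length as" using ij by (auto simp: as_def)
    ultimately show False by (metis nth_mem zero_neq_one)
  qed
  show "form.independent (set us)"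
  proof
    assume "form.dependent (set us)"
    then obtain u v where u: "(\<Sum>v\<in>set us. cscale (u v) v) = 0" and v: "v \<in> set us" "u v \<noteq> 0"
      by (auto simp: form.dependent_finite)
    have "lincomb (map u us) us = sum_list (map (\<lambda>v. cscale (u v) v) us)"
      by (induction us) auto
    also have "\<dots> = 0" using u d by (simp add: sum_list_distinct_conv_sum_set)
    finally have "\<forall>a\<in>set (map u us). a = 0" 
      using spec[OF assms[unfolded indep_mod_def], of "map u us"] by simp
    then show False using v by simp
  qed
qed

lemma independent_imp_indep_mod_0:
  assumes "distinct us" "form.independent (set us)"
  shows "indep_mod {0} us"
  unfolding indep_mod_def
proof (intro allI impI ballI)
  fix as a assume len: "length as = length us" and 0: "lincomb as us \<in> {0}" and a: "a \<in> set as"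
  define u where "u = (\<lambda>v. the (map_of (zip us as) v))"
  have as: "as = map u us"
    by (rule nth_equalityI) (use len assms(1) in \<open>auto simp: u_def map_of_zip_nth\<close>)
  have "lincomb (map u us) us = sum_list (map (\<lambda>v. cscale (u v) v) us)"
    by (induction us) auto
  also have "\<dots> = (\<Sum>v\<in>set us. cscale (u v) v)" using assms(1) by (simp add: sum_list_distinct_conv_sum_set)
  finally have "(\<Sum>v\<in>set us. cscale (u v) v) = 0" using 0 as by simp
  then have "u v = 0" if "v \<in> set us" for v
    using assms(2) that form.dependent_finite[of "set us"] by blast
  then show "a = 0" using a as by auto
qed

lemma linear_lincomb:
  assumes g: "Vector_Spaces.linear cscale cscale g" and "length as = length vs"
  shows "g (lincomb as vs) = lincomb as (map g vs)"
proof -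
  interpret g: Vector_Spaces.linear cscale cscale g by fact
  show ?thesis using assms(2)
    by (induction as vs rule: list_induct2) (simp_all add: g.zero g.add g.scale)
qed

text \<open>All infinite sets get the one value \<infinity>, like a supremum over arbitrarily long
  families.\<close>

definition ecard :: "'b set \<Rightarrow> enat" where
  "ecard C = (if finite C then enat (card C) else \<infinity>)"

lemma ecard_Un_disjoint: "A \<inter> B = {} \<Longrightarrow> ecard (A \<union> B) = ecard A + ecard B"
  by (simp add: ecard_def card_Un_disjoint)

text \<open>The projection \<open>g\<close> turns a family independent modulo \<open>W\<close> into
  an independent one in the span of \<open>C\<close>, which bounds its length. Conversely, since
  \<open>g\<close> kills \<open>W\<close> and fixes \<open>C\<close>, every list of distinct
  elements of \<open>C\<close> is independent modulo \<open>W\<close>.\<close>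

lemma dim_mod_eq_ecard:
  fixes W V :: "'a form set"
  assumes W: "form.subspace W" and V: "form.subspace V"
    and B: "BW \<subseteq> BV" "form.independent BV" "form.span BW = W" "form.span BV = V"
  shows "dim_mod W V = ecard (BV - BW)"
proof -
  define C where "C = BV - BW"
  \<comment> \<open>The projection of \<open>V\<close> onto the span of \<open>C\<close> along \<open>W\<close>.\<close>
  obtain g :: "'a form \<Rightarrow> 'a form" where g: "Vector_Spaces.linear cscale cscale g"
    and gB: "\<And>v. v \<in> BV \<Longrightarrow> g v = (if v \<in> C then v else 0)"
    using form_pair.linear_independent_extend[OF B(2), of "\<lambda>v. if v \<in> C then v else 0"] by blast
  interpret g: Vector_Spaces.linear cscale cscale g by fact
  have gV: "g v \<in> form.span C \<and> g v - v \<in> W" if "v \<in> V" for v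
    using that unfolding B(4)[symmetric]
  proof (induction rule: form.span_induct)
    case base
    show ?case unfolding form.subspace_def mem_Collect_eq
    proof (intro conjI ballI allI)
      fix x y a
      assume x: "x \<in> {x. g x \<in> form.span C \<and> g x - x \<in> W}"
      show "g (cscale a x) \<in> form.span C" using x by (simp add: g.scale form.span_scale)
      show "g (cscale a x) - cscale a x \<in> W"
        using x form.subspace_scale[OF W, of "g x - x" a] by (simp add: g.scale form.scale_right_diff_distrib)
      assume y: "y \<in> {x. g x \<in> form.span C \<and> g x - x \<in> W}"
      show "g (x + y) \<in> form.span C" using x y by (simp add: g.add form.span_add)
      have eq: "g (x + y) - (x + y) = (g x - x) + (g y - y)" by (simp add: g.add)
      show "g (x + y) - (x + y) \<in> W" unfolding eq by (rule form.subspace_add[OF W]) (use x y in auto)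
    qed (simp_all add: g.zero form.span_zero form.subspace_0[OF W])
  next
    case (step v)
    have "- v \<in> W" if "v \<in> BW"
      using that B(3) form.span_base form.subspace_neg[OF W] by blast
    then show ?case using step gB[OF step] B(1)
      by (auto simp: C_def form.span_base form.span_zero form.subspace_0[OF W])
  qed
  have gW: "g w = 0" if "w \<in> W" for w
    using that unfolding B(3)[symmetric]
    by (rule form_pair.linear_eq_0_on_span[OF g, rotated]) (use gB B(1) in \<open>auto simp: C_def\<close>)
  have upper: "length vs \<le> card C" if fin: "finite C" and vs: "set vs \<subseteq> V" "indep_mod W vs" for vs
  proof -
    have "indep_mod {0} (map g vs)" unfolding indep_mod_def
    proof (intro allI impI)
      fix as assume len: "length as = length (map g vs)" and "lincomb as (map g vs) \<in> {0}"
      then have "g (lincomb as vs) = 0" using linear_lincomb[OF g] by simp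
      moreover have "lincomb as vs \<in> V" using lincomb_in_subspace[OF V _ vs(1)] len by simp
      ultimately have "- lincomb as vs \<in> W" using gV by fastforce
      then have "lincomb as vs \<in> W" using form.subspace_neg[OF W] by fastforce
      then show "\<forall>a\<in>set as. a = 0" using vs(2) len by (simp add: indep_mod_def)
    qed
    note ind = indep_mod_0_imp_independent[OF this]
    have "set (map g vs) \<subseteq> form.span C" using gV vs(1) by auto
    then have "card (set (map g vs)) \<le> card C"
      using form.independent_span_bound[OF fin ind(2)] by blast
    then show ?thesis using distinct_card[OF ind(1)] by simp
  qed
  have lower: "set vs \<subseteq> V \<and> indep_mod W vs" if vs: "distinct vs" "set vs \<subseteq> C" for vs
  proof
    show "set vs \<subseteq> V" using vs(2) B(4) form.span_superset by (force simp: C_def)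
    have "form.independent (set vs)"
      using form.independent_mono[OF B(2)] vs(2) by (auto simp: C_def)
    with vs(1) have ind: "indep_mod {0} vs" by (rule independent_imp_indep_mod_0)
    show "indep_mod W vs" unfolding indep_mod_def
    proof (intro allI impI)
      fix as assume len: "length as = length vs" and "lincomb as vs \<in> W"
      then have "lincomb as (map g vs) = 0" using gW linear_lincomb[OF g len] by simp
      moreover have "map g vs = vs" by (rule map_idI) (use vs(2) gB in \<open>auto simp: C_def\<close>)
      ultimately show "\<forall>a\<in>set as. a = 0" using ind len by (simp add: indep_mod_def)
    qed
  qed
  have le: "enat (card F) \<le> dim_mod W V" if F: "finite F" "F \<subseteq> C" for F
  proof -
    obtain vs where "set vs = F" "distinct vs" using finite_distinct_list[OF F(1)] by blast
    then show ?thesis using lower[of vs] F(2) distinct_card[of vs] unfolding dim_mod_def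
      by (intro Sup_upper) auto
  qed
  show ?thesis
  proof (cases "finite C")
    case True
    have "dim_mod W V \<le> enat (card C)" unfolding dim_mod_def
      by (rule Sup_least) (use upper[OF True] in auto)
    then show ?thesis using le[OF True] True by (simp add: ecard_def flip: C_def)
  next
    case False
    have "enat k \<le> dim_mod W V" for k
      using infinite_arbitrarily_large[OF False, of k] le by blast
    then have "dim_mod W V = \<infinity>" by (metis Suc_n_not_le_n enat_ord_simps(1) not_infinity_eq)
    then show ?thesis using False by (simp add: ecard_def flip: C_def)
  qed
qed

text \<open>A basis of \<open>W\<close> is extended to one of \<open>U\<close> and that to one of
  \<open>V\<close>; the two successive differences partition the total one. Cardinalities in
  \<open>enat\<close> add over this partition, infinite ones included.\<close>

lemma dim_mod_add:
  assumes W: "form.subspace W" and U: "form.subspace U" and V: "form.subspace V" and "W \<subseteq> U" "U \<subseteq> V"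
  shows "dim_mod W V = dim_mod U V + dim_mod W U"
proof -
  have span: "form.span B = S" if "form.subspace S" "B \<subseteq> S" "S \<subseteq> form.span B" for B S
    using that form.span_minimal by blast
  obtain BW where BW: "BW \<subseteq> W" "form.independent BW" "W \<subseteq> form.span BW"
    by (rule form.maximal_independent_subset)
  obtain BU where BU: "BW \<subseteq> BU" "BU \<subseteq> U" "form.independent BU" "U \<subseteq> form.span BU"
    by (rule form.maximal_independent_subset_extend[of BW U]) (use BW \<open>W \<subseteq> U\<close> in auto)
  obtain BV where BV: "BU \<subseteq> BV" "BV \<subseteq> V" "form.independent BV" "V \<subseteq> form.span BV"
    by (rule form.maximal_independent_subset_extend[of BU V]) (use BU \<open>U \<subseteq> V\<close> in auto)
  note sW = span[OF W BW(1,3)] and sU = span[OF U BU(2,4)] and sV = span[OF V BV(2,4)]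
  have "dim_mod W V = ecard (BV - BW)"
    by (rule dim_mod_eq_ecard[OF W V _ BV(3) sW sV]) (use BU BV in auto)
  moreover have "dim_mod U V = ecard (BV - BU)" by (rule dim_mod_eq_ecard[OF U V BV(1,3) sU sV])
  moreover have "dim_mod W U = ecard (BU - BW)" by (rule dim_mod_eq_ecard[OF W U BU(1,3) sW sU])
  moreover have "BV - BW = (BV - BU) \<union> (BU - BW)" using BU BV by auto
  moreover have "(BV - BU) \<inter> (BU - BW) = {}" by auto
  ultimately show ?thesis by (simp add: ecard_Un_disjoint)
qed

text \<open>The second isomorphism theorem carried out on families: a list in \<open>Z\<close>
  serves unchanged on the right, and a list in \<open>Z + M\<close> is replaced by components in
  \<open>Z\<close>. Lengths are preserved, so both suprema run over the same set.\<close>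

lemma dim_mod_second_iso:
  fixes Z M :: "'a form set"
  assumes Z: "form.subspace Z" and M: "form.subspace M"
  shows "dim_mod (Z \<inter> M) Z = dim_mod M (Z + M)"
proof -
  have "(\<exists>vs. k = enat (length vs) \<and> set vs \<subseteq> Z \<and> indep_mod (Z \<inter> M) vs)
      \<longleftrightarrow> (\<exists>vs. k = enat (length vs) \<and> set vs \<subseteq> Z + M \<and> indep_mod M vs)" for k
  proof
    assume "\<exists>vs. k = enat (length vs) \<and> set vs \<subseteq> Z \<and> indep_mod (Z \<inter> M) vs"
    then obtain vs where vs: "k = enat (length vs)" "set vs \<subseteq> Z" "indep_mod (Z \<inter> M) vs" by blast
    have "indep_mod M vs"
      using vs(3) lincomb_in_subspace[OF Z _ vs(2)] by (auto simp: indep_mod_def)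
    moreover have "Z \<subseteq> Z + M" using form.subspace_0[OF M] by (force simp: set_plus_def)
    ultimately show "\<exists>vs. k = enat (length vs) \<and> set vs \<subseteq> Z + M \<and> indep_mod M vs"
      using vs by (intro exI[of _ vs]) auto
  next
    assume "\<exists>vs. k = enat (length vs) \<and> set vs \<subseteq> Z + M \<and> indep_mod M vs"
    then obtain vs where vs: "k = enat (length vs)" "set vs \<subseteq> Z + M" "indep_mod M vs" by blast
    have "\<forall>v\<in>Z + M. \<exists>z. z \<in> Z \<and> v - z \<in> M" by (auto simp: set_plus_def)
    \<comment> \<open>\<open>h\<close> is a mere choice of \<open>Z\<close>-components, not a linear
      map; the next fact shows that it respects linear combinations up to \<open>M\<close>.\<close>
    then obtain h where h: "\<And>v. v \<in> Z + M \<Longrightarrow> h v \<in> Z \<and> v - h v \<in> M" by (metis bchoice)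
    have diff: "length as = length us \<Longrightarrow> set us \<subseteq> Z + M \<Longrightarrow> lincomb as us - lincomb as (map h us) \<in> M" for as us
    proof (induction as us rule: list_induct2)
      case Nil
      then show ?case by (simp add: form.subspace_0[OF M])
    next
      case (Cons a as u us)
      have eq: "lincomb (a # as) (u # us) - lincomb (a # as) (map h (u # us))
          = cscale a (u - h u) + (lincomb as us - lincomb as (map h us))"
        by (simp add: form.scale_right_diff_distrib)
      show ?case unfolding eq
        by (rule form.subspace_add[OF M form.subspace_scale[OF M]]) (use Cons h[of u] in auto)
    qed
    have "indep_mod (Z \<inter> M) (map h vs)" unfolding indep_mod_def
    proof (intro allI impI)
      fix as assume "length as = length (map h vs)" "lincomb as (map h vs) \<in> Z \<inter> M"
      then have "length as = length vs" "lincomb as vs \<in> M"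
        using form.subspace_add[OF M diff[OF _ vs(2), of as], of "lincomb as (map h vs)"] by auto
      then show "\<forall>a\<in>set as. a = 0" using vs(3) by (simp add: indep_mod_def)
    qed
    then show "\<exists>vs. k = enat (length vs) \<and> set vs \<subseteq> Z \<and> indep_mod (Z \<inter> M) vs"
      using vs h by (intro exI[of _ "map h vs"]) auto
  qed
  then show ?thesis unfolding dim_mod_def by presburger
qed

text \<open>The coset of \<open>W\<close> contains \<open>\<theta>\<close> because
  \<open>0 \<in> W\<close>, and a coset of \<open>W'\<close> is determined by any of its elements,
  so exactly one target class qualifies.\<close>

lemma induced_coset:
  assumes W': "form.subspace W'" and "W \<subseteq> W'" "0 \<in> W" "\<theta> \<in> V'"
  shows "induced (quot V' W') (\<theta> +o W) = \<theta> +o W'"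
  unfolding induced_def
proof (rule the_equality)
  show "\<theta> +o W' \<in> quot V' W' \<and> \<theta> +o W \<subseteq> \<theta> +o W'"
    using assms by (auto simp: quot_def elt_set_plus_def)
  fix D assume D: "D \<in> quot V' W' \<and> \<theta> +o W \<subseteq> D"
  then obtain \<eta> where \<eta>: "D = \<eta> +o W'" by (auto simp: quot_def)
  have "\<theta> \<in> \<theta> +o W" using \<open>0 \<in> W\<close> by (force simp: elt_set_plus_def)
  then have "\<theta> - \<eta> \<in> W'" using D \<eta> by (auto simp: elt_set_plus_def)
  then show "D = \<theta> +o W'" using coset_eq_iff[OF W', of \<theta> \<eta>] \<eta> by simp
qed

lemma subspace_plus: "form.subspace U \<Longrightarrow> form.subspace V \<Longrightarrow> form.subspace (U + V)"
proof -
  have "U + V = {x + y | x y. x \<in> U \<and> y \<in> V}" by (auto simp: set_plus_def)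
  then show "form.subspace U \<Longrightarrow> form.subspace V \<Longrightarrow> form.subspace (U + V)"
    using form.subspace_sums[of U V] by simp
qed

context complex_mfd
begin

section \<open>Kernels and images of the operators\<close>

lemma subspace_forms: "form.subspace (forms n \<A> p q)"
  by (simp add: form.subspace_def zero_form add_form cscale_form)

lemma del_0 [simp]: "del n (0 :: 'a form) = 0"
  using del_cscale[OF zero_form, of 0] by simp

lemma delbar_0 [simp]: "delbar n (0 :: 'a form) = 0"
  using delbar_cscale[OF zero_form, of 0] by simp

lemma subspace_ker_del: "form.subspace (ker_del n \<A> p q)"
  using subspace_forms[of p q]
  by (auto simp: form.subspace_def ker_del_def del_add del_cscale)

lemma subspace_ker_delbar: "form.subspace (ker_delbar n \<A> p q)"
  using subspace_forms[of p q]
  by (auto simp: form.subspace_def ker_delbar_def delbar_add delbar_cscale)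

lemma subspace_im_del: "form.subspace (im_del n \<A> p q)"
proof (cases p)
  case 0
  then show ?thesis by (simp add: im_del_def)
next
  case (Suc k)
  show ?thesis unfolding form.subspace_def im_del_def Suc
    by (auto simp: image_iff intro: zero_form bexI[of _ 0] simp flip: del_add del_cscale
        intro!: add_form cscale_form)
qed

lemma subspace_im_delbar: "form.subspace (im_delbar n \<A> p q)"
proof (cases q)
  case 0
  then show ?thesis by (simp add: im_delbar_def)
next
  case (Suc k)
  show ?thesis unfolding form.subspace_def im_delbar_def Suc
    by (auto simp: image_iff intro: zero_form bexI[of _ 0] simp flip: delbar_add delbar_cscale
        intro!: add_form cscale_form)
qed

lemma im_del_subset_ker_del: "im_del n \<A> p q \<subseteq> ker_del n \<A> p q"
  using del_form[of _ "p - 1" q] del_del[of _ "p - 1" q]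
  by (cases p) (auto simp: im_del_def ker_del_def zero_form)

lemma im_delbar_subset_ker_delbar: "im_delbar n \<A> p q \<subseteq> ker_delbar n \<A> p q"
  using delbar_form[of _ p "q - 1"] delbar_delbar[of _ p "q - 1"]
  by (cases q) (auto simp: im_delbar_def ker_delbar_def zero_form)

text \<open>Anticommutation writes \<partial>\<partial>bar \<eta> as \<partial>bar (- \<partial>
  \<eta>). This is why a Bott-Chern class determines a Dolbeault class.\<close>

lemma im_del_delbar_subset_im_delbar: "im_del_delbar n \<A> p q \<subseteq> im_delbar n \<A> p q"
proof (cases "p = 0 \<or> q = 0")
  case True
  then show ?thesis using form.subspace_0[OF subspace_im_delbar] by (auto simp: im_del_delbar_def)
next
  case False
  then obtain p' q' where pq: "p = Suc p'" "q = Suc q'" by (metis not0_implies_Suc)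
  show ?thesis
  proof
    fix \<theta> assume "\<theta> \<in> im_del_delbar n \<A> p q"
    then obtain \<eta> where \<eta>: "\<eta> \<in> forms n \<A> p' q'" "\<theta> = del n (delbar n \<eta>)"
      by (auto simp: im_del_delbar_def pq)
    have "\<theta> = delbar n (cscale (-1) (del n \<eta>))"
      unfolding \<eta>(2) del_delbar[OF \<eta>(1)] delbar_cscale[OF del_form[OF \<eta>(1)]] by simp
    moreover have "cscale (-1) (del n \<eta>) \<in> forms n \<A> p (q - 1)"
      using cscale_form[OF del_form[OF \<eta>(1)], of "-1"] by (simp only: pq diff_Suc_1)
    ultimately show "\<theta> \<in> im_delbar n \<A> p q"
      unfolding im_delbar_def using pq(2) by simp
  qed
qed

lemma zero_in_im_del_delbar: "0 \<in> im_del_delbar n \<A> p q"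
  using zero_form by (auto simp: im_del_delbar_def image_iff intro!: bexI[of _ 0])

lemma ker_delbar_subset_ker_del_delbar: "ker_delbar n \<A> p q \<subseteq> ker_del_delbar n \<A> p q"
  by (auto simp: ker_delbar_def ker_del_delbar_def)

lemma dim_im_pi_delbar:
  "quot_dim (im_delbar n \<A> p q) (pi_delbar n \<A> p q ` H_BC n \<A> p q)
     = k_dim n \<A> p q + quot_dim (im_delbar n \<A> p q) (ker_pi_A n \<A> p q)"
proof -
  define B where "B = im_del n \<A> p q"
  define B' where "B' = im_delbar n \<A> p q"
  define K where "K = ker_del n \<A> p q"
  define K' where "K' = ker_delbar n \<A> p q"
  define Z where "Z = K \<inter> K'"
  define U where "U = K' \<inter> (B + B')"
  have sub: "form.subspace B" "form.subspace B'" "form.subspace K" "form.subspace K'"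
    by (simp_all add: B_def B'_def K_def K'_def subspace_im_del subspace_im_delbar subspace_ker_del subspace_ker_delbar)
  then have subZ: "form.subspace Z" and subBB: "form.subspace (B + B')"
    by (auto simp: Z_def form.subspace_inter subspace_plus)
  with sub have subU: "form.subspace U" by (simp add: U_def form.subspace_inter)
  have incl: "B \<subseteq> K" "B' \<subseteq> K'"
    by (simp_all add: B_def B'_def K_def K'_def im_del_subset_ker_del im_delbar_subset_ker_delbar)
  have B'_BB: "B' \<subseteq> B + B'" using form.subspace_0[OF sub(1)] by (force simp: set_plus_def)
  \<comment> \<open>Modular law with \<open>B' \<subseteq> K'\<close>: if \<open>b + b'\<close> lies
    in \<open>K'\<close>, so does \<open>b\<close>.\<close>
  have U_eq: "U = B \<inter> K' + B'"
  proof
    show "U \<subseteq> B \<inter> K' + B'"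
    proof
      fix \<theta> assume "\<theta> \<in> U"
      then obtain b b' where b: "\<theta> \<in> K'" "b \<in> B" "b' \<in> B'" "\<theta> = b + b'" by (auto simp: U_def set_plus_def)
      then have "b \<in> K'" using form.subspace_diff[OF sub(4), of \<theta> b'] incl(2) by auto
      then show "\<theta> \<in> B \<inter> K' + B'" using b by (auto simp: set_plus_def)
    qed
    show "B \<inter> K' + B' \<subseteq> U"
      using incl(2) form.subspace_add[OF sub(4)] by (auto simp: U_def set_plus_def)
  qed
  have B'_U: "B' \<subseteq> U" using incl(2) B'_BB by (auto simp: U_def)
  \<comment> \<open>Modular law again, now with \<open>B \<subseteq> K\<close>: if
    \<open>b + b'\<close> lies in \<open>K\<close>, so does \<open>b'\<close>.\<close>
  have ZU: "Z \<inter> U = K_denom n \<A> p q"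
  proof
    show "Z \<inter> U \<subseteq> K_denom n \<A> p q"
    proof
      fix \<theta> assume \<theta>: "\<theta> \<in> Z \<inter> U"
      then obtain b b' where b: "b \<in> B \<inter> K'" "b' \<in> B'" "\<theta> = b + b'" by (auto simp: U_eq set_plus_def)
      then have "b' \<in> K" using form.subspace_diff[OF sub(3), of \<theta> b] \<theta> incl(1) by (auto simp: Z_def)
      then show "\<theta> \<in> K_denom n \<A> p q"
        using b unfolding K_denom_def B_def B'_def K_def K'_def set_plus_def by blast
    qed
    show "K_denom n \<A> p q \<subseteq> Z \<inter> U"
      unfolding K_denom_def U_eq Z_def B_def[symmetric] B'_def[symmetric] K_def[symmetric] K'_def[symmetric]
      using incl form.subspace_add[OF sub(3)] form.subspace_add[OF sub(4)]
      by (auto simp: set_plus_def)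
  qed
  \<comment> \<open>Enlarging \<open>B'\<close> to \<open>U\<close> adds nothing, since
    \<open>B \<inter> K'\<close> already lies in \<open>Z\<close>.\<close>
  have Z_plus: "Z + B' = Z + U"
  proof
    show "Z + B' \<subseteq> Z + U" using B'_U by (rule set_plus_mono2[OF subset_refl])
    have "U \<subseteq> Z + B'" unfolding U_eq by (rule set_plus_mono2) (use incl(1) in \<open>auto simp: Z_def\<close>)
    then have "Z + U \<subseteq> Z + (Z + B')" by (rule set_plus_mono2[OF subset_refl])
    also have "\<dots> = Z + B'" by (simp add: add.assoc[symmetric] subspace_plus_self[OF subZ])
    finally show "Z + U \<subseteq> Z + B'" .
  qed
  have "pi_delbar n \<A> p q ` H_BC n \<A> p q = (\<lambda>\<theta>. \<theta> +o B') ` Z"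
    unfolding pi_delbar_def H_BC_def H_delbar_def
      B'_def[symmetric] K_def[symmetric] K'_def[symmetric] Z_def[symmetric]
    unfolding quot_def[of Z] image_image
    by (intro image_cong refl induced_coset sub zero_in_im_del_delbar)
      (use im_del_delbar_subset_im_delbar in \<open>auto simp: B'_def Z_def\<close>)
  \<comment> \<open>Replacing \<open>Z\<close> by \<open>Z + B'\<close> changes no class but gives a
    subspace containing \<open>B'\<close> and \<open>U\<close>, as the dimension count along a chain
    requires.\<close>
  also have "\<dots> = quot (Z + B') B'"
  proof -
    have "(z + b) +o B' = z +o B'" if "b \<in> B'" for z b using that by (simp add: coset_eq_iff[OF sub(2)])
    moreover have "Z \<subseteq> Z + B'" using form.subspace_0[OF sub(2)] by (force simp: set_plus_def)
    ultimately show ?thesis by (auto simp: quot_def set_plus_def)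
  qed
  finally have im: "pi_delbar n \<A> p q ` H_BC n \<A> p q = quot (Z + B') B'" .
  have "pi_A n \<A> p q (\<theta> +o B') = \<theta> +o (B + B')" if "\<theta> \<in> K'" for \<theta>
    unfolding pi_A_def H_A_def B_def[symmetric] B'_def[symmetric]
    by (rule induced_coset[OF subBB B'_BB form.subspace_0[OF sub(2)]])
      (use that ker_delbar_subset_ker_del_delbar in \<open>auto simp: K'_def\<close>)
  then have "pi_A n \<A> p q (\<theta> +o B') = B + B' \<longleftrightarrow> \<theta> \<in> B + B'" if "\<theta> \<in> K'" for \<theta>
    using that by (simp add: coset_eq_self_iff[OF subBB])
  then have ker: "ker_pi_A n \<A> p q = quot U B'"
    unfolding ker_pi_A_def H_delbar_def quot_def U_def B_def[symmetric] B'_def[symmetric] K'_def[symmetric]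
    by auto
  have "k_dim n \<A> p q = dim_mod (Z \<inter> U) Z"
    unfolding k_dim_def K_space_def ZU[symmetric] K_def[symmetric] K'_def[symmetric] Z_def[symmetric]
    by (rule quot_dim_quot[OF form.subspace_inter[OF subZ subU]])
  also have "\<dots> = dim_mod U (Z + B')"
    unfolding Z_plus by (rule dim_mod_second_iso[OF subZ subU])
  finally have k: "k_dim n \<A> p q = dim_mod U (Z + B')" .
  have "U \<subseteq> Z + B'" unfolding Z_plus using form.subspace_0[OF subZ] by (force simp: set_plus_def)
  then have "dim_mod B' (Z + B') = dim_mod U (Z + B') + dim_mod B' U"
    by (intro dim_mod_add sub subU subspace_plus subZ B'_U)
  then show ?thesis unfolding B'_def[symmetric] im ker k quot_dim_quot[OF sub(2)] .
qed

end

theorem proposition2p1: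
  fixes X :: "'a topology" and \<A> :: "'a chart set" and n p q :: nat
  assumes "compact_complex_manifold n X \<A>" and "p \<le> n" and "q \<le> n"
  shows "quot_dim (im_delbar n \<A> p q) (pi_delbar n \<A> p q ` H_BC n \<A> p q)
           = k_dim n \<A> p q + quot_dim (im_delbar n \<A> p q) (ker_pi_A n \<A> p q)"
proof -
  interpret complex_mfd n X \<A>
    by unfold_locales (use assms(1) in \<open>simp add: compact_complex_manifold_def\<close>)
  show ?thesis by (rule dim_im_pi_delbar)
qed

end
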